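(* Let $\nu>0$, let $T:\mathbb{R}\to\mathbb{R}$ be a given temperature profile, let $N\in\mathbb{N}$, and consider the linearized Boussinesq equations with vertical dissipation $$\partial_t\omega=\nu(\partial_y-t\partial_x)^2\omega+\partial_x\theta,\qquad \partial_t\partial_x\theta=-T'(y)\,\partial_x^2\Delta_t^{-1}\omega,\qquad (t,x,y)\in(0,\infty)\times\mathbb{T}\times\mathbb{R}.$$ Suppose that the Fourier transform of $T'$ satisfies $$\int(1+|\xi|)^{N+5}\,|\mathcal{F}(T')(\xi)|\,d\xi\le4^{-N}\nu^{1/3}.$$ Then there is a constant $C>0$ such that for any initial data $(\omega_0,\theta_0)\in H^N\times H^{N+1}$ and all times $t>0$ it holds that $$\|\omega(t)\|_{H^N}^2+\|\partial_x\theta(t)\|_{H^N}^2\le C(1+\nu^{-2/3})^2\left(\|\omega_0\|_{H^N}^2+\|\theta_0\|_{H^{N+1}}^2\right).$$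
   Context: The system is the linearization of the two-dimensional Boussinesq equations, with vertical dissipation in the velocity only, around $v=(y,0)$, $\theta=T(y)$. $\omega,\theta$ are the perturbations of vorticity and temperature, as functions of $(t,x,y)$ in coordinates moving with the shear: a function $f(t,x,y)$ in the original coordinates is replaced by $f(t,x+ty,y)$. $\Delta_t=\partial_x^2+(\partial_y-t\partial_x)^2$, and $\partial_x^2\Delta_t^{-1}$ is the Fourier multiplier $\frac{k^2}{k^2+(\xi-kt)^2}$ for $k\ne0$ and $0$ for $k=0$, where $(k,\xi)\in\mathbb{Z}\times\mathbb{R}$ are the frequencies dual to $(x,y)\in\mathbb{T}\times\mathbb{R}$. $H^N=H^N(\mathbb{T}\times\mathbb{R})$ is the usual Sobolev space. $\mathcal{F}(T')$ is the Fourier transform of $T'$ on $\mathbb{R}$ in the sense of tempered distributions; it may be a measure, in which case $|\mathcal{F}(T')(\xi)|\,d\xi$ denotes integration against its total variation. The normalization is such that $\mathcal{F}(\alpha)=\alpha\,\delta_0$ for a constant $\alpha$. *)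

theory Defs
  imports "HOL-Analysis.Analysis"
begin

section \<open>Fourier transform and Sobolev spaces on the cylinder\<close>

text \<open>
  The torus has period \<open>2 * pi\<close> (its frequencies are the integers) and is represented by its
  fundamental domain. Elements of L2 are functions up to null sets, so values outside the
  fundamental domain are irrelevant and periodicity is carried by the characters
  \<open>exp (i (k x + \<xi> y))\<close>.
\<close>

definition cylinder :: "(real \<times> real) measure" where
  "cylinder = restrict_space lborel {0..<2 * pi} \<Otimes>\<^sub>M lborel"

definition frequencies :: "(int \<times> real) measure" where
  "frequencies = count_space UNIV \<Otimes>\<^sub>M lborel"

definition truncated_fourier :: "real \<Rightarrow> (real \<times> real \<Rightarrow> real) \<Rightarrow> int \<times> real \<Rightarrow> complex" where
  "truncated_fourier R f = (\<lambda>(k, \<xi>).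
     complex_of_real (1 / (2 * pi)) *
     (LINT (x, y)|cylinder. indicator {-R..R} y *\<^sub>R
        (complex_of_real (f (x, y)) * cis (- (of_int k * x + \<xi> * y)))))"

text \<open>
  The Fourier--Plancherel transform of a square integrable function: the L2 limit of the
  transforms of its truncations. The factor \<open>1 / (2 * pi)\<close> above makes it unitary.
\<close>

definition has_fourier :: "(real \<times> real \<Rightarrow> real) \<Rightarrow> (int \<times> real \<Rightarrow> complex) \<Rightarrow> bool" where
  "has_fourier f F \<longleftrightarrow>
     f \<in> borel_measurable cylinder \<and> integrable cylinder (\<lambda>p. (f p)\<^sup>2) \<and>
     F \<in> borel_measurable frequencies \<and>
     ((\<lambda>R. \<integral>\<^sup>+\<kappa>. ennreal ((cmod (F \<kappa> - truncated_fourier R f \<kappa>))\<^sup>2) \<partial>frequencies) \<longlongrightarrow> 0) at_top"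

text \<open>The transform is determined up to null sets.\<close>

definition fourier :: "(real \<times> real \<Rightarrow> real) \<Rightarrow> int \<times> real \<Rightarrow> complex" where
  "fourier f = (SOME F. has_fourier f F)"

text \<open>
  The squared norm of order \<open>s\<close> is taken of the Fourier transform, since negative orders
  are needed below.
\<close>

definition sobolev_sq :: "real \<Rightarrow> (int \<times> real \<Rightarrow> complex) \<Rightarrow> ennreal" where
  "sobolev_sq s F =
     (\<integral>\<^sup>+(k, \<xi>). ennreal ((1 + (of_int k)\<^sup>2 + \<xi>\<^sup>2) powr s * (cmod (F (k, \<xi>)))\<^sup>2) \<partial>frequencies)"

text \<open>The Sobolev space of order \<open>s\<close>, for \<open>s \<ge> 0\<close> (its elements are L2 functions).\<close>

definition sobolev :: "real \<Rightarrow> (real \<times> real \<Rightarrow> real) set" where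
  "sobolev s = {f. (\<exists>F. has_fourier f F) \<and> sobolev_sq s (fourier f) < \<infinity>}"

definition sobolev_continuous :: "real \<Rightarrow> (real \<Rightarrow> int \<times> real \<Rightarrow> complex) \<Rightarrow> bool" where
  "sobolev_continuous s U \<longleftrightarrow>
     (\<forall>t\<ge>0. sobolev_sq s (U t) < \<infinity> \<and>
        ((\<lambda>r. sobolev_sq s (\<lambda>\<kappa>. U r \<kappa> - U t \<kappa>)) \<longlongrightarrow> 0) (at t within {0..}))"

definition has_sobolev_derivative ::
    "real \<Rightarrow> (real \<Rightarrow> int \<times> real \<Rightarrow> complex) \<Rightarrow> (int \<times> real \<Rightarrow> complex) \<Rightarrow> real \<Rightarrow> bool" where
  "has_sobolev_derivative s U V t \<longleftrightarrow>
     ((\<lambda>h. sobolev_sq s (\<lambda>\<kappa>. (U (t + h) \<kappa> - U t \<kappa>) / complex_of_real h - V \<kappa>)) \<longlongrightarrow> 0) (at 0)"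

section \<open>Differential operators in the moving frame, acting on Fourier transforms\<close>

definition dx :: "(int \<times> real \<Rightarrow> complex) \<Rightarrow> int \<times> real \<Rightarrow> complex" where
  "dx F = (\<lambda>(k, \<xi>). \<i> * of_int k * F (k, \<xi>))"

text \<open>The operator \<open>\<partial>\<^sub>y - t \<partial>\<^sub>x\<close>.\<close>

definition dy_shear :: "real \<Rightarrow> (int \<times> real \<Rightarrow> complex) \<Rightarrow> int \<times> real \<Rightarrow> complex" where
  "dy_shear t F = (\<lambda>(k, \<xi>). \<i> * complex_of_real (\<xi> - of_int k * t) * F (k, \<xi>))"

text \<open>The operator \<open>\<partial>\<^sub>x\<^sup>2\<close> composed with the inverse of \<open>\<Delta>\<^sub>t = \<partial>\<^sub>x\<^sup>2 + (\<partial>\<^sub>y - t \<partial>\<^sub>x)\<^sup>2\<close>.\<close>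

definition dxx_inv_laplace :: "real \<Rightarrow> (int \<times> real \<Rightarrow> complex) \<Rightarrow> int \<times> real \<Rightarrow> complex" where
  "dxx_inv_laplace t F = (\<lambda>(k, \<xi>).
     if k = 0 then 0
     else complex_of_real ((of_int k)\<^sup>2 / ((of_int k)\<^sup>2 + (\<xi> - of_int k * t)\<^sup>2)) * F (k, \<xi>))"

section \<open>Fourier transform of tempered distributions given by functions\<close>

definition schwartz :: "(real \<Rightarrow> complex) \<Rightarrow> bool" where
  "schwartz \<phi> \<longleftrightarrow> (\<exists>D :: nat \<Rightarrow> real \<Rightarrow> complex. D 0 = \<phi> \<and>
     (\<forall>n x. (D n has_vector_derivative D (Suc n) x) (at x)) \<and>
     (\<forall>n m. bounded (range (\<lambda>x. x ^ m *\<^sub>R D n x))))"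

text \<open>
  The function \<open>f\<close> acts on Schwartz functions by integration, and its distributional Fourier
  transform is the complex measure with density \<open>h\<close> with respect to the positive Borel
  measure \<open>M\<close>; the total variation of this complex measure is the one with density \<open>|h|\<close>.
  Every complex measure has this form by polar decomposition, and \<open>M = lborel\<close> is the case
  that the transform is a function. The factor \<open>1 / (2 * pi)\<close> makes the transform of a
  constant \<open>\<alpha>\<close> equal to \<open>\<alpha>\<close> times the Dirac measure at 0.
\<close>

definition has_fourier_measure :: "(real \<Rightarrow> real) \<Rightarrow> real measure \<Rightarrow> (real \<Rightarrow> complex) \<Rightarrow> bool" where
  "has_fourier_measure f M h \<longleftrightarrow>
     sets M = sets borel \<and> h \<in> borel_measurable borel \<and>
     (\<forall>\<phi>. schwartz \<phi> \<longrightarrow>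
        (let \<phi>_hat = (\<lambda>y. LINT \<xi>|lborel. \<phi> \<xi> * cis (- (\<xi> * y)))
         in integrable lborel (\<lambda>y. complex_of_real (f y) * \<phi>_hat y) \<and>
            integrable M (\<lambda>\<xi>. \<phi> \<xi> * h \<xi>) \<and>
            (LINT \<xi>|M. \<phi> \<xi> * h \<xi>) =
              complex_of_real (1 / (2 * pi)) * (LINT y|lborel. complex_of_real (f y) * \<phi>_hat y)))"

section \<open>The linearized Boussinesq equations\<close>

text \<open>
  Strong solutions with \<open>\<omega>\<close> and \<open>\<partial>\<^sub>x\<theta>\<close> continuous in time with values in the Sobolev space of
  order \<open>N\<close>. The right hand side of the vorticity equation then is of order \<open>N - 2\<close>, and this
  is where the time derivative of \<open>\<omega>\<close> is taken. The product with \<open>T'\<close> is the pointwise product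
  with the function \<open>g\<close> obtained from \<open>\<omega>\<close> by the Fourier multiplier.
\<close>

definition boussinesq_solution ::
    "real \<Rightarrow> (real \<Rightarrow> real) \<Rightarrow> nat \<Rightarrow> (real \<times> real \<Rightarrow> real) \<Rightarrow> (real \<times> real \<Rightarrow> real) \<Rightarrow>
     (real \<Rightarrow> real \<times> real \<Rightarrow> real) \<Rightarrow> (real \<Rightarrow> real \<times> real \<Rightarrow> real) \<Rightarrow> bool" where
  "boussinesq_solution \<nu> T N \<omega>\<^sub>0 \<theta>\<^sub>0 \<omega> \<theta> \<longleftrightarrow>
     \<omega> 0 = \<omega>\<^sub>0 \<and> \<theta> 0 = \<theta>\<^sub>0 \<and>
     (\<forall>t\<ge>0. \<omega> t \<in> sobolev (real N) \<and> \<theta> t \<in> sobolev 0) \<and>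
     sobolev_continuous (real N) (\<lambda>t. fourier (\<omega> t)) \<and>
     sobolev_continuous (real N) (\<lambda>t. dx (fourier (\<theta> t))) \<and>
     (\<forall>t>0. has_sobolev_derivative (real N - 2) (\<lambda>r. fourier (\<omega> r))
        (\<lambda>\<kappa>. complex_of_real \<nu> * dy_shear t (dy_shear t (fourier (\<omega> t))) \<kappa> + dx (fourier (\<theta> t)) \<kappa>) t) \<and>
     (\<forall>t>0. \<exists>g P. has_fourier g (dxx_inv_laplace t (fourier (\<omega> t))) \<and>
        has_fourier (\<lambda>(x, y). - deriv T y * g (x, y)) P \<and>
        has_sobolev_derivative (real N) (\<lambda>r. dx (fourier (\<theta> r))) P t)"

end

theory Submission
  imports Defs "HOL-Probability.Probability"
begin

text \<open>
  On the Fourier side the frequency \<open>k\<close> is a parameter, and with \<open>n = \<nu> powr (1/3)\<close> the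
  transforms \<open>U\<close> of \<open>\<omega>\<close> and \<open>V\<close> of \<open>\<partial>\<^sub>x\<theta>\<close> satisfy
  \<open>\<partial>\<^sub>t U = - n^3 (\<xi> - k t)^2 U + V\<close> and \<open>\<partial>\<^sub>t V = - F(T') * (a U)\<close>, where the convolution is
  taken in \<open>\<xi>\<close> and \<open>a = 1 / (1 + (t - \<xi> / k)^2)\<close> is concentrated around the critical time
  \<open>\<xi> / k\<close>. Two mechanisms compete. The dissipation, which for \<open>k \<noteq> 0\<close> is at least
  \<open>n^3 (t - \<xi> / k)^2\<close>, limits the response of \<open>U\<close> to a source of size one to about \<open>1 / n\<close>; so \<open>U\<close>
  is bounded by \<open>V / n\<close> up to a constant. The kernel \<open>a\<close> has integral \<open>\<pi>\<close> in time, so one passage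
  through the critical time changes \<open>V\<close> by a bounded multiple of \<open>F(T') / n\<close>, whose mass is at most
  one. Since a bounded factor is not a small one, the feedback is not closed by a contraction in
  the supremum over time. Instead \<open>V\<close> is compared with a multiple of \<open>G = exp (3 arctan (t - \<xi> / k))\<close>.
  This weight stays between two constants, and \<open>\<partial>\<^sub>t G = 3 a G\<close> makes the feedback smaller by the
  factor 3, at the price of the ratio of \<open>G\<close> at \<open>\<xi> - \<eta>\<close> and \<open>\<xi>\<close>. The ratio is at most
  \<open>(1 + |\<eta>|)^5\<close> (\<open>exp_arctan_shift\<close>), and this is where the five moments of \<open>F(T')\<close> beyond
  the order \<open>N\<close> are spent. The response constant of the dissipation is \<open>25 \<pi> / 27\<close>
  (\<open>lag_step\<close>, \<open>lag_le\<close>), and \<open>25 \<pi> / 81 < 1\<close> closes the argument.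

  Concretely, there is a time independent function \<open>Y\<close> in the Sobolev space of order \<open>N\<close>, a Neumann series
  (\<open>neumann_series\<close>), such that \<open>V\<close> is dominated almost everywhere by \<open>G Y\<close> and, for
  \<open>k \<noteq> 0\<close>, \<open>U\<close> by the decaying initial vorticity plus \<open>G Y\<close> times the response \<open>lag n\<close>. As \<open>U t\<close>
  and \<open>V t\<close> are determined only up to null sets depending on \<open>t\<close>, no pointwise differential inequality is
  available. Instead the squared norm \<open>e t\<close> of the parts of \<open>|U|\<close> and \<open>|V|\<close> above their majorants
  satisfies a backward difference inequality (\<open>comparison_principle\<close>). Backward differences are the right ones because the unbounded dissipation then
  enters only through a factor \<open>1 + \<tau> d \<ge> 1\<close>; this is the stability of the implicit
  Euler scheme.

  To know the time derivative of \<open>V\<close>, the transform of the product of \<open>T'\<close> with a square integrable function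
  has to be bounded by a convolution. For this \<open>T'\<close> is identified almost everywhere with the
  inverse transform of the measure, by testing with Gaussians and uniqueness of characteristic
  functions (\<open>has_fourier_measure_inversion\<close>); the truncated transforms then satisfy the
  convolution bound by Fubini's theorem, and it passes to the limit (\<open>has_fourier_mult_le\<close>).
\<close>

section \<open>Weighted square norms and convolution in the vertical frequency\<close>

definition freq_weight :: "int \<times> real \<Rightarrow> real" where
  "freq_weight \<kappa> = 1 + (of_int (fst \<kappa>))\<^sup>2 + (snd \<kappa>)\<^sup>2"

text \<open>
  The integrands take values in the extended nonnegative reals, where truncated subtraction is the
  positive part and nonnegative series need no convergence proof.
\<close>
definition weighted_sq :: "real \<Rightarrow> (int \<times> real \<Rightarrow> ennreal) \<Rightarrow> ennreal" where
  "weighted_sq s f = (\<integral>\<^sup>+\<kappa>. ennreal (freq_weight \<kappa> powr s) * (f \<kappa>)\<^sup>2 \<partial>frequencies)"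

definition conv :: "real measure \<Rightarrow> (int \<times> real \<Rightarrow> ennreal) \<Rightarrow> int \<times> real \<Rightarrow> ennreal" where
  "conv \<mu> f = (\<lambda>(k, \<xi>). \<integral>\<^sup>+\<eta>. f (k, \<xi> - \<eta>) \<partial>\<mu>)"

lemma freq_weight_ge1: "freq_weight \<kappa> \<ge> 1"
  by (simp add: freq_weight_def)

lemma freq_weight_pos: "freq_weight \<kappa> > 0"
  using freq_weight_ge1[of \<kappa>] by linarith

lemma measurable_fst_frequencies [measurable]: "fst \<in> measurable frequencies (count_space UNIV)"
  by (simp add: frequencies_def)

lemma measurable_snd_frequencies [measurable]: "snd \<in> borel_measurable frequencies"
  by (simp add: frequencies_def)

lemma measurable_Pair_frequencies [measurable (raw)]:
  assumes "f \<in> measurable N (count_space UNIV)" "g \<in> borel_measurable N"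
  shows "(\<lambda>x. (f x, g x)) \<in> measurable N frequencies"
  using assms by (simp add: frequencies_def)

lemma space_frequencies [simp]: "space frequencies = UNIV"
  by (simp add: frequencies_def space_pair_measure)

lemma sigma_finite_frequencies: "sigma_finite_measure frequencies"
  unfolding frequencies_def
  by (intro sigma_finite_pair_measure sigma_finite_measure_count_space_countable
        sigma_finite_lborel) auto

lemma borel_measurable_freq_weight [measurable]: "freq_weight \<in> borel_measurable frequencies"
  unfolding freq_weight_def [abs_def] by measurable

lemma sobolev_sq_eq_weighted_sq:
  "sobolev_sq s F = weighted_sq s (\<lambda>\<kappa>. ennreal (cmod (F \<kappa>)))"
  unfolding sobolev_sq_def weighted_sq_def freq_weight_def
  by (intro nn_integral_cong) (auto simp: case_prod_beta ennreal_mult ennreal_power)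

lemma weighted_sq_mono_AE:
  assumes "AE \<kappa> in frequencies. f \<kappa> \<le> g \<kappa>"
  shows "weighted_sq s f \<le> weighted_sq s g"
  unfolding weighted_sq_def
  using assms by (intro nn_integral_mono_AE) (auto elim!: eventually_mono intro!: mult_left_mono power_mono)

lemma weighted_sq_mono:
  "(\<And>\<kappa>. f \<kappa> \<le> g \<kappa>) \<Longrightarrow> weighted_sq s f \<le> weighted_sq s g"
  by (intro weighted_sq_mono_AE) auto

lemma weighted_sq_order_mono:
  assumes "s \<le> s'"
  shows "weighted_sq s f \<le> weighted_sq s' f"
  unfolding weighted_sq_def using assms freq_weight_ge1
  by (intro nn_integral_mono mult_right_mono ennreal_leI powr_mono) auto

lemma weighted_sq_eq_0_iff:
  assumes [measurable]: "f \<in> borel_measurable frequencies"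
  shows "weighted_sq s f = 0 \<longleftrightarrow> (AE \<kappa> in frequencies. f \<kappa> = 0)"
proof -
  have "freq_weight \<kappa> powr s > 0" for \<kappa>
    using freq_weight_pos[of \<kappa>] by simp
  then have "ennreal (freq_weight \<kappa> powr s) \<noteq> 0" for \<kappa>
    by (metis ennreal_eq_0_iff not_le)
  then have *: "ennreal (freq_weight \<kappa> powr s) * (f \<kappa>)\<^sup>2 = 0 \<longleftrightarrow> f \<kappa> = 0" for \<kappa>
    by simp
  have "(\<lambda>\<kappa>. ennreal (freq_weight \<kappa> powr s) * (f \<kappa>)\<^sup>2) \<in> borel_measurable frequencies"
    by measurable
  then show ?thesis
    unfolding weighted_sq_def by (simp only: nn_integral_0_iff_AE *)
qed

lemma weighted_sq_cmult:
  assumes [measurable]: "f \<in> borel_measurable frequencies"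
  shows "weighted_sq s (\<lambda>\<kappa>. c * f \<kappa>) = c\<^sup>2 * weighted_sq s f"
  unfolding weighted_sq_def
  by (subst nn_integral_cmult [symmetric]) (auto simp: power_mult_distrib mult_ac)

text \<open>
  The square of a sum with an adjustable constant: a factor \<open>1 + e\<close> arbitrarily close to one in front
  of the main term allows difference quotients to be estimated without square roots.
\<close>
lemma ennreal_square_add_le:
  fixes a b :: ennreal
  assumes "e > 0"
  shows "(a + b)\<^sup>2 \<le> ennreal (1 + e) * a\<^sup>2 + ennreal (1 + 1 / e) * b\<^sup>2"
proof (cases a; cases b)
  fix x y assume xy: "a = ennreal x" "b = ennreal y" "x \<ge> 0" "y \<ge> 0"
  have "0 \<le> (sqrt e * x - y / sqrt e)\<^sup>2" by simp
  also have "\<dots> = e * x\<^sup>2 + y\<^sup>2 / e - 2 * x * y"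
    using assms by (simp add: power2_diff power_mult_distrib power_divide)
  finally have "(x + y)\<^sup>2 \<le> (1 + e) * x\<^sup>2 + (1 + 1 / e) * y\<^sup>2"
    by (simp add: power2_sum algebra_simps)
  then show ?thesis using xy assms
    by (simp add: ennreal_power ennreal_mult [symmetric] ennreal_plus [symmetric] ennreal_leI
             del: ennreal_plus)
qed (use assms in \<open>auto simp: ennreal_mult_top power2_eq_square ennreal_mult_eq_top_iff\<close>)

lemma weighted_sq_add_le:
  assumes [measurable]: "f \<in> borel_measurable frequencies" "g \<in> borel_measurable frequencies"
    and "e > 0"
  shows "weighted_sq s (\<lambda>\<kappa>. f \<kappa> + g \<kappa>) \<le> ennreal (1 + e) * weighted_sq s f + ennreal (1 + 1 / e) * weighted_sq s g"
proof -
  have "weighted_sq s (\<lambda>\<kappa>. f \<kappa> + g \<kappa>) \<le> (\<integral>\<^sup>+\<kappa>. ennreal (freq_weight \<kappa> powr s) *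
      (ennreal (1 + e) * (f \<kappa>)\<^sup>2 + ennreal (1 + 1 / e) * (g \<kappa>)\<^sup>2) \<partial>frequencies)"
    unfolding weighted_sq_def
    by (intro nn_integral_mono mult_left_mono ennreal_square_add_le assms) auto
  also have "\<dots> = (\<integral>\<^sup>+\<kappa>. ennreal (1 + e) * (ennreal (freq_weight \<kappa> powr s) * (f \<kappa>)\<^sup>2) +
      ennreal (1 + 1 / e) * (ennreal (freq_weight \<kappa> powr s) * (g \<kappa>)\<^sup>2) \<partial>frequencies)"
    by (intro nn_integral_cong) (simp add: distrib_left mult_ac)
  also have "\<dots> = ennreal (1 + e) * weighted_sq s f + ennreal (1 + 1 / e) * weighted_sq s g"
    unfolding weighted_sq_def by (subst nn_integral_add) (auto simp: nn_integral_cmult)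
  finally show ?thesis .
qed

lemma weighted_sq_add_le2:
  assumes [measurable]: "f \<in> borel_measurable frequencies" "g \<in> borel_measurable frequencies"
  shows "weighted_sq s (\<lambda>\<kappa>. f \<kappa> + g \<kappa>) \<le> 2 * weighted_sq s f + 2 * weighted_sq s g"
  using weighted_sq_add_le[OF assms, of 1 s] by simp

text \<open>
  Peetre's inequality. It holds for orders of both signs because the roles of the two frequencies can
  be exchanged.
\<close>
lemma freq_weight_shift:
  assumes "\<bar>s\<bar> \<le> p"
  shows "freq_weight (k, \<xi>) powr (s / 2) \<le> freq_weight (k, \<xi> - \<eta>) powr (s / 2) * (1 + \<bar>\<eta>\<bar>) powr p"
proof -
  have key: "freq_weight (k, x + y) \<le> freq_weight (k, x) * (1 + \<bar>y\<bar>)\<^sup>2" for x y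
  proof -
    have "2 * \<bar>x\<bar> \<le> 1 + x\<^sup>2" using sum_squares_bound[of 1 "\<bar>x\<bar>"] by simp
    then have "2 * \<bar>x\<bar> * \<bar>y\<bar> \<le> (1 + x\<^sup>2) * \<bar>y\<bar>" by (intro mult_right_mono) auto
    then have "2 * (x * y) \<le> (1 + x\<^sup>2) * \<bar>y\<bar>"
      using abs_ge_self[of "x * y"] by (simp add: abs_mult mult.assoc)
    moreover have "freq_weight (k, x) * (1 + \<bar>y\<bar>)\<^sup>2 = 1 + (real_of_int k)\<^sup>2 + x\<^sup>2 + y\<^sup>2 +
        ((real_of_int k)\<^sup>2 + x\<^sup>2) * y\<^sup>2 + 2 * (real_of_int k)\<^sup>2 * \<bar>y\<bar> + 2 * ((1 + x\<^sup>2) * \<bar>y\<bar>)"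
      by (simp add: freq_weight_def power2_sum algebra_simps)
    moreover have "0 \<le> (1 + x\<^sup>2) * \<bar>y\<bar>" "0 \<le> ((real_of_int k)\<^sup>2 + x\<^sup>2) * y\<^sup>2" "0 \<le> 2 * (real_of_int k)\<^sup>2 * \<bar>y\<bar>"
      by auto
    moreover have "freq_weight (k, x + y) = 1 + (real_of_int k)\<^sup>2 + x\<^sup>2 + y\<^sup>2 + 2 * (x * y)"
      by (simp add: freq_weight_def power2_sum)
    ultimately show ?thesis by linarith
  qed
  define v w where "v = freq_weight (k, \<xi>)" and "w = freq_weight (k, \<xi> - \<eta>)"
  define b where "b = (1 + \<bar>\<eta>\<bar>)\<^sup>2"
  have vw: "v \<le> w * b" "w \<le> v * b"
    using key[of "\<xi> - \<eta>" \<eta>] key[of \<xi> "- \<eta>"] by (simp_all add: v_def w_def b_def)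
  have pos: "v > 0" "w > 0" "b \<ge> 1" using freq_weight_pos by (auto simp: v_def w_def b_def)
  have bp: "b powr (\<bar>s\<bar> / 2) \<le> (1 + \<bar>\<eta>\<bar>) powr p"
  proof -
    have "b powr (\<bar>s\<bar> / 2) = (1 + \<bar>\<eta>\<bar>) powr \<bar>s\<bar>"
      unfolding b_def by (simp add: powr_powr flip: powr_numeral)
    also have "\<dots> \<le> (1 + \<bar>\<eta>\<bar>) powr p" using assms by (intro powr_mono) auto
    finally show ?thesis .
  qed
  have "v powr (s / 2) \<le> w powr (s / 2) * b powr (\<bar>s\<bar> / 2)"
  proof (cases "s \<ge> 0")
    case True
    have "v powr (s / 2) \<le> (w * b) powr (s / 2)" using vw pos True by (intro powr_mono2) auto
    then show ?thesis using True pos by (simp add: powr_mult)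
  next
    case False
    have "w powr (- s / 2) \<le> (v * b) powr (- s / 2)" using vw pos False by (intro powr_mono2) auto
    then have "w powr (- s / 2) \<le> v powr (- s / 2) * b powr (- s / 2)" using pos by (simp add: powr_mult)
    then show ?thesis using False pos by (simp add: powr_minus field_simps)
  qed
  also have "\<dots> \<le> w powr (s / 2) * (1 + \<bar>\<eta>\<bar>) powr p"
    using bp by (intro mult_left_mono) auto
  finally show ?thesis by (simp add: v_def w_def)
qed

lemma nn_integral_frequencies_shift:
  assumes [measurable]: "f \<in> borel_measurable frequencies"
  shows "(\<integral>\<^sup>+\<kappa>. f (fst \<kappa>, snd \<kappa> - \<eta>) \<partial>frequencies) = (\<integral>\<^sup>+\<kappa>. f \<kappa> \<partial>frequencies)"
proof -
  have f: "f \<in> borel_measurable (count_space UNIV \<Otimes>\<^sub>M lborel)"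
    using assms by (simp add: frequencies_def)
  have "(\<integral>\<^sup>+\<kappa>. f (fst \<kappa>, snd \<kappa> - \<eta>) \<partial>frequencies) =
      (\<integral>\<^sup>+k. \<integral>\<^sup>+\<xi>. f (k, \<xi> - \<eta>) \<partial>lborel \<partial>count_space UNIV)"
    unfolding frequencies_def using f
    by (subst lborel.nn_integral_fst [symmetric]) auto
  also have "\<dots> = (\<integral>\<^sup>+k. \<integral>\<^sup>+\<xi>. f (k, \<xi>) \<partial>lborel \<partial>count_space UNIV)"
  proof (rule nn_integral_cong)
    fix k :: int
    show "(\<integral>\<^sup>+\<xi>. f (k, \<xi> - \<eta>) \<partial>lborel) = (\<integral>\<^sup>+\<xi>. f (k, \<xi>) \<partial>lborel)"
      by (subst nn_integral_real_affine[where c = 1 and t = "- \<eta>" and f = "\<lambda>\<xi>. f (k, \<xi>)"]) auto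
  qed
  also have "\<dots> = (\<integral>\<^sup>+\<kappa>. f \<kappa> \<partial>frequencies)"
    unfolding frequencies_def using f by (subst lborel.nn_integral_fst) auto
  finally show ?thesis .
qed

lemma borel_measurable_conv:
  assumes "sigma_finite_measure \<mu>" and sets [measurable_cong]: "sets \<mu> = sets borel"
    and [measurable]: "f \<in> borel_measurable frequencies"
  shows "conv \<mu> f \<in> borel_measurable frequencies"
proof -
  interpret sigma_finite_measure \<mu> by fact
  show ?thesis unfolding conv_def case_prod_beta by measurable
qed

lemma conv_mono: "(\<And>\<kappa>. f \<kappa> \<le> g \<kappa>) \<Longrightarrow> conv \<mu> f \<kappa> \<le> conv \<mu> g \<kappa>"
  unfolding conv_def case_prod_beta by (intro nn_integral_mono) auto

lemma conv_add:
  assumes [measurable_cong]: "sets \<mu> = sets borel"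
    and [measurable]: "f \<in> borel_measurable frequencies" "g \<in> borel_measurable frequencies"
  shows "conv \<mu> (\<lambda>\<kappa>. f \<kappa> + g \<kappa>) \<kappa> = conv \<mu> f \<kappa> + conv \<mu> g \<kappa>"
  unfolding conv_def case_prod_beta by (intro nn_integral_add) auto

lemma conv_cmult:
  assumes [measurable_cong]: "sets \<mu> = sets borel"
    and [measurable]: "f \<in> borel_measurable frequencies"
  shows "conv \<mu> (\<lambda>\<kappa>. c * f \<kappa>) \<kappa> = c * conv \<mu> f \<kappa>"
  unfolding conv_def case_prod_beta by (intro nn_integral_cmult) auto

text \<open>
  Young's inequality with weights. Peetre's inequality moves the weight under the convolution,
  the Cauchy--Schwarz inequality with one half of \<open>(1 + |\<eta>|) powr p\<close> in each factor gives one moment,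
  and integration over the frequencies gives the other.
\<close>
lemma weighted_sq_conv_le:
  assumes "sigma_finite_measure \<mu>" and sets [measurable_cong]: "sets \<mu> = sets borel"
    and [measurable]: "f \<in> borel_measurable frequencies" and p: "\<bar>s\<bar> \<le> p"
  shows "weighted_sq s (conv \<mu> f) \<le> (\<integral>\<^sup>+\<eta>. ennreal ((1 + \<bar>\<eta>\<bar>) powr p) \<partial>\<mu>)\<^sup>2 * weighted_sq s f"
proof -
  interpret mu: sigma_finite_measure \<mu> by fact
  interpret fr: sigma_finite_measure frequencies by (rule sigma_finite_frequencies)
  interpret pair_sigma_finite \<mu> frequencies ..
  define m where "m = (\<integral>\<^sup>+\<eta>. ennreal ((1 + \<bar>\<eta>\<bar>) powr p) \<partial>\<mu>)"
  define \<Phi> where "\<Phi> \<kappa> = ennreal (freq_weight \<kappa> powr s) * (f \<kappa>)\<^sup>2" for \<kappa>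
  have [measurable]: "\<Phi> \<in> borel_measurable frequencies" unfolding \<Phi>_def by measurable
  have sq: "(ennreal (x powr (s / 2)))\<^sup>2 = ennreal (x powr s)" for x s
    by (simp add: power2_eq_square flip: powr_add ennreal_mult)
  have pt: "ennreal (freq_weight \<kappa> powr s) * (conv \<mu> f \<kappa>)\<^sup>2 \<le>
      m * (\<integral>\<^sup>+\<eta>. \<Phi> (fst \<kappa>, snd \<kappa> - \<eta>) * ennreal ((1 + \<bar>\<eta>\<bar>) powr p) \<partial>\<mu>)" for \<kappa>
  proof -
    obtain k \<xi> where \<kappa>: "\<kappa> = (k, \<xi>)" by (cases \<kappa>)
    let ?b = "\<lambda>\<eta>::real. ennreal ((1 + \<bar>\<eta>\<bar>) powr (p / 2))"
    let ?g = "\<lambda>\<eta>. ennreal (freq_weight (k, \<xi> - \<eta>) powr (s / 2)) * f (k, \<xi> - \<eta>) * ?b \<eta>"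
    have "ennreal (freq_weight \<kappa> powr (s / 2)) * conv \<mu> f \<kappa> =
        (\<integral>\<^sup>+\<eta>. ennreal (freq_weight (k, \<xi>) powr (s / 2)) * f (k, \<xi> - \<eta>) \<partial>\<mu>)"
      unfolding conv_def \<kappa> by (simp add: nn_integral_cmult)
    also have "\<dots> \<le> (\<integral>\<^sup>+\<eta>. ?g \<eta> * ?b \<eta> \<partial>\<mu>)"
    proof (intro nn_integral_mono)
      fix \<eta>
      have "ennreal (freq_weight (k, \<xi>) powr (s / 2)) \<le> ennreal (freq_weight (k, \<xi> - \<eta>) powr (s / 2)) * (?b \<eta>)\<^sup>2"
        using freq_weight_shift[OF p, of k \<xi> \<eta>] by (simp add: sq ennreal_leI flip: ennreal_mult)
      then have "ennreal (freq_weight (k, \<xi>) powr (s / 2)) * f (k, \<xi> - \<eta>) \<le> ennreal (freq_weight (k, \<xi> - \<eta>) powr (s / 2)) * (?b \<eta>)\<^sup>2 * f (k, \<xi> - \<eta>)"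
        by (intro mult_right_mono) auto
      then show "ennreal (freq_weight (k, \<xi>) powr (s / 2)) * f (k, \<xi> - \<eta>) \<le>
          ?g \<eta> * ?b \<eta>"
        by (simp add: power2_eq_square mult_ac)
    qed
    finally have le: "ennreal (freq_weight \<kappa> powr (s / 2)) * conv \<mu> f \<kappa> \<le>
        (\<integral>\<^sup>+\<eta>. ?g \<eta> * ?b \<eta> \<partial>\<mu>)" .
    have "ennreal (freq_weight \<kappa> powr s) * (conv \<mu> f \<kappa>)\<^sup>2 =
        (ennreal (freq_weight \<kappa> powr (s / 2)) * conv \<mu> f \<kappa>)\<^sup>2"
      by (simp add: power_mult_distrib sq)
    also have "\<dots> \<le> (\<integral>\<^sup>+\<eta>. ?g \<eta> * ?b \<eta> \<partial>\<mu>)\<^sup>2"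
      by (intro power_mono le) auto
    also have "\<dots> \<le> (\<integral>\<^sup>+\<eta>. (?g \<eta>)\<^sup>2 \<partial>\<mu>) *
        (\<integral>\<^sup>+\<eta>. (?b \<eta>)\<^sup>2 \<partial>\<mu>)"
      by (rule Cauchy_Schwarz_nn_integral) measurable
    also have "\<dots> = (\<integral>\<^sup>+\<eta>. \<Phi> (fst \<kappa>, snd \<kappa> - \<eta>) * ennreal ((1 + \<bar>\<eta>\<bar>) powr p) \<partial>\<mu>) * m"
      by (simp only: \<kappa> power_mult_distrib sq m_def \<Phi>_def fst_conv snd_conv)
    finally show ?thesis by (simp only: mult.commute)
  qed
  have "weighted_sq s (conv \<mu> f) \<le>
      (\<integral>\<^sup>+\<kappa>. m * (\<integral>\<^sup>+\<eta>. \<Phi> (fst \<kappa>, snd \<kappa> - \<eta>) * ennreal ((1 + \<bar>\<eta>\<bar>) powr p) \<partial>\<mu>) \<partial>frequencies)"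
    unfolding weighted_sq_def by (intro nn_integral_mono pt)
  also have "\<dots> = m * (\<integral>\<^sup>+\<kappa>. (\<integral>\<^sup>+\<eta>. \<Phi> (fst \<kappa>, snd \<kappa> - \<eta>) * ennreal ((1 + \<bar>\<eta>\<bar>) powr p) \<partial>\<mu>) \<partial>frequencies)"
    by (intro nn_integral_cmult) measurable
  also have "(\<integral>\<^sup>+\<kappa>. (\<integral>\<^sup>+\<eta>. \<Phi> (fst \<kappa>, snd \<kappa> - \<eta>) * ennreal ((1 + \<bar>\<eta>\<bar>) powr p) \<partial>\<mu>) \<partial>frequencies) =
      (\<integral>\<^sup>+\<eta>. (\<integral>\<^sup>+\<kappa>. \<Phi> (fst \<kappa>, snd \<kappa> - \<eta>) * ennreal ((1 + \<bar>\<eta>\<bar>) powr p) \<partial>frequencies) \<partial>\<mu>)"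
    by (rule Fubini') measurable
  also have "\<dots> = (\<integral>\<^sup>+\<eta>. (\<integral>\<^sup>+\<kappa>. \<Phi> \<kappa> \<partial>frequencies) * ennreal ((1 + \<bar>\<eta>\<bar>) powr p) \<partial>\<mu>)"
    by (simp add: nn_integral_multc nn_integral_frequencies_shift)
  also have "\<dots> = (\<integral>\<^sup>+\<kappa>. \<Phi> \<kappa> \<partial>frequencies) * m"
    by (simp add: nn_integral_cmult m_def)
  also have "m * ((\<integral>\<^sup>+\<kappa>. \<Phi> \<kappa> \<partial>frequencies) * m) = m\<^sup>2 * weighted_sq s f"
    by (simp add: weighted_sq_def \<Phi>_def power2_eq_square mult_ac)
  finally show ?thesis by (simp add: m_def)
qed

lemma ennreal_mult_mult:
  "0 \<le> a \<Longrightarrow> 0 \<le> b \<Longrightarrow> ennreal a * (ennreal b * x) = ennreal (a * b) * x"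
  by (simp add: ennreal_mult mult.assoc)

text \<open>
  The fixed point is the sum of the iterates \<open>u n\<close>. Since the norm enters squared, the sum is estimated
  by the Cauchy--Schwarz inequality for series with the weights \<open>r ^ n\<close>, which yields
  the constant that the triangle inequality would give.
\<close>
lemma neumann_series:
  assumes mu: "sigma_finite_measure \<mu>" and sets [measurable_cong]: "sets \<mu> = sets borel"
    and f [measurable]: "f \<in> borel_measurable frequencies" and r: "0 < r" "r < 1"
    and contr: "\<And>g. g \<in> borel_measurable frequencies \<Longrightarrow>
      weighted_sq s (conv \<mu> g) \<le> ennreal (r\<^sup>2) * weighted_sq s g"
    and zero: "\<And>\<xi>. f (0, \<xi>) = 0"
  shows "\<exists>Y. Y \<in> borel_measurable frequencies \<and> (\<forall>\<kappa>. Y \<kappa> = f \<kappa> + conv \<mu> Y \<kappa>) \<and>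
    (\<forall>\<xi>. Y (0, \<xi>) = 0) \<and> weighted_sq s Y \<le> ennreal (1 / (1 - r)\<^sup>2) * weighted_sq s f"
proof -
  define u where "u n = (conv \<mu> ^^ n) f" for n
  define Y where "Y \<kappa> = (\<Sum>n. u n \<kappa>)" for \<kappa>
  have u0: "u 0 = f" and uS: "u (Suc n) = conv \<mu> (u n)" for n by (simp_all add: u_def)
  have um [measurable]: "u n \<in> borel_measurable frequencies" for n
    by (induction n) (use mu sets f in \<open>auto simp: u0 uS intro: borel_measurable_conv\<close>)
  have Ym [measurable]: "Y \<in> borel_measurable frequencies" unfolding Y_def by measurable
  have fixpoint: "Y \<kappa> = f \<kappa> + conv \<mu> Y \<kappa>" for \<kappa>
  proof -
    have "conv \<mu> Y \<kappa> = (\<Sum>n. u (Suc n) \<kappa>)"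
      unfolding uS unfolding conv_def case_prod_beta Y_def by (intro nn_integral_suminf) measurable
    moreover have "(\<lambda>n. u n \<kappa>) sums (f \<kappa> + (\<Sum>n. u (Suc n) \<kappa>))"
      using sums_Suc[OF summable_sums[OF summableI], of "\<lambda>n. u n \<kappa>"] by (simp add: u0 add.commute)
    ultimately show ?thesis unfolding Y_def by (simp add: sums_iff)
  qed
  have Y_zero: "Y (0, \<xi>) = 0" for \<xi>
  proof -
    have "u n (0, \<xi>) = 0" for n \<xi>
      by (induction n arbitrary: \<xi>) (auto simp: u0 uS zero conv_def)
    then show ?thesis by (simp add: Y_def)
  qed
  have un: "weighted_sq s (u n) \<le> ennreal (r ^ (2 * n)) * weighted_sq s f" for n
  proof (induction n)
    case (Suc n)
    have "weighted_sq s (u (Suc n)) \<le> ennreal (r\<^sup>2) * weighted_sq s (u n)"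
      unfolding uS by (rule contr) measurable
    also have "\<dots> \<le> ennreal (r\<^sup>2) * (ennreal (r ^ (2 * n)) * weighted_sq s f)"
      by (intro mult_left_mono Suc) auto
    also have "\<dots> = ennreal (r ^ (2 * Suc n)) * weighted_sq s f"
      using r by (simp add: ennreal_mult_mult power2_eq_square mult.assoc)
    finally show ?case .
  qed (simp add: u0)
  have geo: "(\<Sum>n. ennreal (r ^ n)) = ennreal (1 / (1 - r))"
    using r by (intro suminf_ennreal_eq) (auto intro!: geometric_sums)
  have pt: "(Y \<kappa>)\<^sup>2 \<le> ennreal (1 / (1 - r)) * (\<Sum>n. ennreal (1 / r ^ n) * (u n \<kappa>)\<^sup>2)" for \<kappa>
  proof -
    let ?a = "\<lambda>n. ennreal (sqrt (r ^ n))" and ?b = "\<lambda>n. ennreal (1 / sqrt (r ^ n)) * u n \<kappa>"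
    have ab: "?a n * ?b n = u n \<kappa>" for n
      using r by (simp add: ennreal_mult_mult [of _ _ "u n \<kappa>"])
    have a2: "(?a n)\<^sup>2 = ennreal (r ^ n)" and b2: "(?b n)\<^sup>2 = ennreal (1 / r ^ n) * (u n \<kappa>)\<^sup>2" for n
      using r by (simp_all add: ennreal_power power_mult_distrib power_divide)
    have "(\<integral>\<^sup>+n. ?a n * ?b n \<partial>count_space UNIV)\<^sup>2 \<le>
        (\<integral>\<^sup>+n. (?a n)\<^sup>2 \<partial>count_space UNIV) * (\<integral>\<^sup>+n. (?b n)\<^sup>2 \<partial>count_space UNIV)"
      by (rule Cauchy_Schwarz_nn_integral) auto
    then show ?thesis by (simp only: ab a2 b2 nn_integral_count_space_nat Y_def geo)
  qed
  have "weighted_sq s Y \<le> (\<integral>\<^sup>+\<kappa>. ennreal (1 / (1 - r)) *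
      (\<Sum>n. ennreal (1 / r ^ n) * (ennreal (freq_weight \<kappa> powr s) * (u n \<kappa>)\<^sup>2)) \<partial>frequencies)"
    unfolding weighted_sq_def
  proof (intro nn_integral_mono)
    fix \<kappa>
    have "ennreal (freq_weight \<kappa> powr s) * (Y \<kappa>)\<^sup>2 \<le>
        ennreal (freq_weight \<kappa> powr s) * (ennreal (1 / (1 - r)) * (\<Sum>n. ennreal (1 / r ^ n) * (u n \<kappa>)\<^sup>2))"
      by (intro mult_left_mono pt) auto
    also have "\<dots> = ennreal (1 / (1 - r)) * (\<Sum>n. ennreal (freq_weight \<kappa> powr s) * (ennreal (1 / r ^ n) * (u n \<kappa>)\<^sup>2))"
      by (simp only: ennreal_suminf_cmult mult.left_commute)
    finally show "ennreal (freq_weight \<kappa> powr s) * (Y \<kappa>)\<^sup>2 \<le> ennreal (1 / (1 - r)) *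
      (\<Sum>n. ennreal (1 / r ^ n) * (ennreal (freq_weight \<kappa> powr s) * (u n \<kappa>)\<^sup>2))"
      by (simp only: mult.left_commute)
  qed
  also have "\<dots> = ennreal (1 / (1 - r)) * (\<Sum>n. ennreal (1 / r ^ n) * weighted_sq s (u n))"
    unfolding weighted_sq_def
    by (simp add: nn_integral_cmult nn_integral_suminf)
  also have "\<dots> \<le> ennreal (1 / (1 - r)) * (\<Sum>n. ennreal (r ^ n) * weighted_sq s f)"
  proof (intro mult_left_mono suminf_le)
    fix n
    have "ennreal (1 / r ^ n) * weighted_sq s (u n) \<le> ennreal (1 / r ^ n) * (ennreal (r ^ (2 * n)) * weighted_sq s f)"
      by (intro mult_left_mono un) auto
    also have "\<dots> = ennreal (r ^ n) * weighted_sq s f"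
      using r by (simp add: ennreal_mult_mult mult_2 power_add)
    finally show "ennreal (1 / r ^ n) * weighted_sq s (u n) \<le> ennreal (r ^ n) * weighted_sq s f" .
  qed auto
  also have "(\<Sum>n. ennreal (r ^ n) * weighted_sq s f) = ennreal (1 / (1 - r)) * weighted_sq s f"
    by (simp add: geo)
  also have "ennreal (1 / (1 - r)) * (ennreal (1 / (1 - r)) * weighted_sq s f) = ennreal (1 / (1 - r)\<^sup>2) * weighted_sq s f"
    using r by (simp add: ennreal_mult_mult power2_eq_square)
  finally have "weighted_sq s Y \<le> ennreal (1 / (1 - r)\<^sup>2) * weighted_sq s f" .
  with Ym fixpoint Y_zero show ?thesis by blast
qed

section \<open>Inversion when the Fourier transform is a finite measure\<close>
lemma borel_measurable_cis [measurable]: "cis \<in> borel_measurable borel"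
  by (intro borel_measurable_continuous_onI continuous_intros)

lemma power_le_fact_mult_exp:
  fixes x :: real
  assumes "x \<ge> 0"
  shows "x ^ n \<le> fact n * exp x"
proof -
  have "(\<Sum>k\<in>{n}. inverse (fact k) *\<^sub>R x ^ k) \<le> (\<Sum>k. inverse (fact k) *\<^sub>R x ^ k)"
    using assms summable_exp_generic[of x] by (intro sum_le_suminf) auto
  then show ?thesis by (simp add: exp_def field_simps)
qed

lemma bounded_power_mult_gauss: "bounded (range (\<lambda>x::real. x ^ n * exp (- x\<^sup>2 / 2)))"
proof -
  have "norm (x ^ n * exp (- x\<^sup>2 / 2)) \<le> fact n * exp (1 / 2)" for x :: real
  proof -
    have "0 \<le> (\<bar>x\<bar> - 1)\<^sup>2" by simp
    then have "\<bar>x\<bar> - x\<^sup>2 / 2 \<le> 1 / 2" by (simp add: power2_diff)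
    have "norm (x ^ n * exp (- x\<^sup>2 / 2)) = \<bar>x\<bar> ^ n * exp (- x\<^sup>2 / 2)"
      by (simp add: abs_mult power_abs)
    also have "\<dots> \<le> fact n * exp \<bar>x\<bar> * exp (- x\<^sup>2 / 2)"
      by (intro mult_right_mono power_le_fact_mult_exp) auto
    also have "\<dots> = fact n * exp (\<bar>x\<bar> - x\<^sup>2 / 2)"
      by (simp add: mult.assoc flip: exp_add)
    also have "\<dots> \<le> fact n * exp (1 / 2)"
      using \<open>\<bar>x\<bar> - x\<^sup>2 / 2 \<le> 1 / 2\<close> by (intro mult_left_mono) auto
    finally show ?thesis .
  qed
  then show ?thesis by (auto simp: bounded_iff)
qed

lemma bounded_poly_mult_gauss: "bounded (range (\<lambda>x::real. poly p x * exp (- x\<^sup>2 / 2)))"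
proof -
  have "bounded (range (\<lambda>x::real. x ^ n * poly p x * exp (- x\<^sup>2 / 2)))" for n
  proof (induction p arbitrary: n)
    case 0
    then show ?case by simp
  next
    case (pCons c p)
    have "x ^ n * poly (pCons c p) x * exp (- x\<^sup>2 / 2) =
        c * (x ^ n * exp (- x\<^sup>2 / 2)) + x ^ Suc n * poly p x * exp (- x\<^sup>2 / 2)" for x :: real
      by (simp add: algebra_simps)
    moreover have "bounded (range (\<lambda>x. c * (x ^ n * exp (- x\<^sup>2 / 2)) + x ^ Suc n * poly p x * exp (- x\<^sup>2 / 2)))"
    proof (rule bounded_plus_comp)
      show "bounded (range (\<lambda>x. c * (x ^ n * exp (- x\<^sup>2 / 2))))"
        using bounded_scaling[OF bounded_power_mult_gauss[of n], of c] by (simp add: image_image)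
      show "bounded (range (\<lambda>x. x ^ Suc n * poly p x * exp (- x\<^sup>2 / 2)))"
        by (rule pCons.IH)
    qed
    ultimately show ?case by simp
  qed
  from this[of 0] show ?thesis by simp
qed

text \<open>
  The derivatives of a Gaussian are Gaussians times polynomials \<open>p n\<close> (the Hermite polynomials up to sign).
\<close>
lemma schwartz_gauss: "schwartz (\<lambda>\<xi>. complex_of_real (exp (- (\<xi> - a)\<^sup>2 / 2)))"
proof -
  define p :: "nat \<Rightarrow> real poly" where "p = rec_nat 1 (\<lambda>_ q. pderiv q - [:0, 1:] * q)"
  have p: "p 0 = 1" "p (Suc n) = pderiv (p n) - [:0, 1:] * p n" for n
    by (simp_all add: p_def)
  define D where "D n x = complex_of_real (poly (p n) (x - a) * exp (- (x - a)\<^sup>2 / 2))" for n x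
  show ?thesis unfolding schwartz_def
  proof (intro exI[of _ D] conjI allI)
    show "D 0 = (\<lambda>\<xi>. complex_of_real (exp (- (\<xi> - a)\<^sup>2 / 2)))"
      by (simp add: D_def p fun_eq_iff)
    fix n x
    have "((\<lambda>x. poly (p n) (x - a) * exp (- (x - a)\<^sup>2 / 2)) has_real_derivative
        poly (p (Suc n)) (x - a) * exp (- (x - a)\<^sup>2 / 2)) (at x)"
      by (auto intro!: derivative_eq_intros DERIV_chain2[OF poly_DERIV] simp: p algebra_simps add_divide_distrib diff_divide_distrib)
    then show "(D n has_vector_derivative D (Suc n) x) (at x)"
      unfolding D_def [abs_def]
      by (intro has_vector_derivative_of_real) (simp add: has_real_derivative_iff_has_vector_derivative)
  next
    fix n m
    let ?q = "[:a, 1:] ^ m * p n"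
    have "norm (x ^ m *\<^sub>R D n x) = norm (poly ?q (x - a) * exp (- (x - a)\<^sup>2 / 2))" for x
      by (simp add: D_def norm_mult abs_mult power_abs del: of_real_mult)
    moreover obtain B where B: "\<And>x. norm (poly ?q x * exp (- x\<^sup>2 / 2)) \<le> B"
      using bounded_poly_mult_gauss[of ?q] by (auto simp: bounded_iff)
    ultimately show "bounded (range (\<lambda>x. x ^ m *\<^sub>R D n x))"
      unfolding bounded_iff using B[of "x - a" for x] by (intro exI[of _ B]) auto
  qed
qed

lemma gauss_fourier:
  "(LINT \<xi>|lborel. complex_of_real (exp (- (\<xi> - a)\<^sup>2 / 2)) * cis (- (\<xi> * y))) =
     complex_of_real (sqrt (2 * pi) * exp (- y\<^sup>2 / 2)) * cis (- (a * y))"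
proof -
  have "complex_of_real (exp (- ((- y)\<^sup>2) / 2)) = char std_normal_distribution (- y)"
    by (simp add: char_std_normal_distribution)
  also have "\<dots> = (LINT x|lborel. std_normal_density x *\<^sub>R iexp (- y * x))"
    unfolding char_def by (subst integral_density) auto
  also have "\<dots> = (LINT x|lborel. complex_of_real (1 / sqrt (2 * pi)) * (complex_of_real (exp (- x\<^sup>2 / 2)) * cis (- (x * y))))"
    by (intro Bochner_Integration.integral_cong)
      (auto simp: std_normal_density_def cis_conv_exp scaleR_conv_of_real mult_ac)
  also have "\<dots> = complex_of_real (1 / sqrt (2 * pi)) * (LINT x|lborel. complex_of_real (exp (- x\<^sup>2 / 2)) * cis (- (x * y)))"
    by simp
  finally have char: "complex_of_real (exp (- (- y)\<^sup>2 / 2)) =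
      complex_of_real (1 / sqrt (2 * pi)) * (LINT x|lborel. complex_of_real (exp (- x\<^sup>2 / 2)) * cis (- (x * y)))" (is "_ = _ * ?I") .
  have "?I = complex_of_real (sqrt (2 * pi) * (1 / sqrt (2 * pi))) * ?I"
    by simp
  also have "\<dots> = complex_of_real (sqrt (2 * pi)) * complex_of_real (exp (- (- y)\<^sup>2 / 2))"
    unfolding char by (simp only: of_real_mult mult.assoc)
  finally have *: "?I = complex_of_real (sqrt (2 * pi) * exp (- y\<^sup>2 / 2))"
    by (simp only: of_real_mult power2_minus)
  have "(LINT \<xi>|lborel. complex_of_real (exp (- (\<xi> - a)\<^sup>2 / 2)) * cis (- (\<xi> * y))) =
      (LINT x|lborel. (complex_of_real (exp (- x\<^sup>2 / 2)) * cis (- (x * y))) * cis (- (a * y)))"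
    by (subst lborel_integral_real_affine[where c = 1 and t = a])
      (auto simp: cis_mult algebra_simps intro!: Bochner_Integration.integral_cong)
  also have "\<dots> = complex_of_real (sqrt (2 * pi) * exp (- y\<^sup>2 / 2)) * cis (- (a * y))"
    by (simp only: integral_mult_left_zero *)
  finally show ?thesis .
qed

lemma integrable_gauss: "integrable lborel (\<lambda>x::real. exp (- x\<^sup>2 / 2))"
proof -
  have "integrable lborel (\<lambda>x. sqrt (2 * pi) * std_normal_density x)"
    using integrable_std_normal_moment[of 0] by simp
  then show ?thesis by (simp add: std_normal_density_def)
qed

text \<open>
  The positive and the negative part have equal mass, since the transform vanishes at 0. After
  normalization they are densities of probability measures with the same characteristic function.
\<close>
lemma zero_fourier_imp_AE_zero_real:
  fixes r :: "real \<Rightarrow> real"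
  assumes r: "integrable lborel r"
    and zero: "\<And>a. (LINT y|lborel. complex_of_real (r y) * cis (a * y)) = 0"
  shows "AE y in lborel. r y = 0"
proof -
  define P where "P y = max 0 (r y)" for y
  define Q where "Q y = max 0 (- r y)" for y
  have [measurable]: "r \<in> borel_measurable borel"
    using borel_measurable_integrable[OF r] by simp
  have [measurable]: "P \<in> borel_measurable borel" "Q \<in> borel_measurable borel"
    unfolding P_def Q_def by measurable
  have int: "integrable lborel P" "integrable lborel Q"
    unfolding P_def Q_def using r by (auto intro!: integrable_max)
  have nn: "P y \<ge> 0" "Q y \<ge> 0" for y by (auto simp: P_def Q_def)
  have rPQ: "r y = P y - Q y" for y by (auto simp: P_def Q_def)
  have intc: "integrable lborel (\<lambda>y. complex_of_real (P y) * cis (a * y))"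
    "integrable lborel (\<lambda>y. complex_of_real (Q y) * cis (a * y))" for a
    by (rule Bochner_Integration.integrable_bound[OF int(1)], measurable, simp add: norm_mult)
       (rule Bochner_Integration.integrable_bound[OF int(2)], measurable, simp add: norm_mult)
  have PQ: "(LINT y|lborel. complex_of_real (P y) * cis (a * y)) = (LINT y|lborel. complex_of_real (Q y) * cis (a * y))" for a
    using zero[of a] intc[of a] by (simp add: rPQ left_diff_distrib)
  define c where "c = (LINT y|lborel. P y)"
  have cQ: "c = (LINT y|lborel. Q y)"
    using PQ[of 0] by (simp add: c_def)
  have c0: "c \<ge> 0" unfolding c_def using nn by simp
  show ?thesis
  proof (cases "c = 0")
    case True
    have "AE y in lborel. P y = 0" "AE y in lborel. Q y = 0"
      using integral_nonneg_eq_0_iff_AE[OF int(1)] integral_nonneg_eq_0_iff_AE[OF int(2)] nn True c_def cQ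
      by auto
    then show ?thesis by eventually_elim (simp add: rPQ)
  next
    case False
    then have c: "c > 0" using c0 by simp
    have dist: "real_distribution (density lborel (\<lambda>y. ennreal (F y / c)))"
      and ch: "char (density lborel (\<lambda>y. ennreal (F y / c))) t = (LINT y|lborel. complex_of_real (F y) * cis (t * y)) / complex_of_real c"
      if F: "integrable lborel F" "\<And>y. F y \<ge> 0" "(LINT y|lborel. F y) = c" for F t
    proof -
      have [measurable]: "F \<in> borel_measurable borel" using borel_measurable_integrable[OF F(1)] by simp
      have "(\<integral>\<^sup>+y. ennreal (F y / c) \<partial>lborel) = ennreal (LINT y|lborel. F y / c)"
        using F c by (intro nn_integral_eq_integral) auto
      then have "prob_space (density lborel (\<lambda>y. ennreal (F y / c)))"
        using F c by (intro prob_spaceI) (simp add: emeasure_density)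
      then show "real_distribution (density lborel (\<lambda>y. ennreal (F y / c)))"
        by (simp add: real_distribution_def real_distribution_axioms_def)
      have "char (density lborel (\<lambda>y. ennreal (F y / c))) t = (LINT y|lborel. (F y / c) *\<^sub>R iexp (t * y))"
        unfolding char_def using F c by (subst integral_density) auto
      also have "\<dots> = (LINT y|lborel. complex_of_real (F y) * cis (t * y) / complex_of_real c)"
        by (intro Bochner_Integration.integral_cong) (auto simp: cis_conv_exp scaleR_conv_of_real)
      finally show "char (density lborel (\<lambda>y. ennreal (F y / c))) t = (LINT y|lborel. complex_of_real (F y) * cis (t * y)) / complex_of_real c"
        by simp
    qed
    have "density lborel (\<lambda>y. ennreal (P y / c)) = density lborel (\<lambda>y. ennreal (Q y / c))"
    proof (rule Levy_uniqueness)
      show "char (density lborel (\<lambda>y. ennreal (P y / c))) = char (density lborel (\<lambda>y. ennreal (Q y / c)))"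
        using PQ by (auto simp: ch int nn c_def [symmetric] cQ [symmetric] fun_eq_iff)
    qed (rule dist; use int nn c_def cQ in \<open>simp\<close>)+
    then have "AE y in lborel. ennreal (P y / c) = ennreal (Q y / c)"
      by (subst (asm) sigma_finite_measure.density_unique_iff [OF sigma_finite_lborel]) auto
    then show ?thesis
      by eventually_elim (use c nn in \<open>simp add: rPQ divide_nonneg_pos\<close>)
  qed
qed

lemma zero_fourier_imp_AE_zero:
  fixes d :: "real \<Rightarrow> complex"
  assumes d: "integrable lborel d"
    and zero: "\<And>a. (LINT y|lborel. d y * cis (a * y)) = 0"
  shows "AE y in lborel. d y = 0"
proof -
  have [measurable]: "d \<in> borel_measurable borel"
    using borel_measurable_integrable[OF d] by simp
  have int: "integrable lborel (\<lambda>y. d y * cis (a * y))" for a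
    by (rule Bochner_Integration.integrable_bound[OF d], measurable, simp add: norm_mult)
  have intc: "integrable lborel (\<lambda>y. cnj (d y) * cis (a * y))" for a
    using integrable_cnj[OF int[of "- a"]] by (simp add: cis_cnj)
  have zeroc: "(LINT y|lborel. cnj (d y) * cis (a * y)) = 0" for a
  proof -
    have "(LINT y|lborel. cnj (d y) * cis (a * y)) = (LINT y|lborel. cnj (d y * cis (- a * y)))"
      by (simp add: cis_cnj)
    also have "\<dots> = cnj (LINT y|lborel. d y * cis (- a * y))"
      by (rule integral_bounded_linear[OF bounded_linear_cnj int])
    finally show ?thesis using zero[of "- a"] by simp
  qed
  have "AE y in lborel. Re (d y) = 0"
  proof (rule zero_fourier_imp_AE_zero_real)
    show "integrable lborel (\<lambda>y. Re (d y))" using d by simp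
    fix a
    have "complex_of_real (Re (d y)) * cis (a * y) = (d y * cis (a * y) + cnj (d y) * cis (a * y)) / 2" for y
      by (simp add: complex_eq_iff algebra_simps)
    then show "(LINT y|lborel. complex_of_real (Re (d y)) * cis (a * y)) = 0"
      by (simp only:) (simp add: int intc zero zeroc)
  qed
  moreover have "AE y in lborel. Im (d y) = 0"
  proof (rule zero_fourier_imp_AE_zero_real)
    show "integrable lborel (\<lambda>y. Im (d y))" using d by simp
    fix a
    have "complex_of_real (Im (d y)) * cis (a * y) = (cnj (d y) * cis (a * y) - d y * cis (a * y)) * (\<i> / 2)" for y
      by (simp add: complex_eq_iff algebra_simps add_divide_distrib diff_divide_distrib)
    then show "(LINT y|lborel. complex_of_real (Im (d y)) * cis (a * y)) = 0"
      by (simp only:) (simp add: int intc zero zeroc)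
  qed
  ultimately show ?thesis by eventually_elim (simp add: complex_eq_iff)
qed

lemma integrable_fst_finite_pair:
  fixes f :: "'a \<Rightarrow> 'b :: {banach, second_countable_topology}"
  assumes "finite_measure N" and f: "integrable M f"
  shows "integrable (M \<Otimes>\<^sub>M N) (\<lambda>p. f (fst p))"
proof -
  interpret N: finite_measure N by fact
  have [measurable]: "f \<in> borel_measurable M" using f by simp
  have "(\<integral>\<^sup>+p. ennreal (norm (f (fst p))) \<partial>(M \<Otimes>\<^sub>M N)) = (\<integral>\<^sup>+x. \<integral>\<^sup>+y. ennreal (norm (f x)) \<partial>N \<partial>M)"
    by (subst N.nn_integral_fst [symmetric]) simp_all
  also have "\<dots> = (\<integral>\<^sup>+x. ennreal (norm (f x)) \<partial>M) * emeasure N (space N)"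
    by (simp add: nn_integral_multc)
  also have "\<dots> < \<infinity>"
    using f N.emeasure_finite by (simp add: integrable_iff_bounded ennreal_mult_eq_top_iff less_top [symmetric])
  finally show ?thesis by (simp add: integrable_iff_bounded)
qed

text \<open>
  The total variation of the complex measure with density \<open>h\<close>. It serves as the reference measure because it is
  finite and Fubini's theorem applies to it, while \<open>M\<close> may fail to be sigma-finite.
\<close>
definition fourier_density_measure :: "real measure \<Rightarrow> (real \<Rightarrow> complex) \<Rightarrow> real measure" where
  "fourier_density_measure M h = density M (\<lambda>\<eta>. ennreal (cmod (h \<eta>)))"

lemma sets_fourier_density_measure [simp]:
  "sets M = sets borel \<Longrightarrow> sets (fourier_density_measure M h) = sets borel"
  by (simp add: fourier_density_measure_def)

lemma integral_fourier_density_measure: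
  assumes [measurable_cong]: "sets M = sets borel" and [measurable]: "h \<in> borel_measurable borel" "F \<in> borel_measurable borel"
  shows "(LINT \<eta>|fourier_density_measure M h. sgn (h \<eta>) * F \<eta>) = (LINT \<eta>|M. h \<eta> * F \<eta>)"
proof -
  have "cmod z *\<^sub>R (sgn z * w) = z * w" for z w :: complex
    by (cases "z = 0") (simp_all add: sgn_div_norm)
  then show ?thesis
    unfolding fourier_density_measure_def by (subst integral_density) auto
qed

text \<open>
  Testing with the Gaussian centred at \<open>- a\<close> shows that the transform of \<open>f y * exp (- y^2 / 2)\<close> at \<open>- a\<close> is
  the integral of that Gaussian against the measure, up to a constant factor. By Fubini's theorem the same holds with \<open>f\<close> replaced by
  the inverse transform \<open>q\<close> of the measure. Hence \<open>(f - q) * exp (- y^2 / 2)\<close> is an integrable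
  function with vanishing Fourier transform.
\<close>
lemma has_fourier_measure_inversion:
  assumes fm: "has_fourier_measure f M h"
    and fin: "finite_measure (fourier_density_measure M h)"
  shows "AE y in lborel. complex_of_real (f y) =
    (LINT \<eta>|fourier_density_measure M h. sgn (h \<eta>) * cis (y * \<eta>))"
proof -
  define \<mu> where "\<mu> = fourier_density_measure M h"
  interpret mu: finite_measure \<mu> using fin by (simp add: \<mu>_def)
  interpret pair_sigma_finite lborel \<mu> ..
  have M [measurable_cong]: "sets M = sets borel" and h [measurable]: "h \<in> borel_measurable borel"
    using fm by (auto simp: has_fourier_measure_def)
  have [measurable_cong]: "sets \<mu> = sets borel" by (simp add: \<mu>_def M)
  define u where "u \<eta> = sgn (h \<eta>)" for \<eta>
  have [measurable]: "u \<in> borel_measurable borel" unfolding u_def sgn_div_norm by measurable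
  have u1: "cmod (u \<eta>) \<le> 1" for \<eta> by (simp add: u_def norm_sgn)
  define q where "q y = (LINT \<eta>|\<mu>. u \<eta> * cis (y * \<eta>))" for y
  have [measurable]: "q \<in> borel_measurable borel" unfolding q_def by measurable
  define E where "E y = complex_of_real (exp (- y\<^sup>2 / 2))" for y :: real
  have [measurable]: "E \<in> borel_measurable borel" unfolding E_def by measurable
  have E_int: "integrable lborel E" unfolding E_def using integrable_gauss by simp
  define \<phi> where "\<phi> a \<xi> = complex_of_real (exp (- (\<xi> - a)\<^sup>2 / 2))" for a \<xi> :: real
  have [measurable]: "\<phi> a \<in> borel_measurable borel" for a unfolding \<phi>_def by measurable
  define s where "s = complex_of_real (sqrt (2 * pi))"
  have s: "s \<noteq> 0" "s * s = complex_of_real (2 * pi)"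
    by (simp_all add: s_def flip: of_real_mult)
  have hat: "(LINT \<xi>|lborel. \<phi> a \<xi> * cis (- (\<xi> * y))) = s * E y * cis (- (a * y))" for a y
    unfolding \<phi>_def s_def E_def by (subst gauss_fourier) simp
  have test: "integrable lborel (\<lambda>y. complex_of_real (f y) * (s * E y * cis (- (a * y))))"
    "(LINT \<xi>|M. \<phi> a \<xi> * h \<xi>) = complex_of_real (1 / (2 * pi)) * (LINT y|lborel. complex_of_real (f y) * (s * E y * cis (- (a * y))))" for a
    using fm schwartz_gauss[of a] unfolding has_fourier_measure_def Let_def hat [symmetric] \<phi>_def by blast+
  have fE: "integrable lborel (\<lambda>y. complex_of_real (f y) * E y)"
  proof -
    have "integrable lborel (\<lambda>y. (1 / s) * (complex_of_real (f y) * (s * E y * cis (- (0 * y)))))"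
      by (intro integrable_mult_right test)
    then show ?thesis using s by (simp add: field_simps)
  qed
  have fEa: "integrable lborel (\<lambda>y. complex_of_real (f y) * E y * cis (a * y))" for a
    by (rule Bochner_Integration.integrable_bound[OF fE])
       (use borel_measurable_integrable[OF fE] in \<open>auto simp: norm_mult\<close>)
  have fL: "(LINT y|lborel. complex_of_real (f y) * E y * cis (a * y)) = s * (LINT \<eta>|\<mu>. u \<eta> * \<phi> (- a) \<eta>)" for a
  proof -
    have "(LINT \<eta>|\<mu>. u \<eta> * \<phi> (- a) \<eta>) = (LINT \<xi>|M. \<phi> (- a) \<xi> * h \<xi>)"
      unfolding \<mu>_def u_def by (subst integral_fourier_density_measure) (auto simp: M \<phi>_def mult.commute)
    also have "\<dots> = complex_of_real (1 / (2 * pi)) * (LINT y|lborel. s * (complex_of_real (f y) * E y * cis (a * y)))"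
      unfolding test by (simp add: mult_ac)
    finally have "s * (LINT \<eta>|\<mu>. u \<eta> * \<phi> (- a) \<eta>) =
        (s * s) * complex_of_real (1 / (2 * pi)) * (LINT y|lborel. complex_of_real (f y) * E y * cis (a * y))"
      by simp
    then show ?thesis by (simp add: s flip: of_real_mult)
  qed
  have q_bound: "cmod (q y) \<le> measure \<mu> (space \<mu>)" for y
  proof -
    have "integrable \<mu> (\<lambda>\<eta>. u \<eta> * cis (y * \<eta>))"
      by (rule mu.integrable_const_bound[where B = 1]) (auto simp: norm_mult u1)
    then have "cmod (q y) \<le> (LINT \<eta>|\<mu>. 1)" unfolding q_def
      by (rule Bochner_Integration.integral_norm_bound_integral) (auto simp: norm_mult u1 intro!: mu.integrable_const)
    then show ?thesis by simp
  qed
  have qEa: "integrable lborel (\<lambda>y. q y * E y * cis (a * y))" for a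
  proof (rule Bochner_Integration.integrable_bound)
    show "integrable lborel (\<lambda>y. measure \<mu> (space \<mu>) *\<^sub>R E y)" using E_int by simp
  qed (auto simp: norm_mult intro!: mult_right_mono q_bound)
  have qL: "(LINT y|lborel. q y * E y * cis (a * y)) = s * (LINT \<eta>|\<mu>. u \<eta> * \<phi> (- a) \<eta>)" for a
  proof -
    have int: "integrable (lborel \<Otimes>\<^sub>M \<mu>) (\<lambda>(y, \<eta>). u \<eta> * cis (y * \<eta>) * (E y * cis (a * y)))"
    proof (rule Bochner_Integration.integrable_bound)
      show "integrable (lborel \<Otimes>\<^sub>M \<mu>) (\<lambda>(y, \<eta>). E y * 1)"
        using integrable_fst_finite_pair[OF fin [folded \<mu>_def] E_int] by (simp add: case_prod_beta')
    qed (auto simp: norm_mult u1 mult_left_le_one_le)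
    have "(LINT y|lborel. q y * E y * cis (a * y)) = (LINT y|lborel. LINT \<eta>|\<mu>. u \<eta> * cis (y * \<eta>) * (E y * cis (a * y)))"
      by (simp add: mult.assoc [of "q _"]) (simp add: q_def)
    also have "\<dots> = (LINT \<eta>|\<mu>. LINT y|lborel. u \<eta> * cis (y * \<eta>) * (E y * cis (a * y)))"
      by (rule Fubini_integral [OF int, symmetric])
    also have "\<dots> = (LINT \<eta>|\<mu>. s * (u \<eta> * \<phi> (- a) \<eta>))"
    proof (intro Bochner_Integration.integral_cong refl)
      fix \<eta>
      have "(LINT y|lborel. u \<eta> * cis (y * \<eta>) * (E y * cis (a * y))) = (LINT y|lborel. u \<eta> * (\<phi> 0 y * cis (- (y * - (\<eta> + a)))))"
        by (intro Bochner_Integration.integral_cong refl)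
          (simp add: E_def \<phi>_def cis_mult algebra_simps)
      also have "\<dots> = u \<eta> * (s * E (- (\<eta> + a)))"
        by (simp add: hat)
      finally show "(LINT y|lborel. u \<eta> * cis (y * \<eta>) * (E y * cis (a * y))) = s * (u \<eta> * \<phi> (- a) \<eta>)"
        by (simp add: E_def \<phi>_def power2_commute [of "- \<eta>"] add.commute)
    qed
    finally show ?thesis by simp
  qed
  have "AE y in lborel. (complex_of_real (f y) - q y) * E y = 0"
  proof (rule zero_fourier_imp_AE_zero)
    show "integrable lborel (\<lambda>y. (complex_of_real (f y) - q y) * E y)"
      using fE qEa[of 0] by (simp add: left_diff_distrib)
    show "(LINT y|lborel. (complex_of_real (f y) - q y) * E y * cis (a * y)) = 0" for a
      using fEa[of a] qEa[of a] by (simp add: left_diff_distrib fL qL)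
  qed
  then show ?thesis
    unfolding q_def u_def \<mu>_def by (auto simp: E_def elim!: eventually_mono)
qed

section \<open>The Fourier transform of a product\<close>
lemma space_cylinder: "space cylinder = {0..<2 * pi} \<times> UNIV"
  by (simp add: cylinder_def space_pair_measure space_restrict_space)

lemma measurable_fst_cylinder [measurable]: "fst \<in> borel_measurable cylinder"
  unfolding cylinder_def
  by (rule measurable_compose[OF measurable_fst]) (simp add: measurable_restrict_space1)

lemma measurable_snd_cylinder [measurable]: "snd \<in> borel_measurable cylinder"
  unfolding cylinder_def using measurable_snd[of "restrict_space lborel {0..<2 * pi}" lborel]
  by (simp add: measurable_lborel2)

lemma sigma_finite_cylinder: "sigma_finite_measure cylinder"
  unfolding cylinder_def
  by (intro sigma_finite_pair_measure sigma_finite_measure_restrict_space sigma_finite_lborel) auto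

lemma AE_cylinder_snd:
  assumes "AE y in lborel. Q y"
  shows "AE p in cylinder. Q (snd p)"
proof -
  interpret x: sigma_finite_measure "restrict_space lborel {0..<2 * pi}"
    by (intro sigma_finite_measure_restrict_space sigma_finite_lborel) auto
  interpret pair_sigma_finite "restrict_space lborel {0..<2 * pi}" "lborel :: real measure" ..
  obtain A where A: "{y. \<not> Q y} \<subseteq> A" "A \<in> sets borel" "AE y in lborel. y \<notin> A"
    using assms AE_not_in[of _ "lborel :: real measure"] by (elim AE_E) (force simp: null_sets_def)
  note [measurable] = A(2)
  have "AE p in cylinder. snd p \<notin> A"
    unfolding cylinder_def
  proof (rule AE_pair_measure)
    show "{p \<in> space (restrict_space lborel {0..<2 * pi} \<Otimes>\<^sub>M lborel). snd p \<notin> A}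
        \<in> sets (restrict_space lborel {0..<2 * pi} \<Otimes>\<^sub>M lborel)"
      by measurable
  qed (use A in auto)
  then show ?thesis by eventually_elim (use A in auto)
qed

lemma borel_measurable_truncated_fourier [measurable]:
  assumes [measurable]: "f \<in> borel_measurable cylinder"
  shows "truncated_fourier R f \<in> borel_measurable frequencies"
proof -
  interpret sigma_finite_measure cylinder by (rule sigma_finite_cylinder)
  have "truncated_fourier R f = (\<lambda>\<kappa>. complex_of_real (1 / (2 * pi)) *
     (LINT p|cylinder. indicator {-R..R} (snd p) *\<^sub>R
        (complex_of_real (f p) * cis (- (of_int (fst \<kappa>) * fst p + snd \<kappa> * snd p)))))"
    by (auto simp: truncated_fourier_def case_prod_beta')
  also have "\<dots> \<in> borel_measurable frequencies" by measurable
  finally show ?thesis .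
qed

lemma integrable_truncated:
  fixes g :: "real \<times> real \<Rightarrow> real"
  assumes [measurable]: "g \<in> borel_measurable cylinder" and g2: "integrable cylinder (\<lambda>p. (g p)\<^sup>2)"
  shows "integrable cylinder (\<lambda>p. indicator {-R..R} (snd p) * \<bar>g p\<bar>)"
proof (rule Bochner_Integration.integrable_bound)
  have "emeasure cylinder ({0..<2 * pi} \<times> {-R..R}) = emeasure (restrict_space lborel {0..<2 * pi}) {0..<2 * pi} * emeasure lborel {-R..R}"
    unfolding cylinder_def by (rule lborel.emeasure_pair_measure_Times) (auto simp: sets_restrict_space_iff)
  also have "\<dots> < \<infinity>"
    by (simp add: emeasure_restrict_space emeasure_lborel_Icc_eq ennreal_mult_less_top)
  finally have "emeasure cylinder ({0..<2 * pi} \<times> {-R..R}) < \<infinity>" .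
  moreover have "{0..<2 * pi} \<times> {-R..R} \<in> sets cylinder"
    unfolding cylinder_def by (intro pair_measureI) (auto simp: sets_restrict_space_iff)
  ultimately show "integrable cylinder (\<lambda>p. indicator ({0..<2 * pi} \<times> {-R..R}) p + (g p)\<^sup>2)"
    using g2 by (intro Bochner_Integration.integrable_add) (auto simp: integrable_indicator_iff)
  have *: "\<bar>x\<bar> \<le> 1 + x\<^sup>2" for x :: real
    using sum_squares_bound[of 1 "\<bar>x\<bar>"] by simp
  show "AE p in cylinder. norm (indicator {-R..R} (snd p) * \<bar>g p\<bar>) \<le> norm (indicator ({0..<2 * pi} \<times> {-R..R}) p + (g p)\<^sup>2)"
    by (intro AE_I2) (use * in \<open>auto simp: space_cylinder indicator_def\<close>)
qed measurable

text \<open>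
  If \<open>f\<close> is a superposition of the characters \<open>cis (y * \<eta>)\<close>, multiplication by \<open>f\<close> is a superposition of the
  shifts by \<open>\<eta>\<close> of the transform. Truncation to a bounded range of \<open>y\<close> makes a square integrable
  function integrable, so that the integrals may be exchanged.
\<close>
lemma cmod_truncated_fourier_mult_le:
  assumes [measurable]: "g \<in> borel_measurable cylinder" and g2: "integrable cylinder (\<lambda>p. (g p)\<^sup>2)"
    and "finite_measure \<mu>" and [measurable_cong]: "sets \<mu> = sets borel"
    and [measurable]: "u \<in> borel_measurable borel" and u1: "\<And>\<eta>. cmod (u \<eta>) \<le> 1"
    and f: "AE y in lborel. complex_of_real (f y) = (LINT \<eta>|\<mu>. u \<eta> * cis (y * \<eta>))"
    and fg: "(\<lambda>(x, y). - f y * g (x, y)) \<in> borel_measurable cylinder"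
  shows "ennreal (cmod (truncated_fourier R (\<lambda>(x, y). - f y * g (x, y)) \<kappa>)) \<le>
    conv \<mu> (\<lambda>\<kappa>. ennreal (cmod (truncated_fourier R g \<kappa>))) \<kappa>"
proof -
  interpret mu: finite_measure \<mu> by fact
  interpret cyl: sigma_finite_measure cylinder by (rule sigma_finite_cylinder)
  interpret pair_sigma_finite cylinder \<mu> ..
  obtain k \<xi> where \<kappa>: "\<kappa> = (k, \<xi>)" by (cases \<kappa>)
  let ?F = "\<lambda>\<eta> p. indicator {-R..R} (snd p) *\<^sub>R (complex_of_real (g p) * cis (- (of_int k * fst p + (\<xi> - \<eta>) * snd p)))"
  let ?c = "complex_of_real (1 / (2 * pi))"
  have tf: "truncated_fourier R g (k, \<xi> - \<eta>) = ?c * (LINT p|cylinder. ?F \<eta> p)" for \<eta>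
    by (simp add: truncated_fourier_def case_prod_beta')
  define fg where "fg p = - f (snd p) * g p" for p
  have [measurable]: "fg \<in> borel_measurable cylinder"
    using fg by (simp add: fg_def [abs_def] case_prod_beta')
  have int: "integrable (cylinder \<Otimes>\<^sub>M \<mu>) (\<lambda>(p, \<eta>). u \<eta> * ?F \<eta> p)"
  proof (rule Bochner_Integration.integrable_bound)
    show "integrable (cylinder \<Otimes>\<^sub>M \<mu>) (\<lambda>q. indicator {-R..R} (snd (fst q)) * \<bar>g (fst q)\<bar>)"
      using integrable_fst_finite_pair[OF assms(3) integrable_truncated[OF assms(1,2)]] .
    show "AE q in cylinder \<Otimes>\<^sub>M \<mu>. norm (case q of (p, \<eta>) \<Rightarrow> u \<eta> * ?F \<eta> p) \<le> norm (indicator {-R..R} (snd (fst q)) * \<bar>g (fst q)\<bar>)"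
      by (intro AE_I2) (auto simp: norm_mult indicator_def intro!: mult_left_le_one_le u1)
  qed measurable
  have "(LINT p|cylinder. indicator {-R..R} (snd p) *\<^sub>R
          (complex_of_real (fg p) * cis (- (of_int k * fst p + \<xi> * snd p)))) =
      (LINT p|cylinder. - (LINT \<eta>|\<mu>. u \<eta> * ?F \<eta> p))"
  proof (rule integral_cong_AE)
    show "(\<lambda>p. indicator {-R..R} (snd p) *\<^sub>R (complex_of_real (fg p) * cis (- (of_int k * fst p + \<xi> * snd p))))
        \<in> borel_measurable cylinder"
      by measurable
    show "AE p in cylinder. indicator {-R..R} (snd p) *\<^sub>R (complex_of_real (fg p) * cis (- (of_int k * fst p + \<xi> * snd p))) =
        - (LINT \<eta>|\<mu>. u \<eta> * ?F \<eta> p)"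
      using AE_cylinder_snd[OF f]
    proof eventually_elim
      case (elim p)
      have "(LINT \<eta>|\<mu>. u \<eta> * ?F \<eta> p) = (LINT \<eta>|\<mu>. (u \<eta> * cis (snd p * \<eta>)) *
          (indicator {-R..R} (snd p) *\<^sub>R (complex_of_real (g p) * cis (- (of_int k * fst p + \<xi> * snd p)))))"
        by (intro Bochner_Integration.integral_cong refl) (simp add: cis_mult algebra_simps indicator_def)
      also have "\<dots> = (LINT \<eta>|\<mu>. u \<eta> * cis (snd p * \<eta>)) *
          (indicator {-R..R} (snd p) *\<^sub>R (complex_of_real (g p) * cis (- (of_int k * fst p + \<xi> * snd p))))"
        by (rule integral_mult_left_zero)
      finally show ?case
        unfolding elim [symmetric] by (simp only: fg_def) (simp add: mult.assoc)
    qed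
  qed measurable
  also have "\<dots> = - (LINT p|cylinder. LINT \<eta>|\<mu>. u \<eta> * ?F \<eta> p)"
    by simp
  also have "(LINT p|cylinder. LINT \<eta>|\<mu>. u \<eta> * ?F \<eta> p) = (LINT \<eta>|\<mu>. LINT p|cylinder. u \<eta> * ?F \<eta> p)"
    by (rule Fubini_integral [OF int, symmetric])
  finally have "truncated_fourier R (\<lambda>(x, y). - f y * g (x, y)) \<kappa> = - (?c * (LINT \<eta>|\<mu>. LINT p|cylinder. u \<eta> * ?F \<eta> p))"
    by (simp add: \<kappa> truncated_fourier_def case_prod_beta' fg_def)
  also have "?c * (LINT \<eta>|\<mu>. LINT p|cylinder. u \<eta> * ?F \<eta> p) = (LINT \<eta>|\<mu>. u \<eta> * truncated_fourier R g (k, \<xi> - \<eta>))"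
    unfolding tf integral_mult_right_zero mult.left_commute [of "u _"] ..
  finally have "ennreal (cmod (truncated_fourier R (\<lambda>(x, y). - f y * g (x, y)) \<kappa>)) =
      ennreal (cmod (LINT \<eta>|\<mu>. u \<eta> * truncated_fourier R g (k, \<xi> - \<eta>)))"
    by simp
  also have "\<dots> \<le> (\<integral>\<^sup>+\<eta>. ennreal (cmod (u \<eta> * truncated_fourier R g (k, \<xi> - \<eta>))) \<partial>\<mu>)"
    by (cases "integrable \<mu> (\<lambda>\<eta>. u \<eta> * truncated_fourier R g (k, \<xi> - \<eta>))")
      (auto intro: integral_norm_bound_ennreal simp: not_integrable_integral_eq)
  also have "\<dots> \<le> conv \<mu> (\<lambda>\<kappa>. ennreal (cmod (truncated_fourier R g \<kappa>))) \<kappa>"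
    unfolding conv_def \<kappa> by (auto intro!: nn_integral_mono ennreal_leI mult_left_le_one_le u1 simp: norm_mult)
  finally show ?thesis .
qed

text \<open>
  The bound for truncations passes to the limit because convolution with a finite measure is bounded on
  square integrable functions: the part \<open>D\<close> of \<open>|P|\<close> above the claimed bound has norm at most that of
  the truncation errors \<open>A R\<close> and \<open>B R\<close>.
\<close>
lemma has_fourier_mult_le:
  assumes g: "has_fourier g G" and fg: "has_fourier (\<lambda>(x, y). - f y * g (x, y)) P"
    and \<mu>: "finite_measure \<mu>" "sets \<mu> = sets borel"
    and u: "u \<in> borel_measurable borel" "\<And>\<eta>. cmod (u \<eta>) \<le> 1"
    and f: "AE y in lborel. complex_of_real (f y) = (LINT \<eta>|\<mu>. u \<eta> * cis (y * \<eta>))"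
  shows "AE \<kappa> in frequencies. ennreal (cmod (P \<kappa>)) \<le> conv \<mu> (\<lambda>\<kappa>. ennreal (cmod (G \<kappa>))) \<kappa>"
proof -
  interpret mu: finite_measure \<mu> by fact
  note [measurable_cong] = \<mu>(2)
  define fg where "fg = (\<lambda>(x, y). - f y * g (x, y))"
  have [measurable]: "g \<in> borel_measurable cylinder" "fg \<in> borel_measurable cylinder"
    "G \<in> borel_measurable frequencies" "P \<in> borel_measurable frequencies"
    and g2: "integrable cylinder (\<lambda>p. (g p)\<^sup>2)"
    using g fg by (auto simp: has_fourier_def fg_def)
  define c where "c H = (\<lambda>\<kappa>. ennreal (cmod (H \<kappa>)))" for H :: "int \<times> real \<Rightarrow> complex"
  have cm [measurable]: "c H \<in> borel_measurable frequencies" if [measurable]: "H \<in> borel_measurable frequencies" for H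
    unfolding c_def by measurable
  define A where "A R = (\<lambda>\<kappa>. P \<kappa> - truncated_fourier R fg \<kappa>)" for R
  define B where "B R = (\<lambda>\<kappa>. G \<kappa> - truncated_fourier R g \<kappa>)" for R
  have [measurable]: "A R \<in> borel_measurable frequencies" "B R \<in> borel_measurable frequencies" for R
    unfolding A_def B_def by measurable
  have conv_meas [measurable]: "conv \<mu> H \<in> borel_measurable frequencies" if "H \<in> borel_measurable frequencies" for H
    by (rule borel_measurable_conv) (use that \<mu> mu.sigma_finite_measure_axioms in auto)
  have w0: "weighted_sq 0 (c H) = (\<integral>\<^sup>+\<kappa>. ennreal ((cmod (H \<kappa>))\<^sup>2) \<partial>frequencies)" for H
    unfolding weighted_sq_def c_def
    by (intro nn_integral_cong) (use freq_weight_pos in \<open>auto simp: ennreal_power dest: less_imp_neq[THEN not_sym]\<close>)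
  have limA: "((\<lambda>R. weighted_sq 0 (c (A R))) \<longlongrightarrow> 0) at_top"
    and limB: "((\<lambda>R. weighted_sq 0 (c (B R))) \<longlongrightarrow> 0) at_top"
    using g fg unfolding w0 A_def B_def has_fourier_def fg_def by auto
  define m where "m = emeasure \<mu> (space \<mu>)"
  have m: "m < \<infinity>" using mu.emeasure_finite by (simp add: m_def less_top [symmetric])
  define D where "D \<kappa> = c P \<kappa> - conv \<mu> (c G) \<kappa>" for \<kappa>
  have [measurable]: "D \<in> borel_measurable frequencies" unfolding D_def by measurable
  have tri: "c H \<kappa> \<le> c H' \<kappa> + c (\<lambda>\<kappa>. H \<kappa> - H' \<kappa>) \<kappa>" "c H' \<kappa> \<le> c H \<kappa> + c (\<lambda>\<kappa>. H \<kappa> - H' \<kappa>) \<kappa>" for H H' \<kappa>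
    using norm_triangle_sub[of "H \<kappa>" "H' \<kappa>"] norm_triangle_sub[of "H' \<kappa>" "H \<kappa>"]
    by (auto simp: c_def norm_minus_commute ennreal_leI simp flip: ennreal_plus)
  have bound: "weighted_sq 0 D \<le> 2 * weighted_sq 0 (c (A R)) + 2 * (m\<^sup>2 * weighted_sq 0 (c (B R)))" for R
  proof -
    have "D \<kappa> \<le> c (A R) \<kappa> + conv \<mu> (c (B R)) \<kappa>" for \<kappa>
    proof -
      have "c P \<kappa> \<le> c (truncated_fourier R fg) \<kappa> + c (A R) \<kappa>"
        unfolding A_def by (rule tri)
      also have "c (truncated_fourier R fg) \<kappa> \<le> conv \<mu> (c (truncated_fourier R g)) \<kappa>"
        unfolding c_def fg_def
        by (rule cmod_truncated_fourier_mult_le) (use g2 \<mu> u f fg in \<open>auto simp: has_fourier_def\<close>)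
      also have "\<dots> \<le> conv \<mu> (\<lambda>\<kappa>. c G \<kappa> + c (B R) \<kappa>) \<kappa>"
        unfolding B_def by (intro conv_mono tri)
      also have "\<dots> = conv \<mu> (c G) \<kappa> + conv \<mu> (c (B R)) \<kappa>"
        by (rule conv_add) (use \<mu> in auto)
      finally have "c P \<kappa> \<le> conv \<mu> (c G) \<kappa> + (c (A R) \<kappa> + conv \<mu> (c (B R)) \<kappa>)"
        by (simp add: add_right_mono add_ac)
      then show ?thesis unfolding D_def by (simp add: ennreal_minus_le_iff c_def)
    qed
    then have "weighted_sq 0 D \<le> weighted_sq 0 (\<lambda>\<kappa>. c (A R) \<kappa> + conv \<mu> (c (B R)) \<kappa>)"
      by (rule weighted_sq_mono)
    also have "\<dots> \<le> 2 * weighted_sq 0 (c (A R)) + 2 * weighted_sq 0 (conv \<mu> (c (B R)))"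
      by (rule weighted_sq_add_le2) measurable
    also have "weighted_sq 0 (conv \<mu> (c (B R))) \<le> (\<integral>\<^sup>+\<eta>. ennreal ((1 + \<bar>\<eta>\<bar>) powr 0) \<partial>\<mu>)\<^sup>2 * weighted_sq 0 (c (B R))"
      by (rule weighted_sq_conv_le) (use \<mu> mu.sigma_finite_measure_axioms in auto)
    also have "(\<integral>\<^sup>+\<eta>. ennreal ((1 + \<bar>\<eta>\<bar>) powr 0) \<partial>\<mu>) = (\<integral>\<^sup>+\<eta>. 1 \<partial>\<mu>)"
      by (intro nn_integral_cong) auto
    also have "\<dots> = m" by (simp add: m_def)
    finally show ?thesis by (simp add: add_left_mono mult_left_mono)
  qed
  have "((\<lambda>R. 2 * weighted_sq 0 (c (A R)) + 2 * (m\<^sup>2 * weighted_sq 0 (c (B R)))) \<longlongrightarrow> 2 * 0 + 2 * (m\<^sup>2 * 0)) at_top"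
    by (intro tendsto_add ennreal_tendsto_cmult limA limB) (use m in \<open>auto simp: power2_eq_square ennreal_mult_less_top\<close>)
  then have "weighted_sq 0 D \<le> 2 * 0 + 2 * (m\<^sup>2 * 0)"
    by (rule tendsto_lowerbound) (use bound in auto)
  then have "AE \<kappa> in frequencies. D \<kappa> = 0"
    by (simp add: weighted_sq_eq_0_iff)
  then show ?thesis
  proof eventually_elim
    case (elim \<kappa>)
    then have "c P \<kappa> - conv \<mu> (c G) \<kappa> \<le> 0" by (simp add: D_def)
    then show ?case unfolding ennreal_minus_le_iff by (simp add: c_def)
  qed
qed

section \<open>Scalar profiles around the critical time\<close>
lemma taylor_backward_step:
  fixes f f' f'' :: "real \<Rightarrow> real"
  assumes f: "\<And>x. (f has_real_derivative f' x) (at x)"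
    and f': "\<And>x. (f' has_real_derivative f'' x) (at x)"
    and C: "\<And>x. t - \<tau> \<le> x \<Longrightarrow> x \<le> t \<Longrightarrow> \<bar>f'' x\<bar> \<le> C" and "\<tau> \<ge> 0"
  shows "f (t - \<tau>) \<le> f t - \<tau> * f' t + C * \<tau>\<^sup>2"
proof (cases "\<tau> = 0")
  case False
  then have \<tau>: "t - \<tau> < t" using assms by simp
  obtain z where z: "t - \<tau> < z" "z < t" "f t - f (t - \<tau>) = \<tau> * f' z"
    using MVT2[OF \<tau>, of f f'] f by auto
  obtain y where y: "z < y" "y < t" "f' t - f' z = (t - z) * f'' y"
    using MVT2[OF z(2), of f' f''] f' by auto
  have "\<bar>f'' y\<bar> \<le> C" using C[of y] y z by simp
  then have C0: "C \<ge> 0" by linarith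
  have "f' t - f' z \<le> (t - z) * C"
    unfolding y(3) using \<open>\<bar>f'' y\<bar> \<le> C\<close> z by (intro mult_left_mono) auto
  also have "\<dots> \<le> \<tau> * C" using z C0 by (intro mult_right_mono) auto
  finally have "\<tau> * (f' t - f' z) \<le> \<tau> * (\<tau> * C)" using assms by (intro mult_left_mono) auto
  then show ?thesis using z(3) by (simp add: algebra_simps power2_eq_square)
qed simp

text \<open>
  The constant matters: the response constant below is \<open>pi\<close> divided by a number just under its cube
  root and has to be smaller than 3, which requires a constant above \<open>(pi / 3)^3\<close>, about 1.15. The
  largest admissible constant is the minimum of \<open>\<theta> / (sin \<theta>)^2\<close>, about 1.38.
\<close>
lemma sin_squared_le:
  fixes \<theta> :: real
  assumes "0 \<le> \<theta>"
  shows "63 / 50 * (sin \<theta>)\<^sup>2 \<le> \<theta>"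
proof -
  have pi: "pi > 3.14" using pi_approx by simp
  consider "\<theta> \<le> pi / 4" | "pi / 4 < \<theta>" "\<theta> \<le> 63 / 50" | "63 / 50 < \<theta>" by linarith
  then show ?thesis
  proof cases
    case 1
    have "\<bar>sin \<theta>\<bar> \<le> \<theta>" using abs_sin_x_le_abs_x[of \<theta>] assms by simp
    then have "(sin \<theta>)\<^sup>2 \<le> \<theta>\<^sup>2" using assms by (metis abs_le_square_iff abs_of_nonneg)
    also have "\<dots> \<le> \<theta> * (pi / 4)" unfolding power2_eq_square using assms 1 by (intro mult_left_mono)
    also have "\<dots> \<le> \<theta> * (50 / 63)"
      using assms pi_approx by (intro mult_left_mono) auto
    finally show ?thesis by simp
  next
    case 2
    have "2 * (sin \<theta>)\<^sup>2 = 1 - cos (2 * \<theta>)"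
      using cos_double_sin[of \<theta>] by simp
    also have "cos (2 * \<theta>) = - sin (2 * \<theta> - pi / 2)"
      by (simp add: sin_diff)
    also have "1 - - sin (2 * \<theta> - pi / 2) \<le> 1 + (2 * \<theta> - pi / 2)"
      using 2 sin_x_le_x[of "2 * \<theta> - pi / 2"] by simp
    finally have "(sin \<theta>)\<^sup>2 \<le> \<theta> + 1 / 2 - pi / 4" by simp
    then show ?thesis using 2 pi by simp
  next
    case 3
    have "(sin \<theta>)\<^sup>2 \<le> 1" by (simp add: abs_square_le_1)
    then show ?thesis using 3 by simp
  qed
qed

lemma inverse_square_le_arctan: "63 / 50 / (1 + y\<^sup>2) \<le> pi / 2 + arctan y"
proof -
  have "sin (pi / 2 + arctan y) = 1 / sqrt (1 + y\<^sup>2)"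
    by (simp add: sin_add cos_arctan)
  then have "(sin (pi / 2 + arctan y))\<^sup>2 = 1 / (1 + y\<^sup>2)"
    by (simp add: power_divide add_nonneg_nonneg)
  then show ?thesis
    using sin_squared_le[of "pi / 2 + arctan y"] arctan_lbound[of y] by simp
qed

text \<open>
  The increment of \<open>arctan\<close> over an interval of given length is largest when the interval is centred at 0.
  With \<open>\<delta>\<close> the increment, the length is \<open>sin \<delta> / (cos \<alpha> * cos \<beta>)\<close>, and the product of cosines is
  largest for \<open>\<alpha> = - \<beta>\<close>.
\<close>
lemma arctan_diff_le:
  assumes "r \<le> s"
  shows "arctan s - arctan r \<le> 2 * arctan ((s - r) / 2)"
proof -
  define \<alpha> \<beta> \<delta> where "\<alpha> = arctan s" and "\<beta> = arctan r" and "\<delta> = \<alpha> - \<beta>"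
  have \<delta>: "0 \<le> \<delta>" "\<delta> < pi"
    using assms arctan_ubound[of s] arctan_lbound[of r]
    by (auto simp: \<delta>_def \<alpha>_def \<beta>_def arctan_le_iff)
  have cos: "cos \<alpha> > 0" "cos \<beta> > 0" "cos (\<delta> / 2) > 0"
    using \<delta> arctan_bounded[of s] arctan_bounded[of r]
    by (auto simp: \<alpha>_def \<beta>_def intro!: cos_gt_zero_pi)
  have "s - r = tan \<alpha> - tan \<beta>" by (simp add: \<alpha>_def \<beta>_def tan_arctan)
  also have "\<dots> = sin \<delta> / (cos \<alpha> * cos \<beta>)"
    using cos by (simp add: tan_def \<delta>_def sin_diff field_simps)
  also have "\<dots> \<ge> sin \<delta> / (cos (\<delta> / 2))\<^sup>2"
  proof (intro divide_left_mono)
    have "2 * (cos \<alpha> * cos \<beta>) = cos (\<alpha> - \<beta>) + cos (\<alpha> + \<beta>)"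
      by (simp add: cos_add cos_diff)
    also have "\<dots> \<le> cos \<delta> + 1" by (simp add: \<delta>_def)
    also have "\<dots> = 2 * (cos (\<delta> / 2))\<^sup>2" using cos_double_cos[of "\<delta> / 2"] by simp
    finally show "cos \<alpha> * cos \<beta> \<le> (cos (\<delta> / 2))\<^sup>2" by simp
  qed (use cos \<delta> in \<open>auto intro!: sin_ge_zero\<close>)
  also have "sin \<delta> / (cos (\<delta> / 2))\<^sup>2 = 2 * tan (\<delta> / 2)"
    using sin_double[of "\<delta> / 2"] cos by (simp add: tan_def field_simps power2_eq_square)
  finally have "tan (\<delta> / 2) \<le> (s - r) / 2" by simp
  then have "arctan (tan (\<delta> / 2)) \<le> arctan ((s - r) / 2)" by (simp add: arctan_le_iff)
  also have "arctan (tan (\<delta> / 2)) = \<delta> / 2" using \<delta> by (intro arctan_tan) auto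
  finally show ?thesis by (simp add: \<delta>_def \<alpha>_def \<beta>_def)
qed

text \<open>
  The derivatives compare because \<open>10 x^2 - 12 x + 4\<close> has no real zero.
\<close>
lemma arctan_le_ln:
  assumes "u \<ge> 0"
  shows "6 * arctan u \<le> 5 * ln (1 + 2 * u)"
proof -
  have "5 * ln (1 + 2 * 0) - 6 * arctan 0 \<le> 5 * ln (1 + 2 * u) - 6 * arctan u"
  proof (rule DERIV_nonneg_imp_nondecreasing[OF assms])
    fix x :: real assume x: "0 \<le> x" "x \<le> u"
    have "0 \<le> (5 * x - 3)\<^sup>2" by simp
    then have "0 \<le> 10 * x\<^sup>2 - 12 * x + 4" by (simp add: power2_diff power_mult_distrib)
    then have "5 * (2 / (1 + 2 * x)) - 6 * (1 / (1 + x\<^sup>2)) \<ge> 0"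
      using x by (simp add: field_simps add_pos_nonneg)
    then show "\<exists>y. ((\<lambda>x. 5 * ln (1 + 2 * x) - 6 * arctan x) has_real_derivative y) (at x) \<and> 0 \<le> y"
      using x by (intro exI[of _ "5 * (2 / (1 + 2 * x)) - 6 * (1 / (1 + x\<^sup>2))"] conjI)
        (auto intro!: derivative_eq_intros simp: inverse_eq_divide)
  qed
  then show ?thesis by simp
qed

text \<open>
  The ratio of the weight \<open>exp (3 * arctan s)\<close> at two points of distance at most \<open>|\<eta>|\<close>. The exponent 3 is
  within the range that the fifth power can pay for.
\<close>
lemma exp_arctan_shift:
  assumes "\<bar>s - r\<bar> \<le> \<bar>\<eta>\<bar>"
  shows "exp (3 * arctan s) \<le> (1 + \<bar>\<eta>\<bar>) ^ 5 * exp (3 * arctan r)"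
proof -
  have "3 * (arctan s - arctan r) \<le> 5 * ln (1 + \<bar>\<eta>\<bar>)"
  proof (cases "r \<le> s")
    case True
    have "3 * (arctan s - arctan r) \<le> 6 * arctan ((s - r) / 2)"
      using arctan_diff_le[OF True] by simp
    also have "\<dots> \<le> 5 * ln (1 + 2 * ((s - r) / 2))"
      using True by (intro arctan_le_ln) auto
    also have "\<dots> \<le> 5 * ln (1 + \<bar>\<eta>\<bar>)"
      using True assms by (intro mult_left_mono iffD2[OF ln_le_cancel_iff]) (auto simp: field_simps add_pos_nonneg)
    finally show ?thesis .
  next
    case False
    then have "3 * (arctan s - arctan r) \<le> 0" by (simp add: arctan_le_iff)
    also have "0 \<le> 5 * ln (1 + \<bar>\<eta>\<bar>)" by simp
    finally show ?thesis .
  qed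
  then have "exp (3 * arctan s) \<le> exp (5 * ln (1 + \<bar>\<eta>\<bar>) + 3 * arctan r)" by simp
  also have "\<dots> = (1 + \<bar>\<eta>\<bar>) ^ 5 * exp (3 * arctan r)"
    by (simp add: exp_add exp_of_nat_mult [of 5, simplified])
  finally show ?thesis .
qed

text \<open>
  An upper solution of \<open>f' + n^3 s^2 f = 1\<close>, the response of the vorticity to a constant source at the
  time \<open>s\<close> after the critical time. The exact response is not elementary; for this one the
  differential inequality reduces to \<open>inverse_square_le_arctan\<close>. The number \<open>27 / 25\<close>
  is below the cube root of \<open>63 / 50\<close>.
\<close>
definition lag :: "real \<Rightarrow> real \<Rightarrow> real" where
  "lag n s = (pi / 2 + arctan (27 / 25 * n * s)) / (27 / 25 * n)"

lemma lag_nonneg: "n > 0 \<Longrightarrow> lag n s \<ge> 0"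
  using arctan_lbound[of "27 / 25 * n * s"] by (simp add: lag_def)

lemma lag_le: "n > 0 \<Longrightarrow> lag n s \<le> pi / (27 / 25 * n)"
  using arctan_ubound[of "27 / 25 * n * s"] unfolding lag_def by (intro divide_right_mono) auto

lemma lag_mono: "n > 0 \<Longrightarrow> s \<le> s' \<Longrightarrow> lag n s \<le> lag n s'"
  unfolding lag_def by (intro divide_right_mono add_left_mono) (auto simp: arctan_le_iff)

text \<open>
  The differential inequality \<open>lag' + n^3 s^2 lag \<ge> 1\<close> in the form of one step of the implicit Euler
  scheme, with the Taylor remainder.
\<close>
lemma lag_step:
  assumes n: "n > 0" and "\<tau> \<ge> 0"
  shows "lag n (s - \<tau>) + \<tau> \<le> (1 + \<tau> * (n ^ 3 * s\<^sup>2)) * lag n s + 2 * n * \<tau>\<^sup>2"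
proof -
  define g c where "g = (27 / 25 :: real)" and "c = g * n"
  have c: "c > 0" "c \<le> 2 * n" using n by (auto simp: c_def g_def)
  have lag: "lag n x = (pi / 2 + arctan (c * x)) / c" for x
    by (simp add: lag_def c_def g_def)
  define f' where "f' x = 1 / (1 + (c * x)\<^sup>2)" for x
  define f'' where "f'' x = - (2 * (c * x) * c) / (1 + (c * x)\<^sup>2)\<^sup>2" for x
  have pos: "1 + (c * x)\<^sup>2 > 0" for x
    by (simp add: add_pos_nonneg)
  have "lag n (s - \<tau>) \<le> lag n s - \<tau> * f' s + (2 * n) * \<tau>\<^sup>2"
  proof (rule taylor_backward_step[where f'' = f''])
    show "(lag n has_real_derivative f' x) (at x)" for x
      unfolding lag [abs_def] f'_def
      using c by (auto intro!: derivative_eq_intros simp: inverse_eq_divide)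
    show "(f' has_real_derivative f'' x) (at x)" for x
      unfolding f'_def f''_def using pos[of x]
      by (auto intro!: derivative_eq_intros simp: power2_eq_square)
    show "\<bar>f'' x\<bar> \<le> 2 * n" for x
    proof -
      have "2 * \<bar>c * x\<bar> \<le> 1 + (c * x)\<^sup>2"
        using sum_squares_bound[of 1 "\<bar>c * x\<bar>"] by simp
      also have "\<dots> \<le> (1 + (c * x)\<^sup>2)\<^sup>2"
        by (simp add: power2_eq_square[of "1 + _"] algebra_simps)
      finally have "2 * \<bar>c * x\<bar> / (1 + (c * x)\<^sup>2)\<^sup>2 \<le> 1"
        using pos[of x] by (simp add: divide_le_eq_1_pos)
      then have "2 * \<bar>c * x\<bar> / (1 + (c * x)\<^sup>2)\<^sup>2 * c \<le> 1 * (2 * n)"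
        using c by (intro mult_mono) auto
      moreover have "\<bar>f'' x\<bar> = 2 * \<bar>c * x\<bar> / (1 + (c * x)\<^sup>2)\<^sup>2 * c"
        using c by (simp add: f''_def abs_mult)
      ultimately show ?thesis by simp
    qed
  qed (use assms in auto)
  moreover have "1 \<le> f' s + n ^ 3 * s\<^sup>2 * lag n s"
  proof -
    have "1 - f' s = (c * s)\<^sup>2 / (1 + (c * s)\<^sup>2)"
      using pos[of s] by (simp add: f'_def field_simps)
    also have "\<dots> = n\<^sup>2 * s\<^sup>2 / g * g ^ 3 / (1 + (c * s)\<^sup>2)"
      by (simp add: c_def g_def power2_eq_square power3_eq_cube)
    also have "\<dots> = n\<^sup>2 * s\<^sup>2 / g * (g ^ 3 / (1 + (c * s)\<^sup>2))"
      by (simp only: times_divide_eq_right)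
    also have "\<dots> \<le> n\<^sup>2 * s\<^sup>2 / g * (63 / 50 / (1 + (c * s)\<^sup>2))"
      by (intro mult_left_mono divide_right_mono) (auto simp: g_def power3_eq_cube)
    also have "\<dots> \<le> n\<^sup>2 * s\<^sup>2 / g * (pi / 2 + arctan (c * s))"
      by (intro mult_left_mono inverse_square_le_arctan) (auto simp: g_def)
    also have "\<dots> = n ^ 3 * s\<^sup>2 * lag n s"
      using n by (simp add: lag c_def power2_eq_square power3_eq_cube)
    finally show ?thesis by simp
  qed
  then have "\<tau> * 1 \<le> \<tau> * (f' s + n ^ 3 * s\<^sup>2 * lag n s)"
    using assms by (intro mult_left_mono) auto
  ultimately show ?thesis by (simp add: algebra_simps)
qed

lemma exp_arctan_le: "exp (3 * arctan s) \<le> exp (3 * pi / 2)"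
  using arctan_ubound[of s] by simp

lemma exp_arctan_ge: "exp (- (3 * pi / 2)) \<le> exp (3 * arctan s)"
  using arctan_lbound[of s] by simp

text \<open>
  The identity \<open>G' = 3 / (1 + s^2) * G\<close> for \<open>G = exp (3 * arctan s)\<close>, as a backward difference with the
  Taylor remainder.
\<close>
lemma exp_arctan_step:
  assumes "\<tau> \<ge> 0"
  shows "exp (3 * arctan (s - \<tau>)) + \<tau> * (3 / (1 + s\<^sup>2) * exp (3 * arctan s)) \<le>
    exp (3 * arctan s) + 12 * exp (3 * pi / 2) * \<tau>\<^sup>2"
proof -
  define f' where "f' x = 3 / (1 + x\<^sup>2) * exp (3 * arctan x)" for x :: real
  define f'' where "f'' x = (9 - 6 * x) / (1 + x\<^sup>2)\<^sup>2 * exp (3 * arctan x)" for x :: real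
  have nz: "1 + x\<^sup>2 \<noteq> 0" for x :: real
    using zero_le_power2[of x] by linarith
  have "exp (3 * arctan (s - \<tau>)) \<le> exp (3 * arctan s) - \<tau> * f' s + 12 * exp (3 * pi / 2) * \<tau>\<^sup>2"
  proof (rule taylor_backward_step[where f'' = f''])
    show "((\<lambda>x. exp (3 * arctan x)) has_real_derivative f' x) (at x)" for x
      by (auto intro!: derivative_eq_intros simp: f'_def inverse_eq_divide)
    show "(f' has_real_derivative f'' x) (at x)" for x
      unfolding f'_def f''_def using nz[of x]
      by (auto intro!: derivative_eq_intros simp: inverse_eq_divide power2_eq_square[of "1 + _"] divide_simps)
         (simp add: algebra_simps)
    show "\<bar>f'' x\<bar> \<le> 12 * exp (3 * pi / 2)" for x
    proof -
      have "2 * \<bar>x\<bar> \<le> 1 + x\<^sup>2"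
        using sum_squares_bound[of 1 "\<bar>x\<bar>"] by simp
      moreover have "1 + x\<^sup>2 \<le> (1 + x\<^sup>2)\<^sup>2" "1 \<le> (1 + x\<^sup>2)\<^sup>2"
        by (auto simp: power2_eq_square[of "1 + _"] algebra_simps)
      ultimately have "\<bar>9 - 6 * x\<bar> \<le> 12 * (1 + x\<^sup>2)\<^sup>2" by linarith
      then have "\<bar>9 - 6 * x\<bar> / (1 + x\<^sup>2)\<^sup>2 \<le> 12" using nz[of x] by (simp add: divide_le_eq)
      then have "\<bar>9 - 6 * x\<bar> / (1 + x\<^sup>2)\<^sup>2 * exp (3 * arctan x) \<le> 12 * exp (3 * pi / 2)"
        by (intro mult_mono exp_arctan_le) auto
      then show ?thesis by (simp add: f''_def abs_mult)
    qed
  qed (use assms in auto)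
  then show ?thesis by (simp add: f'_def)
qed

text \<open>
  An upper solution of \<open>f' + n^3 s^2 f = 0\<close> with value 1 at \<open>t = 0\<close>, where \<open>s\<close> runs with \<open>t\<close>. Its
  logarithmic derivative is \<open>- n x^2 / (1 + x^2)\<close> with \<open>x = n s\<close>. In contrast to the exact solution its
  rate is bounded by \<open>n\<close>, which makes Taylor remainders uniform in the frequency, and it still
  decays like \<open>exp (- n t)\<close>. The decay is what keeps the estimate bounded for large viscosity.
\<close>
definition decay :: "real \<Rightarrow> real \<Rightarrow> real \<Rightarrow> real" where
  "decay n t s = exp (- (n * t) + arctan (n * s) - arctan (n * (s - t)))"

lemma decay_0 [simp]: "decay n 0 s = 1"
  by (simp add: decay_def)

lemma decay_le: "decay n t s \<le> exp pi * exp (- (n * t))"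
  using arctan_ubound[of "n * s"] arctan_lbound[of "n * (s - t)"]
  by (simp add: decay_def flip: exp_add)

lemma DERIV_decay:
  "((\<lambda>x. decay n (t + x) (s + x)) has_real_derivative
     - n * ((n * (s + x))\<^sup>2 / (1 + (n * (s + x))\<^sup>2)) * decay n (t + x) (s + x)) (at x)"
proof -
  have nz: "1 + (n * (s + x))\<^sup>2 \<noteq> 0"
    using zero_le_power2[of "n * (s + x)"] by linarith
  have "((\<lambda>x. exp (- (n * (t + x)) + arctan (n * (s + x)) - arctan (n * (s - t)))) has_real_derivative
     (- n + n * inverse (1 + (n * (s + x))\<^sup>2)) * exp (- (n * (t + x)) + arctan (n * (s + x)) - arctan (n * (s - t)))) (at x)"
    by (auto intro!: derivative_eq_intros simp: algebra_simps)
  moreover have "- n + n * inverse (1 + (n * (s + x))\<^sup>2) = - n * ((n * (s + x))\<^sup>2 / (1 + (n * (s + x))\<^sup>2))"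
    using nz by (simp add: field_simps)
  ultimately show ?thesis by (simp add: decay_def)
qed

lemma decay_step:
  assumes n: "n > 0" and \<tau>: "\<tau> \<ge> 0" "\<tau> \<le> t"
  shows "decay n (t - \<tau>) (s - \<tau>) \<le> (1 + \<tau> * (n ^ 3 * s\<^sup>2)) * decay n t s + 2 * n\<^sup>2 * exp pi * \<tau>\<^sup>2"
proof -
  define x where "x r = n * (s + r)" for r
  define F where "F r = decay n (t + r) (s + r)" for r
  define f' where "f' r = - n * ((x r)\<^sup>2 / (1 + (x r)\<^sup>2)) * F r" for r
  define f'' where "f'' r = n\<^sup>2 * (((x r)\<^sup>2 / (1 + (x r)\<^sup>2))\<^sup>2 - 2 * x r / (1 + (x r)\<^sup>2)\<^sup>2) * F r" for r
  have pos: "1 + (x r)\<^sup>2 > 0" for r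
    by (simp add: add_pos_nonneg)
  then have nz: "1 + (x r)\<^sup>2 \<noteq> 0" for r
    by (simp add: less_imp_neq[THEN not_sym])
  have F: "(F has_real_derivative f' r) (at r)" for r
    unfolding F_def f'_def x_def by (rule DERIV_decay)
  have "F (0 - \<tau>) \<le> F 0 - \<tau> * f' 0 + (2 * n\<^sup>2 * exp pi) * \<tau>\<^sup>2"
  proof (rule taylor_backward_step[where f'' = f''])
    show "(f' has_real_derivative f'' r) (at r)" for r
    proof -
      have "((\<lambda>r. (x r)\<^sup>2 / (1 + (x r)\<^sup>2)) has_real_derivative n * (2 * x r) / (1 + (x r)\<^sup>2)\<^sup>2) (at r)"
        using nz[of r] unfolding x_def
        by (auto intro!: derivative_eq_intros simp: power2_eq_square[of "1 + _"] divide_simps)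
           (simp add: algebra_simps power2_eq_square)
      then have "((\<lambda>r. - n * ((x r)\<^sup>2 / (1 + (x r)\<^sup>2)) * F r) has_real_derivative
          - n * (n * (2 * x r) / (1 + (x r)\<^sup>2)\<^sup>2) * F r + f' r * (- n * ((x r)\<^sup>2 / (1 + (x r)\<^sup>2)))) (at r)"
        by (rule DERIV_mult[OF DERIV_cmult F])
      then show ?thesis
        unfolding f''_def f'_def by (simp add: algebra_simps power2_eq_square)
    qed
    show "\<bar>f'' r\<bar> \<le> 2 * n\<^sup>2 * exp pi" if "0 - \<tau> \<le> r" "r \<le> 0" for r
    proof -
      have "2 * \<bar>x r\<bar> \<le> 1 + (x r)\<^sup>2"
        using sum_squares_bound[of 1 "\<bar>x r\<bar>"] by simp
      moreover have "1 + (x r)\<^sup>2 \<le> (1 + (x r)\<^sup>2)\<^sup>2"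
        by (auto simp: power2_eq_square[of "1 + _"] algebra_simps)
      ultimately have "\<bar>2 * x r / (1 + (x r)\<^sup>2)\<^sup>2\<bar> \<le> 1"
        using pos[of r] by (simp add: abs_mult divide_le_eq_1_pos)
      moreover have "0 \<le> (x r)\<^sup>2 / (1 + (x r)\<^sup>2)" "(x r)\<^sup>2 / (1 + (x r)\<^sup>2) \<le> 1"
        using pos[of r] by (auto simp: divide_le_eq)
      then have "\<bar>((x r)\<^sup>2 / (1 + (x r)\<^sup>2))\<^sup>2\<bar> \<le> 1" by (simp add: abs_square_le_1)
      ultimately have "\<bar>((x r)\<^sup>2 / (1 + (x r)\<^sup>2))\<^sup>2 - 2 * x r / (1 + (x r)\<^sup>2)\<^sup>2\<bar> \<le> 2"
        using abs_triangle_ineq4[of "((x r)\<^sup>2 / (1 + (x r)\<^sup>2))\<^sup>2" "2 * x r / (1 + (x r)\<^sup>2)\<^sup>2"] by linarith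
      moreover have "F r \<le> exp pi"
      proof -
        have "F r \<le> exp pi * exp (- (n * (t + r)))" unfolding F_def by (rule decay_le)
        also have "\<dots> \<le> exp pi * 1" using n \<tau> that by (intro mult_left_mono) auto
        finally show ?thesis by simp
      qed
      ultimately have "n\<^sup>2 * \<bar>((x r)\<^sup>2 / (1 + (x r)\<^sup>2))\<^sup>2 - 2 * x r / (1 + (x r)\<^sup>2)\<^sup>2\<bar> * F r \<le> n\<^sup>2 * 2 * exp pi"
        by (intro mult_mono) (auto simp: F_def decay_def)
      then show ?thesis by (simp add: f''_def abs_mult F_def decay_def mult_ac)
    qed
  qed (use F \<tau> in auto)
  moreover have "- f' 0 \<le> n ^ 3 * s\<^sup>2 * F 0"
  proof -
    have "(x 0)\<^sup>2 / (1 + (x 0)\<^sup>2) \<le> (x 0)\<^sup>2"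
      using nz[of 0] by (simp add: divide_le_eq add_pos_nonneg) (simp add: algebra_simps)
    then have "n * ((x 0)\<^sup>2 / (1 + (x 0)\<^sup>2)) * F 0 \<le> n * (x 0)\<^sup>2 * F 0"
      using n by (intro mult_right_mono mult_left_mono) (auto simp: F_def decay_def)
    then show ?thesis by (simp add: f'_def x_def power2_eq_square power3_eq_cube mult_ac)
  qed
  then have "\<tau> * (- f' 0) \<le> \<tau> * (n ^ 3 * s\<^sup>2 * F 0)"
    using \<tau> by (intro mult_left_mono) auto
  ultimately show ?thesis by (simp add: F_def algebra_simps)
qed

lemma decay_decrease_le:
  assumes n: "n > 0" and "t \<ge> 0" "\<tau> \<ge> 0"
  shows "decay n t s \<le> decay n (t + \<tau>) (s + \<tau>) + n * exp pi * \<tau>"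
proof (cases "\<tau> = 0")
  case False
  let ?r = "\<lambda>z. (n * (s + z))\<^sup>2 / (1 + (n * (s + z))\<^sup>2)"
  from False have \<tau>: "0 < \<tau>" using assms by simp
  obtain z where z: "0 < z" "z < \<tau>"
    "decay n (t + \<tau>) (s + \<tau>) - decay n (t + 0) (s + 0) = (\<tau> - 0) * (- n * ?r z * decay n (t + z) (s + z))"
    using MVT2[OF \<tau>, of "\<lambda>z. decay n (t + z) (s + z)" "\<lambda>z. - n * ?r z * decay n (t + z) (s + z)"] DERIV_decay by auto
  have "1 + (n * (s + z))\<^sup>2 > 0" by (simp add: add_pos_nonneg)
  then have "?r z \<le> 1" by (simp add: divide_le_eq)
  moreover have "decay n (t + z) (s + z) \<le> exp pi * 1"
    by (rule order.trans[OF decay_le]) (use n z assms in auto)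
  ultimately have "?r z * decay n (t + z) (s + z) \<le> 1 * exp pi"
    by (intro mult_mono) (auto simp: decay_def)
  then have "\<tau> * (n * (?r z * decay n (t + z) (s + z))) \<le> \<tau> * (n * (1 * exp pi))"
    using n \<tau> by (intro mult_left_mono) auto
  then show ?thesis using z(3) by (simp add: mult_ac)
qed simp

lemma one_minus_exp_step:
  fixes n :: real
  assumes "n > 0"
  shows "(1 - exp (- (n * (t - \<tau>)))) / n + \<tau> * exp (- (n * t)) \<le> (1 - exp (- (n * t))) / n"
proof -
  have "exp (- (n * t)) * (1 + n * \<tau>) \<le> exp (- (n * t)) * exp (n * \<tau>)"
    using exp_ge_add_one_self[of "n * \<tau>"] by (intro mult_left_mono) auto
  also have "\<dots> = exp (- (n * (t - \<tau>)))" by (simp add: exp_add [symmetric] right_diff_distrib)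
  finally have "(1 - exp (- (n * (t - \<tau>))) + n * \<tau> * exp (- (n * t))) / n \<le> (1 - exp (- (n * t))) / n"
    using assms by (intro divide_right_mono) (auto simp: algebra_simps)
  then show ?thesis using assms by (simp add: add_divide_distrib)
qed

section \<open>A comparison principle\<close>

text \<open>
  The backward inequality alone allows upward jumps; semicontinuity from the right excludes them. At the first
  time \<open>T\<close> at which \<open>e\<close> reaches a fast exponential, the step inequality contradicts the growth of
  the exponential just before \<open>T\<close>.
\<close>
lemma backward_gronwall_zero:
  fixes e :: "real \<Rightarrow> real"
  assumes nonneg: "\<And>t. e t \<ge> 0" and e0: "e 0 = 0" and C: "C \<ge> 0"
    and usc: "\<And>t \<epsilon>. t \<ge> 0 \<Longrightarrow> \<epsilon> > 0 \<Longrightarrow> \<forall>\<^sub>F s in at_right t. e s \<le> (1 + \<epsilon>) * e t + \<epsilon>"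
    and step: "\<And>t \<epsilon>. t > 0 \<Longrightarrow> \<epsilon> > 0 \<Longrightarrow>
      \<forall>\<^sub>F \<tau> in at_right 0. e t \<le> (1 + \<tau>) * e (t - \<tau>) + \<tau> * (C * e t + \<epsilon>)"
    and t: "t \<ge> 0"
  shows "e t = 0"
proof -
  have "e t \<le> \<delta> * exp ((C + 2) * t)" if \<delta>: "\<delta> > 0" for \<delta>
  proof (rule ccontr)
    define \<Phi> where "\<Phi> t = \<delta> * exp ((C + 2) * t)" for t
    have \<Phi>_pos: "\<Phi> t > 0" for t using \<delta> by (simp add: \<Phi>_def)
    have \<Phi>_mono: "\<Phi> r \<le> \<Phi> s" if "r \<le> s" for r s
      using \<delta> C that by (auto simp: \<Phi>_def intro!: mult_left_mono)
    define S where "S = {s. s \<ge> 0 \<and> e s \<ge> \<Phi> s}"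
    assume "\<not> e t \<le> \<delta> * exp ((C + 2) * t)"
    then have "t \<in> S" using t by (simp add: S_def \<Phi>_def)
    then have S: "S \<noteq> {}" "bdd_below S" by (auto simp: S_def intro!: bdd_belowI[of _ 0])
    define T where "T = Inf S"
    have T0: "T \<ge> 0" unfolding T_def using S by (intro cInf_greatest) (auto simp: S_def)
    have below: "e s < \<Phi> s" if "0 \<le> s" "s < T" for s
      using that cInf_lower[OF _ S(2), of s] by (force simp: T_def S_def not_le)
    have T: "e T \<ge> \<Phi> T"
    proof (rule ccontr)
      assume "\<not> e T \<ge> \<Phi> T"
      then have less: "e T < \<Phi> T" by simp
      define \<epsilon> where "\<epsilon> = (\<Phi> T - e T) / (2 * (1 + e T))"
      have \<epsilon>: "\<epsilon> > 0" using less nonneg[of T] by (simp add: \<epsilon>_def add_pos_nonneg)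
      have "1 + e T > 0" using nonneg[of T] by simp
      then have "\<epsilon> * (1 + e T) = (\<Phi> T - e T) / 2" by (simp add: \<epsilon>_def field_simps)
      then have lt: "(1 + \<epsilon>) * e T + \<epsilon> < \<Phi> T" using less by (simp add: algebra_simps)
      obtain b where b: "b > T" "\<And>s. T < s \<Longrightarrow> s < b \<Longrightarrow> e s \<le> (1 + \<epsilon>) * e T + \<epsilon>"
        using usc[OF T0 \<epsilon>] by (auto simp: eventually_at_right_field)
      have "b \<le> T"
        unfolding T_def
      proof (rule cInf_greatest[OF S(1)])
        fix s assume s: "s \<in> S"
        then have "T \<le> s" unfolding T_def by (intro cInf_lower S)
        moreover have "s \<noteq> T" using s less by (auto simp: S_def)
        ultimately have "T < s" by simp
        then show "b \<le> s"
          using b(2)[of s] lt \<Phi>_mono[of T s] s by (force simp: S_def)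
      qed
      then show False using b by simp
    qed
    have "T \<noteq> 0" using T e0 \<Phi>_pos[of 0] by auto
    then have Tpos: "T > 0" using T0 by simp
    define \<tau>0 where "\<tau>0 = min T (1 / (4 * (C + 1)\<^sup>2))"
    have \<tau>0: "\<tau>0 > 0" using Tpos C by (simp add: \<tau>0_def)
    have "\<forall>\<^sub>F \<tau> in at_right 0. \<tau> < \<tau>0 \<and> 0 < \<tau>"
      using \<tau>0 by (auto simp: eventually_at_right_field)
    moreover have "\<Phi> T / 2 > 0" using \<Phi>_pos by simp
    note step[OF Tpos this]
    ultimately have "\<forall>\<^sub>F \<tau> in at_right (0::real). False"
    proof eventually_elim
      case (elim \<tau>)
      then have \<tau>: "0 < \<tau>" "\<tau> < T" "\<tau> * (4 * (C + 1)\<^sup>2) < 1"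
        using C by (auto simp: \<tau>0_def field_simps add_pos_nonneg)
      define x where "x = (C + 1) * \<tau>"
      have x: "x \<ge> 0" "x * x * 4 < \<tau>"
      proof -
        show "x \<ge> 0" using C \<tau> by (simp add: x_def)
        have "\<tau> * (\<tau> * (4 * (C + 1)\<^sup>2)) < \<tau> * 1" using \<tau> by (intro mult_strict_left_mono) auto
        then show "x * x * 4 < \<tau>" by (simp add: x_def power2_eq_square mult_ac)
      qed
      have "C * \<tau> < 1"
      proof -
        have "0 \<le> C * C" using C by simp
        then have "C \<le> 4 * (C + 1)\<^sup>2" using C by (simp add: power2_eq_square algebra_simps)
        then have "\<tau> * C \<le> \<tau> * (4 * (C + 1)\<^sup>2)" using \<tau> by (intro mult_left_mono) auto
        also have "\<dots> < 1" by (rule \<tau>)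
        finally show ?thesis by (simp add: mult.commute)
      qed
      have "e T * (1 - C * \<tau>) \<le> (1 + \<tau>) * e (T - \<tau>) + \<tau> * (\<Phi> T / 2)"
        using elim by (simp add: algebra_simps)
      also have "\<dots> \<le> (1 + \<tau>) * \<Phi> (T - \<tau>) + \<tau> * (\<Phi> T / 2)"
        using below[of "T - \<tau>"] \<tau> by (intro add_right_mono mult_left_mono) auto
      also have "\<Phi> (T - \<tau>) = \<Phi> T * exp (- ((C + 2) * \<tau>))"
        by (simp add: \<Phi>_def algebra_simps flip: exp_add)
      finally have "e T * (1 - C * \<tau>) \<le> \<Phi> T * ((1 + \<tau>) * exp (- ((C + 2) * \<tau>)) + \<tau> / 2)"
        by (simp add: algebra_simps)
      moreover have "\<Phi> T * (1 - C * \<tau>) \<le> e T * (1 - C * \<tau>)"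
        using T \<open>C * \<tau> < 1\<close> by (intro mult_right_mono) auto
      ultimately have "\<Phi> T * (1 - C * \<tau>) \<le> \<Phi> T * ((1 + \<tau>) * exp (- ((C + 2) * \<tau>)) + \<tau> / 2)"
        by linarith
      then have "1 - C * \<tau> \<le> (1 + \<tau>) * exp (- ((C + 2) * \<tau>)) + \<tau> / 2"
        using \<Phi>_pos[of T] by simp
      also have "(1 + \<tau>) * exp (- ((C + 2) * \<tau>)) \<le> exp \<tau> * exp (- ((C + 2) * \<tau>))"
        using exp_ge_add_one_self[of \<tau>] by (intro mult_right_mono) auto
      also have "\<dots> = exp (- x)" by (simp add: x_def algebra_simps flip: exp_add)
      also have "\<dots> \<le> 1 / (1 + x)"
        using exp_ge_add_one_self[of x] x by (simp add: exp_minus field_simps)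
      also have "\<dots> \<le> 1 - x + x * x"
        using x by (subst pos_divide_le_eq) (auto simp: algebra_simps)
      finally have "x - C * \<tau> \<le> x * x + \<tau> / 2" by simp
      then show False using x \<tau> by (simp add: x_def algebra_simps)
    qed
    then show False by simp
  qed
  then have "e t \<le> 0 + \<epsilon>" if "\<epsilon> > 0" for \<epsilon>
    using that by (metis add_0 divide_pos_pos exp_gt_zero exp_not_eq_zero nonzero_eq_divide_eq)
  then have "e t \<le> 0" by (rule field_le_epsilon)
  then show ?thesis using nonneg[of t] by simp
qed

text \<open>
  One backward step for the squared norm: \<open>x'\<close> is the value at the earlier time, \<open>w\<close> the source,
  \<open>q\<close> the error of the difference quotient and \<open>E\<close> the Taylor remainder of the majorant.
\<close>
lemma weighted_sq_step:
  assumes [measurable]: "x' \<in> borel_measurable frequencies" "w \<in> borel_measurable frequencies"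
      "q \<in> borel_measurable frequencies" "E \<in> borel_measurable frequencies"
    and \<tau>: "0 < \<tau>" "\<tau> \<le> 1"
    and le: "AE \<kappa> in frequencies. x \<kappa> \<le> x' \<kappa> + ennreal \<tau> * (w \<kappa> + (q \<kappa> + ennreal \<tau> * E \<kappa>))"
  shows "weighted_sq s x \<le> ennreal (1 + \<tau>) * weighted_sq s x' +
    ennreal \<tau> * (4 * weighted_sq s w + (8 * weighted_sq s q + 8 * (ennreal (\<tau>\<^sup>2) * weighted_sq s E)))"
proof -
  have "weighted_sq s x \<le> weighted_sq s (\<lambda>\<kappa>. x' \<kappa> + ennreal \<tau> * (w \<kappa> + (q \<kappa> + ennreal \<tau> * E \<kappa>)))"
    by (rule weighted_sq_mono_AE) (rule le)
  also have "\<dots> \<le> ennreal (1 + \<tau>) * weighted_sq s x' +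
      ennreal (1 + 1 / \<tau>) * weighted_sq s (\<lambda>\<kappa>. ennreal \<tau> * (w \<kappa> + (q \<kappa> + ennreal \<tau> * E \<kappa>)))"
    by (rule weighted_sq_add_le) (use \<tau> in measurable)
  also have "weighted_sq s (\<lambda>\<kappa>. ennreal \<tau> * (w \<kappa> + (q \<kappa> + ennreal \<tau> * E \<kappa>))) =
      ennreal (\<tau>\<^sup>2) * weighted_sq s (\<lambda>\<kappa>. w \<kappa> + (q \<kappa> + ennreal \<tau> * E \<kappa>))"
    using \<tau> by (subst weighted_sq_cmult) (auto simp: ennreal_power)
  also have "ennreal (1 + 1 / \<tau>) * (ennreal (\<tau>\<^sup>2) * weighted_sq s (\<lambda>\<kappa>. w \<kappa> + (q \<kappa> + ennreal \<tau> * E \<kappa>))) \<le>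
      ennreal (2 * \<tau>) * weighted_sq s (\<lambda>\<kappa>. w \<kappa> + (q \<kappa> + ennreal \<tau> * E \<kappa>))"
  proof -
    have "(1 + 1 / \<tau>) * \<tau>\<^sup>2 \<le> 2 * \<tau>"
      using \<tau> mult_left_le[of \<tau> \<tau>] by (simp add: field_simps power2_eq_square)
    then show ?thesis using \<tau> by (subst ennreal_mult_mult) (auto intro!: mult_right_mono ennreal_leI)
  qed
  also have "weighted_sq s (\<lambda>\<kappa>. w \<kappa> + (q \<kappa> + ennreal \<tau> * E \<kappa>)) \<le>
      2 * weighted_sq s w + 2 * weighted_sq s (\<lambda>\<kappa>. q \<kappa> + ennreal \<tau> * E \<kappa>)"
    by (rule weighted_sq_add_le2) measurable
  also have "weighted_sq s (\<lambda>\<kappa>. q \<kappa> + ennreal \<tau> * E \<kappa>) \<le>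
      2 * weighted_sq s q + 2 * weighted_sq s (\<lambda>\<kappa>. ennreal \<tau> * E \<kappa>)"
    by (rule weighted_sq_add_le2) measurable
  also have "weighted_sq s (\<lambda>\<kappa>. ennreal \<tau> * E \<kappa>) = ennreal (\<tau>\<^sup>2) * weighted_sq s E"
    using \<tau> by (subst weighted_sq_cmult) (auto simp: ennreal_power)
  finally have *: "weighted_sq s x \<le> ennreal (1 + \<tau>) * weighted_sq s x' +
      ennreal (2 * \<tau>) * (2 * weighted_sq s w + 2 * (2 * weighted_sq s q + 2 * (ennreal (\<tau>\<^sup>2) * weighted_sq s E)))"
    by (simp add: add_left_mono mult_left_mono)
  have 2: "ennreal (2 * \<tau>) = ennreal \<tau> * 2" "(4::ennreal) = 2 * 2" "(8::ennreal) = 2 * 2 * 2"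
    using \<tau> by (simp_all add: ennreal_mult mult.commute)
  show ?thesis using * unfolding 2 by (simp only: distrib_left mult.assoc)
qed

lemma filterlim_uminus_at_right_0: "filterlim (\<lambda>\<tau>::real. - \<tau>) (at 0) (at_right 0)"
  by (rule filterlim_atI) (auto intro!: tendsto_eq_intros eventually_at_right_less[THEN eventually_mono])

lemma weighted_sq_usc_step:
  assumes [measurable]: "x' \<in> borel_measurable frequencies" "q \<in> borel_measurable frequencies"
      "E \<in> borel_measurable frequencies"
    and \<epsilon>: "0 < \<epsilon>" and \<tau>: "0 \<le> \<tau>"
    and le: "\<And>\<kappa>. x \<kappa> \<le> x' \<kappa> + (q \<kappa> + ennreal \<tau> * E \<kappa>)"
  shows "weighted_sq s x \<le> ennreal (1 + \<epsilon>) * weighted_sq s x' +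
    ennreal (1 + 1 / \<epsilon>) * (2 * weighted_sq s q + 2 * (ennreal (\<tau>\<^sup>2) * weighted_sq s E))"
proof -
  have "weighted_sq s x \<le> weighted_sq s (\<lambda>\<kappa>. x' \<kappa> + (q \<kappa> + ennreal \<tau> * E \<kappa>))"
    by (rule weighted_sq_mono) (rule le)
  also have "\<dots> \<le> ennreal (1 + \<epsilon>) * weighted_sq s x' +
      ennreal (1 + 1 / \<epsilon>) * weighted_sq s (\<lambda>\<kappa>. q \<kappa> + ennreal \<tau> * E \<kappa>)"
    by (rule weighted_sq_add_le) (use \<epsilon> in measurable)
  also have "weighted_sq s (\<lambda>\<kappa>. q \<kappa> + ennreal \<tau> * E \<kappa>) \<le>
      2 * weighted_sq s q + 2 * weighted_sq s (\<lambda>\<kappa>. ennreal \<tau> * E \<kappa>)"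
    by (rule weighted_sq_add_le2) measurable
  also have "weighted_sq s (\<lambda>\<kappa>. ennreal \<tau> * E \<kappa>) = ennreal (\<tau>\<^sup>2) * weighted_sq s E"
    using \<tau> by (subst weighted_sq_cmult) (auto simp: ennreal_power)
  finally show ?thesis by (simp add: add_left_mono mult_left_mono)
qed

lemma norm_le_of_eq_sum3: "x = a + b + c \<Longrightarrow> norm x \<le> norm a + norm b + norm c"
  using norm_triangle_ineq[of "a + b" c] norm_triangle_ineq[of a b] by simp

lemma coupled_step_add:
  fixes x y :: ennreal
  assumes "x \<le> p * x' + \<tau> * (4 * y + r)" "y \<le> p * y' + \<tau> * (4 * z + r')" "z \<le> c * x"
  shows "x + y \<le> p * (x' + y') + \<tau> * (4 * (y + c * x) + (r + r'))"
proof -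
  have "x + y \<le> (p * x' + \<tau> * (4 * y + r)) + (p * y' + \<tau> * (4 * z + r'))"
    by (intro add_mono assms)
  also have "\<dots> = p * (x' + y') + \<tau> * (4 * (y + z) + (r + r'))"
    by (simp only: distrib_left add_ac)
  also have "\<dots> \<le> p * (x' + y') + \<tau> * (4 * (y + c * x) + (r + r'))"
    by (intro add_mono mult_left_mono order_refl assms) auto
  finally show ?thesis .
qed

text \<open>
  The majorants \<open>Ob\<close> of \<open>U\<close> and \<open>Bb\<close> of \<open>V\<close> are upper solutions of the system up to
  \<open>\<tau>^2 E\<close>. The excesses \<open>x\<close> and \<open>y\<close> of \<open>|U|\<close> and \<open>|V|\<close> over the majorants feed only on each other,
  so their squared norm satisfies the hypotheses of \<open>backward_gronwall_zero\<close>. The order \<open>s\<close> of the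
  norms may be negative: a bound almost everywhere is the same statement in every order.
  Both equations are solved backward from \<open>t\<close> to \<open>t - \<tau>\<close>,
  and the factor \<open>1 + \<tau> * d t \<kappa>\<close>, although unbounded in the frequency, can be cancelled from
  the inequality for \<open>U\<close> because it is at least 1.
\<close>
lemma comparison_principle:
  fixes U V P :: "real \<Rightarrow> int \<times> real \<Rightarrow> complex" and Ob Bb b :: "real \<Rightarrow> int \<times> real \<Rightarrow> ennreal"
    and d :: "real \<Rightarrow> int \<times> real \<Rightarrow> real"
  assumes mu: "sigma_finite_measure \<mu>" "sets \<mu> = sets borel"
    and meas: "\<And>t. t \<ge> 0 \<Longrightarrow> U t \<in> borel_measurable frequencies" "\<And>t. t \<ge> 0 \<Longrightarrow> V t \<in> borel_measurable frequencies"
      "\<And>t. t > 0 \<Longrightarrow> P t \<in> borel_measurable frequencies" "\<And>t. d t \<in> borel_measurable frequencies"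
      "\<And>t. t \<ge> 0 \<Longrightarrow> Ob t \<in> borel_measurable frequencies" "\<And>t. t \<ge> 0 \<Longrightarrow> Bb t \<in> borel_measurable frequencies"
      "E \<in> borel_measurable frequencies"
    and conv: "\<And>g. g \<in> borel_measurable frequencies \<Longrightarrow> weighted_sq s (conv \<mu> g) \<le> ennreal c * weighted_sq s g" "c \<ge> 0"
    and fin: "\<And>t. t \<ge> 0 \<Longrightarrow> sobolev_sq s (U t) < \<infinity>" "\<And>t. t \<ge> 0 \<Longrightarrow> sobolev_sq s (V t) < \<infinity>" "weighted_sq s E < \<infinity>"
    and cont: "\<And>t. t \<ge> 0 \<Longrightarrow> ((\<lambda>r. sobolev_sq s (\<lambda>\<kappa>. U r \<kappa> - U t \<kappa>)) \<longlongrightarrow> 0) (at_right t)"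
      "\<And>t. t \<ge> 0 \<Longrightarrow> ((\<lambda>r. sobolev_sq s (\<lambda>\<kappa>. V r \<kappa> - V t \<kappa>)) \<longlongrightarrow> 0) (at_right t)"
    and deriv: "\<And>t. t > 0 \<Longrightarrow> has_sobolev_derivative s U (\<lambda>\<kappa>. - complex_of_real (d t \<kappa>) * U t \<kappa> + V t \<kappa>) t"
      "\<And>t. t > 0 \<Longrightarrow> has_sobolev_derivative s V (P t) t"
    and d: "\<And>t \<kappa>. d t \<kappa> \<ge> 0"
    and P: "\<And>t. t > 0 \<Longrightarrow> AE \<kappa> in frequencies.
      ennreal (cmod (P t \<kappa>)) \<le> conv \<mu> (\<lambda>\<kappa>. ennreal (cmod (U t \<kappa>)) - Ob t \<kappa>) \<kappa> + b t \<kappa>"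
    and B_step: "\<And>t \<tau> \<kappa>. 0 \<le> \<tau> \<Longrightarrow> \<tau> \<le> t \<Longrightarrow> Bb (t - \<tau>) \<kappa> + ennreal \<tau> * b t \<kappa> \<le> Bb t \<kappa> + ennreal (\<tau>\<^sup>2) * E \<kappa>"
    and O_step: "\<And>t \<tau> \<kappa>. 0 \<le> \<tau> \<Longrightarrow> \<tau> \<le> t \<Longrightarrow> Ob (t - \<tau>) \<kappa> + ennreal \<tau> * Bb t \<kappa> \<le>
      ennreal (1 + \<tau> * d t \<kappa>) * Ob t \<kappa> + ennreal (\<tau>\<^sup>2) * E \<kappa>"
    and B_mono: "\<And>t t' \<kappa>. 0 \<le> t \<Longrightarrow> t \<le> t' \<Longrightarrow> Bb t \<kappa> \<le> Bb t' \<kappa>"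
    and O_decrease: "\<And>t t' \<kappa>. 0 \<le> t \<Longrightarrow> t \<le> t' \<Longrightarrow> Ob t \<kappa> \<le> Ob t' \<kappa> + ennreal (t' - t) * E \<kappa>"
    and init: "\<And>\<kappa>. ennreal (cmod (U 0 \<kappa>)) \<le> Ob 0 \<kappa>" "\<And>\<kappa>. ennreal (cmod (V 0 \<kappa>)) \<le> Bb 0 \<kappa>"
    and t: "t \<ge> 0"
  shows "AE \<kappa> in frequencies. ennreal (cmod (U t \<kappa>)) \<le> Ob t \<kappa> \<and> ennreal (cmod (V t \<kappa>)) \<le> Bb t \<kappa>"
proof -
  note [measurable] = meas(4,7)
  define cm where "cm F = (\<lambda>\<kappa>. ennreal (cmod (F \<kappa>)))" for F :: "int \<times> real \<Rightarrow> complex"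
  have cm_meas [measurable]: "cm F \<in> borel_measurable frequencies" if [measurable]: "F \<in> borel_measurable frequencies" for F
    unfolding cm_def by measurable
  have cm_fin: "cm F \<kappa> < \<infinity>" for F \<kappa> by (simp add: cm_def)
  define x where "x t \<kappa> = cm (U t) \<kappa> - Ob t \<kappa>" for t \<kappa>
  define y where "y t \<kappa> = cm (V t) \<kappa> - Bb t \<kappa>" for t \<kappa>
  have xm: "x t \<in> borel_measurable frequencies" and ym: "y t \<in> borel_measurable frequencies" if "t \<ge> 0" for t
    unfolding x_def y_def using meas that by auto
  have conv_meas: "conv \<mu> g \<in> borel_measurable frequencies" if "g \<in> borel_measurable frequencies" for g
    using mu that by (rule borel_measurable_conv)
  have sob: "sobolev_sq s F = weighted_sq s (cm F)" for F
    by (simp add: sobolev_sq_eq_weighted_sq cm_def)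
  have x_ub: "cm (U t) \<kappa> \<le> Ob t \<kappa> + x t \<kappa>" and y_ub: "cm (V t) \<kappa> \<le> Bb t \<kappa> + y t \<kappa>" for t \<kappa>
    unfolding x_def y_def by (simp_all add: ennreal_minus_le_iff [THEN iffD1])
  have x_leI: "x t \<kappa> \<le> z" if "cm (U t) \<kappa> \<le> Ob t \<kappa> + z" for t \<kappa> z
    unfolding x_def using that cm_fin[of "U t" \<kappa>] by (auto simp: ennreal_minus_le_iff)
  have y_leI: "y t \<kappa> \<le> z" if "cm (V t) \<kappa> \<le> Bb t \<kappa> + z" for t \<kappa> z
    unfolding y_def using that cm_fin[of "V t" \<kappa>] by (auto simp: ennreal_minus_le_iff)
  define A where "A t = weighted_sq s (x t) + weighted_sq s (y t)" for t
  have A_fin: "A t < \<infinity>" if "t \<ge> 0" for t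
  proof -
    have "weighted_sq s (x t) \<le> sobolev_sq s (U t)" "weighted_sq s (y t) \<le> sobolev_sq s (V t)"
      unfolding sob by (auto intro!: weighted_sq_mono simp: x_def y_def)
    then show ?thesis using fin(1,2)[OF that] unfolding A_def
      by (metis ennreal_add_less_top infinity_ennreal_def order_le_less_trans)
  qed
  define e where "e t = (if t \<ge> 0 then enn2real (A t) else 0)" for t
  have eA: "ennreal (e t) = A t" if "t \<ge> 0" for t
    using A_fin[OF that] that by (simp add: e_def)
  have e_nonneg: "e t \<ge> 0" for t by (simp add: e_def)
  define C where "C = 4 * (1 + c)"
  have C0: "C \<ge> 0" using conv(2) by (simp add: C_def)
  have "e t = 0"
  proof (rule backward_gronwall_zero[where e = e and C = C])
    show "C \<ge> 0" by (rule C0)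
    have "x 0 \<kappa> = 0" "y 0 \<kappa> = 0" for \<kappa>
      using x_leI[of 0 \<kappa> 0] y_leI[of 0 \<kappa> 0] init by (auto simp: cm_def)
    then have "A 0 = 0" by (simp add: A_def weighted_sq_def)
    then show "e 0 = 0" by (simp add: e_def)
  next
    fix t \<epsilon> :: real assume t: "t \<ge> 0" and \<epsilon>: "\<epsilon> > 0"
    define qU qV where "qU r = cm (\<lambda>\<kappa>. U r \<kappa> - U t \<kappa>)" and "qV r = cm (\<lambda>\<kappa>. V r \<kappa> - V t \<kappa>)" for r
    define rem where "rem r = ennreal (1 + 1 / \<epsilon>) * (2 * weighted_sq s (qU r) + 2 * (ennreal ((r - t)\<^sup>2) * weighted_sq s E)) +
      ennreal (1 + 1 / \<epsilon>) * (2 * weighted_sq s (qV r) + 2 * (ennreal ((r - t)\<^sup>2) * weighted_sq s E))" for r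
    have "((\<lambda>r. ennreal ((r - t)\<^sup>2)) \<longlongrightarrow> ennreal ((t - t)\<^sup>2)) (at_right t)"
      by (intro tendsto_ennrealI tendsto_intros)
    then have "((\<lambda>r. ennreal ((r - t)\<^sup>2) * weighted_sq s E) \<longlongrightarrow> 0 * weighted_sq s E) (at_right t)"
      using fin(3) unfolding mult.commute[of _ "weighted_sq s E"] by (intro ennreal_tendsto_cmult) auto
    then have "(rem \<longlongrightarrow> ennreal (1 + 1 / \<epsilon>) * (2 * 0 + 2 * (0 * weighted_sq s E)) + ennreal (1 + 1 / \<epsilon>) * (2 * 0 + 2 * (0 * weighted_sq s E))) (at_right t)"
      unfolding rem_def [abs_def] using cont[OF t] unfolding sob qU_def qV_def
      by (intro tendsto_add ennreal_tendsto_cmult) auto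
    then have "(rem \<longlongrightarrow> 0) (at_right t)" by simp
    then have "\<forall>\<^sub>F r in at_right t. rem r < ennreal \<epsilon>"
      using \<epsilon> by (intro order_tendstoD) auto
    moreover have "\<forall>\<^sub>F r in at_right t. r > t"
      by (rule eventually_at_right_less)
    ultimately show "\<forall>\<^sub>F r in at_right t. e r \<le> (1 + \<epsilon>) * e t + \<epsilon>"
    proof eventually_elim
      case (elim r)
      then have r: "r \<ge> 0" "r > t" using t by auto
      have [measurable]: "U t \<in> borel_measurable frequencies" "V t \<in> borel_measurable frequencies"
        "U r \<in> borel_measurable frequencies" "V r \<in> borel_measurable frequencies"
        using meas t r by auto
      have [measurable]: "qU r \<in> borel_measurable frequencies" "qV r \<in> borel_measurable frequencies"
        unfolding qU_def qV_def by measurable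
      have tri: "cm F \<kappa> \<le> cm G \<kappa> + cm (\<lambda>\<kappa>. F \<kappa> - G \<kappa>) \<kappa>" for F G \<kappa>
        using norm_triangle_sub[of "F \<kappa>" "G \<kappa>"]
        by (auto simp: cm_def ennreal_leI simp flip: ennreal_plus)
      have "weighted_sq s (x r) \<le> ennreal (1 + \<epsilon>) * weighted_sq s (x t) +
          ennreal (1 + 1 / \<epsilon>) * (2 * weighted_sq s (qU r) + 2 * (ennreal ((r - t)\<^sup>2) * weighted_sq s E))"
      proof (rule weighted_sq_usc_step)
        fix \<kappa>
        have "cm (U r) \<kappa> \<le> cm (U t) \<kappa> + qU r \<kappa>"
          unfolding qU_def by (rule tri)
        also have "cm (U t) \<kappa> \<le> Ob t \<kappa> + x t \<kappa>" by (rule x_ub)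
        also have "Ob t \<kappa> \<le> Ob r \<kappa> + ennreal (r - t) * E \<kappa>"
          using t r by (intro O_decrease) auto
        finally show "x r \<kappa> \<le> x t \<kappa> + (qU r \<kappa> + ennreal (r - t) * E \<kappa>)"
          by (intro x_leI) (simp add: add_mono add_ac)
      qed (use \<epsilon> r xm[OF t] in auto)
      moreover have "weighted_sq s (y r) \<le> ennreal (1 + \<epsilon>) * weighted_sq s (y t) +
          ennreal (1 + 1 / \<epsilon>) * (2 * weighted_sq s (qV r) + 2 * (ennreal ((r - t)\<^sup>2) * weighted_sq s E))"
      proof (rule weighted_sq_usc_step)
        fix \<kappa>
        have "cm (V r) \<kappa> \<le> cm (V t) \<kappa> + qV r \<kappa>"
          unfolding qV_def by (rule tri)
        also have "cm (V t) \<kappa> \<le> Bb t \<kappa> + y t \<kappa>" by (rule y_ub)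
        also have "Bb t \<kappa> \<le> Bb r \<kappa>"
          using t r by (intro B_mono) auto
        finally have "cm (V r) \<kappa> \<le> Bb r \<kappa> + (y t \<kappa> + qV r \<kappa>)" by (simp add: add_mono add_ac)
        also have "\<dots> \<le> Bb r \<kappa> + (y t \<kappa> + (qV r \<kappa> + ennreal (r - t) * E \<kappa>))"
          by (intro add_left_mono) simp
        finally show "y r \<kappa> \<le> y t \<kappa> + (qV r \<kappa> + ennreal (r - t) * E \<kappa>)"
          by (rule y_leI)
      qed (use \<epsilon> r ym[OF t] in auto)
      ultimately have "A r \<le> ennreal (1 + \<epsilon>) * A t + rem r"
        unfolding A_def rem_def distrib_left by (rule order_trans[OF add_mono]) (simp add: add_ac)
      also have "\<dots> \<le> ennreal (1 + \<epsilon>) * A t + ennreal \<epsilon>"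
        using elim by (intro add_left_mono) auto
      finally have "ennreal (e r) \<le> ennreal ((1 + \<epsilon>) * e t + \<epsilon>)"
        using \<epsilon> e_nonneg[of t] by (simp add: ennreal_mult eA[OF t] eA[OF r(1)])
      then show ?case using \<epsilon> e_nonneg[of t] by (subst (asm) ennreal_le_iff) auto
    qed
  next
    fix t \<epsilon> :: real assume t: "t > 0" and \<epsilon>: "\<epsilon> > 0"
    define qU where "qU \<tau> = cm (\<lambda>\<kappa>. (U (t + - \<tau>) \<kappa> - U t \<kappa>) / complex_of_real (- \<tau>) - (- complex_of_real (d t \<kappa>) * U t \<kappa> + V t \<kappa>))" for \<tau>
    define qV where "qV \<tau> = cm (\<lambda>\<kappa>. (V (t + - \<tau>) \<kappa> - V t \<kappa>) / complex_of_real (- \<tau>) - P t \<kappa>)" for \<tau>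
    define rem where "rem \<tau> = (8 * weighted_sq s (qU \<tau>) + 8 * (ennreal (\<tau>\<^sup>2) * weighted_sq s E)) +
      (8 * weighted_sq s (qV \<tau>) + 8 * (ennreal (\<tau>\<^sup>2) * weighted_sq s E))" for \<tau>
    have limq: "((\<lambda>\<tau>. weighted_sq s (qU \<tau>)) \<longlongrightarrow> 0) (at_right 0)" "((\<lambda>\<tau>. weighted_sq s (qV \<tau>)) \<longlongrightarrow> 0) (at_right 0)"
      using filterlim_compose[OF deriv(1)[OF t, unfolded has_sobolev_derivative_def sob] filterlim_uminus_at_right_0]
        filterlim_compose[OF deriv(2)[OF t, unfolded has_sobolev_derivative_def sob] filterlim_uminus_at_right_0]
      unfolding qU_def qV_def by auto
    have "((\<lambda>\<tau>. ennreal (\<tau>\<^sup>2)) \<longlongrightarrow> ennreal (0\<^sup>2)) (at_right 0)"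
      by (intro tendsto_ennrealI tendsto_intros)
    then have "((\<lambda>\<tau>. ennreal (\<tau>\<^sup>2) * weighted_sq s E) \<longlongrightarrow> 0 * weighted_sq s E) (at_right 0)"
      using fin(3) unfolding mult.commute[of _ "weighted_sq s E"] by (intro ennreal_tendsto_cmult) auto
    then have "(rem \<longlongrightarrow> (8 * 0 + 8 * (0 * weighted_sq s E)) + (8 * 0 + 8 * (0 * weighted_sq s E))) (at_right 0)"
      unfolding rem_def [abs_def] using limq
      by (intro tendsto_add ennreal_tendsto_cmult) auto
    then have "(rem \<longlongrightarrow> 0) (at_right 0)" by simp
    then have "\<forall>\<^sub>F \<tau> in at_right 0. rem \<tau> < ennreal \<epsilon>"
      using \<epsilon> by (intro order_tendstoD) auto
    moreover have "\<forall>\<^sub>F \<tau> in at_right 0. 0 < \<tau> \<and> \<tau> < min t 1"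
      using t by (auto simp: eventually_at_right_field intro!: exI[of _ "min t 1"])
    ultimately show "\<forall>\<^sub>F \<tau> in at_right 0. e t \<le> (1 + \<tau>) * e (t - \<tau>) + \<tau> * (C * e t + \<epsilon>)"
    proof eventually_elim
      case (elim \<tau>)
      then have \<tau>: "0 < \<tau>" "\<tau> \<le> 1" "\<tau> \<le> t" "0 \<le> t - \<tau>" by auto
      have t0: "t \<ge> 0" using t by simp
      have [measurable]: "U t \<in> borel_measurable frequencies" "V t \<in> borel_measurable frequencies"
        "U (t - \<tau>) \<in> borel_measurable frequencies" "V (t - \<tau>) \<in> borel_measurable frequencies" "P t \<in> borel_measurable frequencies"
        using meas t \<tau> by auto
      have qm: "qU \<tau> \<in> borel_measurable frequencies" "qV \<tau> \<in> borel_measurable frequencies"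
        unfolding qU_def qV_def by simp_all
      have "weighted_sq s (x t) \<le> ennreal (1 + \<tau>) * weighted_sq s (x (t - \<tau>)) +
          ennreal \<tau> * (4 * weighted_sq s (y t) + (8 * weighted_sq s (qU \<tau>) + 8 * (ennreal (\<tau>\<^sup>2) * weighted_sq s E)))"
      proof (rule weighted_sq_step, goal_cases)
        case 7
        show ?case
        proof (intro AE_I2)
          fix \<kappa>
          define z where "z = x (t - \<tau>) \<kappa> + ennreal \<tau> * (y t \<kappa> + (qU \<tau> \<kappa> + ennreal \<tau> * E \<kappa>))"
          define D where "D = 1 + \<tau> * d t \<kappa>"
          have D: "D \<ge> 1" using \<tau> d[of t \<kappa>] by (simp add: D_def)
          let ?Q = "(U (t + - \<tau>) \<kappa> - U t \<kappa>) / complex_of_real (- \<tau>) - (- complex_of_real (d t \<kappa>) * U t \<kappa> + V t \<kappa>)"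
          have "complex_of_real D * U t \<kappa> = U (t - \<tau>) \<kappa> + complex_of_real \<tau> * V t \<kappa> + complex_of_real \<tau> * ?Q"
            using \<tau> by (simp add: D_def field_simps)
          then have "cmod (complex_of_real D * U t \<kappa>) \<le> cmod (U (t - \<tau>) \<kappa>) + cmod (complex_of_real \<tau> * V t \<kappa>) + cmod (complex_of_real \<tau> * ?Q)"
            by (rule norm_le_of_eq_sum3)
          then have "D * cmod (U t \<kappa>) \<le> cmod (U (t - \<tau>) \<kappa>) + \<tau> * cmod (V t \<kappa>) + \<tau> * cmod ?Q"
            using D \<tau> by (simp add: norm_mult)
          then have "ennreal D * cm (U t) \<kappa> \<le> cm (U (t - \<tau>)) \<kappa> + ennreal \<tau> * cm (V t) \<kappa> + ennreal \<tau> * qU \<tau> \<kappa>"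
            using D \<tau> unfolding cm_def qU_def
            by (simp add: ennreal_mult [symmetric] ennreal_plus [symmetric] ennreal_leI del: ennreal_plus)
          also have "\<dots> \<le> (Ob (t - \<tau>) \<kappa> + x (t - \<tau>) \<kappa>) + ennreal \<tau> * (Bb t \<kappa> + y t \<kappa>) + ennreal \<tau> * qU \<tau> \<kappa>"
            by (intro add_mono mult_left_mono x_ub y_ub) auto
          also have "\<dots> = (Ob (t - \<tau>) \<kappa> + ennreal \<tau> * Bb t \<kappa>) + (x (t - \<tau>) \<kappa> + ennreal \<tau> * y t \<kappa> + ennreal \<tau> * qU \<tau> \<kappa>)"
            by (simp add: distrib_left add_ac)
          also have "\<dots> \<le> (ennreal D * Ob t \<kappa> + ennreal (\<tau>\<^sup>2) * E \<kappa>) + (x (t - \<tau>) \<kappa> + ennreal \<tau> * y t \<kappa> + ennreal \<tau> * qU \<tau> \<kappa>)"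
            unfolding D_def using \<tau> by (intro add_right_mono O_step) auto
          also have "\<dots> = ennreal D * Ob t \<kappa> + z"
            using \<tau> by (simp add: z_def distrib_left ennreal_mult_mult power2_eq_square add_ac)
          also have "\<dots> \<le> ennreal D * Ob t \<kappa> + ennreal D * z"
            using D mult_right_mono[of 1 "ennreal D" z] by (intro add_left_mono) (simp add: ennreal_leI)
          also have "\<dots> = ennreal D * (Ob t \<kappa> + z)" by (simp add: distrib_left)
          finally have "cm (U t) \<kappa> \<le> Ob t \<kappa> + z"
            using D by (subst (asm) ennreal_mult_le_mult_iff) auto
          then show "x t \<kappa> \<le> x (t - \<tau>) \<kappa> + ennreal \<tau> * (y t \<kappa> + (qU \<tau> \<kappa> + ennreal \<tau> * E \<kappa>))"
            unfolding z_def by (rule x_leI)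
        qed
      qed (use \<tau> xm[OF \<tau>(4)] ym[OF t0] meas(7) qm in simp_all)
      moreover have "weighted_sq s (y t) \<le> ennreal (1 + \<tau>) * weighted_sq s (y (t - \<tau>)) +
          ennreal \<tau> * (4 * weighted_sq s (conv \<mu> (x t)) + (8 * weighted_sq s (qV \<tau>) + 8 * (ennreal (\<tau>\<^sup>2) * weighted_sq s E)))"
      proof (rule weighted_sq_step, goal_cases)
        case 7
        show ?case
          using P[OF t]
        proof eventually_elim
          case (elim \<kappa>)
          let ?Q = "(V (t + - \<tau>) \<kappa> - V t \<kappa>) / complex_of_real (- \<tau>) - P t \<kappa>"
          have "V t \<kappa> = V (t - \<tau>) \<kappa> + complex_of_real \<tau> * P t \<kappa> + complex_of_real \<tau> * ?Q"
            using \<tau> by (simp add: field_simps)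
          then have "cmod (V t \<kappa>) \<le> cmod (V (t - \<tau>) \<kappa>) + cmod (complex_of_real \<tau> * P t \<kappa>) + cmod (complex_of_real \<tau> * ?Q)"
            by (rule norm_le_of_eq_sum3)
          then have "cmod (V t \<kappa>) \<le> cmod (V (t - \<tau>) \<kappa>) + \<tau> * cmod (P t \<kappa>) + \<tau> * cmod ?Q"
            using \<tau> by (simp add: norm_mult)
          then have "cm (V t) \<kappa> \<le> cm (V (t - \<tau>)) \<kappa> + ennreal \<tau> * cm (P t) \<kappa> + ennreal \<tau> * qV \<tau> \<kappa>"
            using \<tau> unfolding cm_def qV_def
            by (simp add: ennreal_mult [symmetric] ennreal_plus [symmetric] ennreal_leI del: ennreal_plus)
          also have "\<dots> \<le> (Bb (t - \<tau>) \<kappa> + y (t - \<tau>) \<kappa>) + ennreal \<tau> * (conv \<mu> (x t) \<kappa> + b t \<kappa>) + ennreal \<tau> * qV \<tau> \<kappa>"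
            using elim unfolding x_def by (intro add_mono mult_left_mono y_ub) (auto simp: cm_def)
          also have "\<dots> = (Bb (t - \<tau>) \<kappa> + ennreal \<tau> * b t \<kappa>) + (y (t - \<tau>) \<kappa> + ennreal \<tau> * conv \<mu> (x t) \<kappa> + ennreal \<tau> * qV \<tau> \<kappa>)"
            by (simp add: distrib_left add_ac)
          also have "\<dots> \<le> (Bb t \<kappa> + ennreal (\<tau>\<^sup>2) * E \<kappa>) + (y (t - \<tau>) \<kappa> + ennreal \<tau> * conv \<mu> (x t) \<kappa> + ennreal \<tau> * qV \<tau> \<kappa>)"
            using \<tau> by (intro add_right_mono B_step) auto
          also have "\<dots> = Bb t \<kappa> + (y (t - \<tau>) \<kappa> + ennreal \<tau> * (conv \<mu> (x t) \<kappa> + (qV \<tau> \<kappa> + ennreal \<tau> * E \<kappa>)))"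
            using \<tau> by (simp add: distrib_left ennreal_mult_mult power2_eq_square add_ac)
          finally show "y t \<kappa> \<le> y (t - \<tau>) \<kappa> + ennreal \<tau> * (conv \<mu> (x t) \<kappa> + (qV \<tau> \<kappa> + ennreal \<tau> * E \<kappa>))"
            by (rule y_leI)
        qed
      qed (use \<tau> ym[OF \<tau>(4)] conv_meas[OF xm[OF t0]] meas(7) qm in simp_all)
      moreover have "weighted_sq s (conv \<mu> (x t)) \<le> ennreal c * weighted_sq s (x t)"
        by (intro conv xm t0)
      ultimately have "A t \<le> ennreal (1 + \<tau>) * A (t - \<tau>) + ennreal \<tau> * (4 * (weighted_sq s (y t) + ennreal c * weighted_sq s (x t)) + rem \<tau>)"
        unfolding A_def rem_def by (rule coupled_step_add)
      also have "\<dots> \<le> ennreal (1 + \<tau>) * A (t - \<tau>) + ennreal \<tau> * (ennreal C * A t + ennreal \<epsilon>)"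
      proof (intro add_mono mult_left_mono order_refl)
        have "weighted_sq s (y t) + ennreal c * weighted_sq s (x t) \<le> ennreal (1 + c) * weighted_sq s (y t) + ennreal (1 + c) * weighted_sq s (x t)"
        proof (intro add_mono mult_right_mono ennreal_leI)
          have "ennreal 1 \<le> ennreal (1 + c)" using conv(2) by (intro ennreal_leI) simp
          then show "weighted_sq s (y t) \<le> ennreal (1 + c) * weighted_sq s (y t)"
            using mult_right_mono[of "ennreal 1" "ennreal (1 + c)" "weighted_sq s (y t)"] by simp
        qed auto
        then have "4 * (weighted_sq s (y t) + ennreal c * weighted_sq s (x t)) \<le> 4 * (ennreal (1 + c) * A t)"
          unfolding A_def by (intro mult_left_mono) (auto simp: distrib_left add_ac)
        also have "\<dots> = ennreal C * A t"
        proof -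
          have "ennreal C = ennreal 4 * ennreal (1 + c)"
            unfolding C_def using conv(2) by (intro ennreal_mult) auto
          then show ?thesis by (simp only: ennreal_numeral mult.assoc)
        qed
        finally show "4 * (weighted_sq s (y t) + ennreal c * weighted_sq s (x t)) \<le> ennreal C * A t" .
      qed (use elim in auto)
      finally have "ennreal (e t) \<le> ennreal ((1 + \<tau>) * e (t - \<tau>) + \<tau> * (C * e t + \<epsilon>))"
        using \<tau>(1) \<epsilon> C0 e_nonneg[of t] e_nonneg[of "t - \<tau>"]
        by (simp add: ennreal_mult eA[OF t0] eA[OF \<tau>(4)])
      then show ?case using \<tau>(1) \<epsilon> C0 e_nonneg[of t] e_nonneg[of "t - \<tau>"]
        by (subst (asm) ennreal_le_iff) auto
    qed
  qed (use t e_nonneg in auto)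
  then have "A t = 0" using eA[OF t] by simp
  then have "AE \<kappa> in frequencies. x t \<kappa> = 0" "AE \<kappa> in frequencies. y t \<kappa> = 0"
    using weighted_sq_eq_0_iff[OF xm[OF t]] weighted_sq_eq_0_iff[OF ym[OF t]] by (auto simp: A_def)
  then show ?thesis
  proof eventually_elim
    case (elim \<kappa>)
    then show ?case using x_ub[of t \<kappa>] y_ub[of t \<kappa>] by (simp add: cm_def)
  qed
qed

section \<open>The majorant\<close>

text \<open>
  The time elapsed since the critical time \<open>\<xi> / k\<close>, at which the multiplier of \<open>\<partial>\<^sub>x\<^sup>2 / \<Delta>\<^sub>t\<close> peaks. Division by
  zero gives the value \<open>t\<close> for \<open>k = 0\<close>; there the data of the majorant vanish.
\<close>
definition critical_time :: "real \<Rightarrow> int \<times> real \<Rightarrow> real" where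
  "critical_time t \<kappa> = t - snd \<kappa> / of_int (fst \<kappa>)"

definition resonance :: "real \<Rightarrow> int \<times> real \<Rightarrow> real" where
  "resonance t \<kappa> = (if fst \<kappa> = 0 then 0 else 1 / (1 + (critical_time t \<kappa>)\<^sup>2))"

lemma borel_measurable_critical_time [measurable]: "critical_time t \<in> borel_measurable frequencies"
  unfolding critical_time_def [abs_def] by measurable

lemma borel_measurable_resonance [measurable]: "resonance t \<in> borel_measurable frequencies"
  unfolding resonance_def [abs_def] by measurable

lemma resonance_nonneg: "resonance t \<kappa> \<ge> 0"
  by (simp add: resonance_def add_nonneg_nonneg)

lemma resonance_le_1: "resonance t \<kappa> \<le> 1"
  by (simp add: resonance_def divide_le_eq add_pos_nonneg)

lemma cmod_dxx_inv_laplace: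
  "cmod (dxx_inv_laplace t F \<kappa>) = resonance t \<kappa> * cmod (F \<kappa>)"
proof -
  obtain k \<xi> where \<kappa>: "\<kappa> = (k, \<xi>)" by (cases \<kappa>)
  show ?thesis
  proof (cases "k = 0")
    case False
    have "(of_int k)\<^sup>2 + (\<xi> - of_int k * t)\<^sup>2 = (of_int k)\<^sup>2 * (1 + (t - \<xi> / of_int k)\<^sup>2)"
      using False by (simp add: field_simps power2_eq_square)
    then have "(of_int k)\<^sup>2 / ((of_int k)\<^sup>2 + (\<xi> - of_int k * t)\<^sup>2) = 1 / (1 + (t - \<xi> / of_int k)\<^sup>2)"
      using False by simp
    then show ?thesis
      using False by (simp add: \<kappa> dxx_inv_laplace_def resonance_def critical_time_def norm_mult add_nonneg_nonneg del: of_real_divide of_real_add)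
  qed (simp add: \<kappa> dxx_inv_laplace_def resonance_def)
qed

lemma critical_time_shift:
  "\<bar>critical_time t (k, \<xi> - \<eta>) - critical_time t (k, \<xi>)\<bar> \<le> \<bar>\<eta>\<bar>"
proof (cases "k = 0")
  case False
  then have "\<bar>\<eta>\<bar> * 1 \<le> \<bar>\<eta>\<bar> * \<bar>of_int k\<bar>" by (intro mult_left_mono) auto
  moreover have "critical_time t (k, \<xi> - \<eta>) - critical_time t (k, \<xi>) = \<eta> / of_int k"
    by (simp add: critical_time_def diff_divide_distrib)
  ultimately show ?thesis using False by (simp add: divide_le_eq abs_divide)
qed (simp add: critical_time_def)

lemma critical_time_square_le:
  assumes "k \<noteq> 0"
  shows "(critical_time t (k, \<xi>))\<^sup>2 \<le> (\<xi> - of_int k * t)\<^sup>2"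
proof -
  have "1 \<le> k\<^sup>2" using assms zero_less_power2[of k] by linarith
  then have "1 \<le> (real_of_int k)\<^sup>2" by (metis of_int_1 of_int_le_iff of_int_power)
  then have "(1::real) * (critical_time t (k, \<xi>))\<^sup>2 \<le> (of_int k)\<^sup>2 * (critical_time t (k, \<xi>))\<^sup>2"
    by (intro mult_right_mono) auto
  also have "\<dots> = (\<xi> - of_int k * t)\<^sup>2"
    using assms by (simp add: critical_time_def field_simps power2_eq_square)
  finally show ?thesis by simp
qed

lemma one_le_ennreal: "1 \<le> x \<Longrightarrow> 1 \<le> ennreal x"
  using ennreal_leI[of 1 x] by simp

lemma weighted_sq_conv_le_moment:
  assumes mu: "sigma_finite_measure \<mu>" "sets \<mu> = sets borel"
    and mom: "(\<integral>\<^sup>+\<eta>. ennreal ((1 + \<bar>\<eta>\<bar>) powr q) \<partial>\<mu>) \<le> ennreal m" and p: "\<bar>s\<bar> \<le> q" "0 \<le> m"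
    and g: "g \<in> borel_measurable frequencies"
  shows "weighted_sq s (conv \<mu> g) \<le> ennreal (m\<^sup>2) * weighted_sq s g"
proof -
  have "weighted_sq s (conv \<mu> g) \<le> (\<integral>\<^sup>+\<eta>. ennreal ((1 + \<bar>\<eta>\<bar>) powr q) \<partial>\<mu>)\<^sup>2 * weighted_sq s g"
    using mu g p by (intro weighted_sq_conv_le) auto
  also have "\<dots> \<le> (ennreal m)\<^sup>2 * weighted_sq s g"
    by (intro mult_right_mono power_mono mom) auto
  finally show ?thesis using p by (simp add: ennreal_power)
qed

text \<open>
  Here \<open>d\<close> is the rate of dissipation, \<open>\<kappa>0\<close> the bound on the response \<open>lag n\<close> and \<open>W\<close> the initial vorticity
  without its mean in \<open>x\<close>. The majorants are built in the order \<open>Y\<close>, \<open>Bb\<close>, \<open>Ob\<close>. For \<open>V\<close>,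
  \<open>Bb t\<close> is the initial value plus the time integral of the convolution with \<open>\<kappa>0 a G Y + e^\<pi> e^(- n t) W\<close>,
  which bounds \<open>a * Ob t\<close>. The integral is explicit because \<open>3 a G\<close> is the derivative of \<open>G\<close>. The fixed point
  equation of \<open>Y\<close> is chosen such that \<open>Bb t \<le> G t * Y\<close>. For \<open>U\<close>, \<open>Ob t\<close> is \<open>decay\<close> times
  the initial value plus \<open>lag\<close> times \<open>Bb t\<close>; it is an upper solution because \<open>Bb\<close> does not decrease.
  For \<open>k = 0\<close> the forcing vanishes and the dissipation is \<open>n^3 \<xi>^2\<close>, without a critical time; there the initial value itself
  is the majorant.

  The comparison takes place in order \<open>N - 2\<close>, in which the time derivative of \<open>U\<close> exists. The
  bound of order \<open>N\<close> comes from the majorants.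
\<close>
lemma linear_boussinesq_bound:
  fixes U V P :: "real \<Rightarrow> int \<times> real \<Rightarrow> complex" and n :: real and N :: nat
  assumes n: "n > 0"
    and mu: "finite_measure \<mu>" and sets [measurable_cong]: "sets \<mu> = sets borel"
    and moment: "(\<integral>\<^sup>+\<eta>. ennreal ((1 + \<bar>\<eta>\<bar>) ^ (N + 5)) \<partial>\<mu>) \<le> ennreal n"
    and meas: "\<And>t. t \<ge> 0 \<Longrightarrow> U t \<in> borel_measurable frequencies" "\<And>t. t \<ge> 0 \<Longrightarrow> V t \<in> borel_measurable frequencies"
      "\<And>t. t > 0 \<Longrightarrow> P t \<in> borel_measurable frequencies"
    and cont: "sobolev_continuous (real N) U" "sobolev_continuous (real N) V"
    and deriv: "\<And>t. t > 0 \<Longrightarrow> has_sobolev_derivative (real N - 2) U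
        (\<lambda>\<kappa>. - complex_of_real (n ^ 3 * (snd \<kappa> - of_int (fst \<kappa>) * t)\<^sup>2) * U t \<kappa> + V t \<kappa>) t"
      "\<And>t. t > 0 \<Longrightarrow> has_sobolev_derivative (real N) V (P t) t"
    and P: "\<And>t. t > 0 \<Longrightarrow> AE \<kappa> in frequencies.
      ennreal (cmod (P t \<kappa>)) \<le> conv \<mu> (\<lambda>\<kappa>. ennreal (resonance t \<kappa> * cmod (U t \<kappa>))) \<kappa>"
    and V0: "\<And>\<xi>. V 0 (0, \<xi>) = 0"
    and t: "t \<ge> 0"
  shows "sobolev_sq (real N) (U t) + sobolev_sq (real N) (V t) \<le>
    ennreal ((2 * exp (2 * pi) + 36 * exp (8 * pi) / (1 - 25 / 81 * pi)\<^sup>2) * (1 + 1 / n\<^sup>2)) *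
      (sobolev_sq (real N) (U 0) + sobolev_sq (real N) (V 0))"
proof -
  interpret mu: finite_measure \<mu> by fact
  have sig: "sigma_finite_measure \<mu>" by (rule mu.sigma_finite_measure_axioms)
  have conv_meas [measurable]: "conv \<mu> g \<in> borel_measurable frequencies" if "g \<in> borel_measurable frequencies" for g
    using sig sets that by (rule borel_measurable_conv)
  have moment': "(\<integral>\<^sup>+\<eta>. ennreal ((1 + \<bar>\<eta>\<bar>) powr q) \<partial>\<mu>) \<le> ennreal n" if "q \<le> real N + 5" for q
  proof -
    have "(1 + \<bar>\<eta>\<bar>) powr q \<le> (1 + \<bar>\<eta>\<bar>) ^ (N + 5)" for \<eta> :: real
    proof -
      have "(1 + \<bar>\<eta>\<bar>) powr q \<le> (1 + \<bar>\<eta>\<bar>) powr real (N + 5)" using that by (intro powr_mono) auto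
      also have "\<dots> = (1 + \<bar>\<eta>\<bar>) ^ (N + 5)" by (rule powr_realpow) auto
      finally show ?thesis .
    qed
    then show ?thesis by (intro order_trans[OF nn_integral_mono moment] ennreal_leI)
  qed
  have conv_bound: "weighted_sq s (conv \<mu> g) \<le> ennreal (n\<^sup>2) * weighted_sq s g"
    if "g \<in> borel_measurable frequencies" "\<bar>s\<bar> \<le> real N + 5" for g s
    by (rule weighted_sq_conv_le_moment[OF sig sets moment'[OF order_refl]]) (use that n in auto)
  define \<rho> \<kappa>0 where "\<rho> = 25 / 81 * pi" and "\<kappa>0 = pi / (27 / 25 * n)"
  have \<rho>: "0 < \<rho>" "\<rho> < 1" using pi_approx by (auto simp: \<rho>_def)
  have \<kappa>0: "\<kappa>0 > 0" "\<kappa>0 \<le> 3 / n" "\<kappa>0 / 3 * n = \<rho>"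
    using n pi_approx by (auto simp: \<kappa>0_def \<rho>_def field_simps)
  define e3 where "e3 = exp (3 * pi / 2)"
  have e3: "e3 > 0" "e3 \<ge> 1" by (auto simp: e3_def)
  define u0 v0 where "u0 \<kappa> = ennreal (cmod (U 0 \<kappa>))" and "v0 \<kappa> = ennreal (cmod (V 0 \<kappa>))" for \<kappa>
  have [measurable]: "u0 \<in> borel_measurable frequencies" "v0 \<in> borel_measurable frequencies"
    unfolding u0_def v0_def using meas[of 0] by auto
  define W where "W \<kappa> = (if fst \<kappa> = 0 then 0 else u0 \<kappa>)" for \<kappa>
  have [measurable]: "W \<in> borel_measurable frequencies" unfolding W_def by measurable
  have v00: "v0 (0, \<xi>) = 0" and W0: "W (0, \<xi>) = 0" for \<xi> by (simp_all add: v0_def V0 W_def)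
  define el where "el = exp pi / n"
  have el: "el > 0" using n by (simp add: el_def)
  define Y0 where "Y0 \<kappa> = ennreal e3 * (v0 \<kappa> + ennreal el * conv \<mu> W \<kappa>)" for \<kappa>
  have Y0m [measurable]: "Y0 \<in> borel_measurable frequencies" unfolding Y0_def by measurable
  \<comment> \<open>one passage through the critical time: the gain \<open>\<kappa>0 / 3\<close> and the cost \<open>(1 + |\<eta>|)^5\<close> of the weight\<close>
  define \<mu>' where "\<mu>' = density \<mu> (\<lambda>\<eta>. ennreal (\<kappa>0 / 3 * (1 + \<bar>\<eta>\<bar>) ^ 5))"
  have sets' [measurable_cong]: "sets \<mu>' = sets borel" by (simp add: \<mu>'_def sets)
  have moment_\<mu>': "(\<integral>\<^sup>+\<eta>. ennreal ((1 + \<bar>\<eta>\<bar>) powr real N) \<partial>\<mu>') \<le> ennreal \<rho>"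
  proof -
    have "(\<integral>\<^sup>+\<eta>. ennreal ((1 + \<bar>\<eta>\<bar>) powr real N) \<partial>\<mu>') =
        (\<integral>\<^sup>+\<eta>. ennreal (\<kappa>0 / 3 * (1 + \<bar>\<eta>\<bar>) ^ 5) * ennreal ((1 + \<bar>\<eta>\<bar>) powr real N) \<partial>\<mu>)"
      unfolding \<mu>'_def by (rule nn_integral_density) measurable
    also have "\<dots> = (\<integral>\<^sup>+\<eta>. ennreal (\<kappa>0 / 3) * ennreal ((1 + \<bar>\<eta>\<bar>) ^ (N + 5)) \<partial>\<mu>)"
      using \<kappa>0 by (intro nn_integral_cong)
        (simp add: ennreal_mult [symmetric] powr_realpow power_add mult_ac add_pos_nonneg)
    also have "\<dots> = ennreal (\<kappa>0 / 3) * (\<integral>\<^sup>+\<eta>. ennreal ((1 + \<bar>\<eta>\<bar>) ^ (N + 5)) \<partial>\<mu>)"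
      by (rule nn_integral_cmult) measurable
    also have "\<dots> \<le> ennreal (\<kappa>0 / 3) * ennreal n"
      by (intro mult_left_mono moment) auto
    also have "\<dots> = ennreal \<rho>" using \<kappa>0 n by (simp add: ennreal_mult [symmetric])
    finally show ?thesis .
  qed
  have sig': "sigma_finite_measure \<mu>'"
  proof -
    have "emeasure \<mu>' (space \<mu>') = (\<integral>\<^sup>+\<eta>. 1 \<partial>\<mu>')" by simp
    also have "\<dots> \<le> (\<integral>\<^sup>+\<eta>. ennreal ((1 + \<bar>\<eta>\<bar>) powr real N) \<partial>\<mu>')"
      by (intro nn_integral_mono) (auto intro!: one_le_ennreal ge_one_powr_ge_zero)
    also have "\<dots> \<le> ennreal \<rho>" by (rule moment_\<mu>')
    finally have "emeasure \<mu>' (space \<mu>') \<noteq> \<infinity>" by (auto simp: top_unique)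
    then show ?thesis by (intro finite_measure.axioms(1) finite_measureI)
  qed
  have contr: "weighted_sq (real N) (conv \<mu>' g) \<le> ennreal (\<rho>\<^sup>2) * weighted_sq (real N) g"
    if "g \<in> borel_measurable frequencies" for g
    by (rule weighted_sq_conv_le_moment[OF sig' sets' moment_\<mu>']) (use that \<rho> in auto)
  have Y00: "Y0 (0, \<xi>) = 0" for \<xi> by (simp add: Y0_def v00 conv_def W0)
  obtain Y where Ym [measurable]: "Y \<in> borel_measurable frequencies"
    and Y: "\<And>\<kappa>. Y \<kappa> = Y0 \<kappa> + conv \<mu>' Y \<kappa>" "\<And>\<xi>. Y (0, \<xi>) = 0"
      "weighted_sq (real N) Y \<le> ennreal (1 / (1 - \<rho>)\<^sup>2) * weighted_sq (real N) Y0"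
    using neumann_series[OF sig' sets' Y0m \<rho> contr Y00] by blast
  define G where "G t \<kappa> = exp (3 * arctan (critical_time t \<kappa>))" for t \<kappa>
  have [measurable]: "G t \<in> borel_measurable frequencies" for t unfolding G_def by measurable
  have G: "G t \<kappa> > 0" "G t \<kappa> \<le> e3" "1 \<le> G t \<kappa> * e3" for t \<kappa>
  proof -
    show "G t \<kappa> > 0" "G t \<kappa> \<le> e3" using exp_arctan_le by (auto simp: G_def e3_def)
    have "exp (- (3 * pi / 2)) * e3 \<le> G t \<kappa> * e3"
      unfolding G_def using e3 by (intro mult_right_mono exp_arctan_ge) auto
    then show "1 \<le> G t \<kappa> * e3" by (simp add: e3_def exp_minus)
  qed
  have G_mono: "G t \<kappa> \<le> G t' \<kappa>" if "t \<le> t'" for t t' \<kappa>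
    using that by (simp add: G_def critical_time_def arctan_le_iff)
  \<comment> \<open>for \<open>k \<noteq> 0\<close>, the time integrals of \<open>\<kappa>0 a G\<close> and of \<open>e^\<pi> e^(- n t)\<close> from 0 to \<open>t\<close>\<close>
  define \<beta> where "\<beta> t \<kappa> = \<kappa>0 / 3 * (G t \<kappa> - G 0 \<kappa>)" for t \<kappa>
  have [measurable]: "\<beta> t \<in> borel_measurable frequencies" for t unfolding \<beta>_def by measurable
  have \<beta>_nonneg: "\<beta> t \<kappa> \<ge> 0" if "t \<ge> 0" for t \<kappa>
    using that \<kappa>0 G_mono[of 0 t \<kappa>] by (simp add: \<beta>_def)
  define l where "l t = exp pi * ((1 - exp (- (n * t))) / n)" for t
  have l: "l t \<ge> 0" "l t \<le> el" if "t \<ge> 0" for t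
    using that n by (auto simp: l_def el_def intro!: divide_right_mono)
  define Bb where "Bb t \<kappa> = v0 \<kappa> + conv \<mu> (\<lambda>\<kappa>. ennreal (\<beta> t \<kappa>) * Y \<kappa> + ennreal (l t) * W \<kappa>) \<kappa>" for t \<kappa>
  define Ob where "Ob t \<kappa> = (if fst \<kappa> = 0 then u0 \<kappa> else
      ennreal (decay n t (critical_time t \<kappa>)) * u0 \<kappa> + ennreal (lag n (critical_time t \<kappa>)) * Bb t \<kappa>)" for t \<kappa>
  define b where "b t = conv \<mu> (\<lambda>\<kappa>. ennreal (resonance t \<kappa>) * Ob t \<kappa>)" for t
  have Bm [measurable]: "Bb t \<in> borel_measurable frequencies" for t unfolding Bb_def by measurable
  have Om [measurable]: "Ob t \<in> borel_measurable frequencies" for t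
    unfolding Ob_def decay_def lag_def by measurable
  have B0: "Bb t (0, \<xi>) = 0" for t \<xi> by (simp add: Bb_def v00 conv_def Y(2) W0)
  have B_le: "Bb t \<kappa> \<le> ennreal (G t \<kappa>) * Y \<kappa>" if "t \<ge> 0" for t \<kappa>
  proof -
    obtain k \<xi> where \<kappa>: "\<kappa> = (k, \<xi>)" by (cases \<kappa>)
    have "conv \<mu> (\<lambda>\<kappa>. ennreal (\<beta> t \<kappa>) * Y \<kappa>) \<kappa> = (\<integral>\<^sup>+\<eta>. ennreal (\<beta> t (k, \<xi> - \<eta>)) * Y (k, \<xi> - \<eta>) \<partial>\<mu>)"
      by (simp add: conv_def \<kappa>)
    also have "\<dots> \<le> (\<integral>\<^sup>+\<eta>. ennreal (G t \<kappa>) * (ennreal (\<kappa>0 / 3 * (1 + \<bar>\<eta>\<bar>) ^ 5) * Y (k, \<xi> - \<eta>)) \<partial>\<mu>)"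
    proof (intro nn_integral_mono)
      fix \<eta>
      have "\<beta> t (k, \<xi> - \<eta>) \<le> \<kappa>0 / 3 * G t (k, \<xi> - \<eta>)"
        using \<kappa>0 G(1)[of 0] by (auto simp: \<beta>_def less_imp_le)
      also have "\<dots> \<le> \<kappa>0 / 3 * ((1 + \<bar>\<eta>\<bar>) ^ 5 * G t \<kappa>)"
        unfolding G_def \<kappa> using \<kappa>0 by (intro mult_left_mono exp_arctan_shift critical_time_shift) auto
      finally have "ennreal (\<beta> t (k, \<xi> - \<eta>)) \<le> ennreal (G t \<kappa> * (\<kappa>0 / 3 * (1 + \<bar>\<eta>\<bar>) ^ 5))"
        by (intro ennreal_leI) (simp add: mult_ac)
      then show "ennreal (\<beta> t (k, \<xi> - \<eta>)) * Y (k, \<xi> - \<eta>) \<le> ennreal (G t \<kappa>) * (ennreal (\<kappa>0 / 3 * (1 + \<bar>\<eta>\<bar>) ^ 5) * Y (k, \<xi> - \<eta>))"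
        using G(1)[of t \<kappa>] \<kappa>0 by (subst ennreal_mult_mult) (auto intro: mult_right_mono)
    qed
    also have "\<dots> = ennreal (G t \<kappa>) * (\<integral>\<^sup>+\<eta>. ennreal (\<kappa>0 / 3 * (1 + \<bar>\<eta>\<bar>) ^ 5) * Y (k, \<xi> - \<eta>) \<partial>\<mu>)"
      by (rule nn_integral_cmult) measurable
    also have "(\<integral>\<^sup>+\<eta>. ennreal (\<kappa>0 / 3 * (1 + \<bar>\<eta>\<bar>) ^ 5) * Y (k, \<xi> - \<eta>) \<partial>\<mu>) = conv \<mu>' Y \<kappa>"
      unfolding conv_def \<kappa> \<mu>'_def prod.case by (rule nn_integral_density [symmetric]) measurable
    finally have 1: "conv \<mu> (\<lambda>\<kappa>. ennreal (\<beta> t \<kappa>) * Y \<kappa>) \<kappa> \<le> ennreal (G t \<kappa>) * conv \<mu>' Y \<kappa>" .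
    have "v0 \<kappa> + conv \<mu> (\<lambda>\<kappa>. ennreal (l t) * W \<kappa>) \<kappa> = 1 * (v0 \<kappa> + ennreal (l t) * conv \<mu> W \<kappa>)"
      by (simp add: conv_cmult sets)
    also have "\<dots> \<le> ennreal (G t \<kappa> * e3) * (v0 \<kappa> + ennreal el * conv \<mu> W \<kappa>)"
      by (rule mult_mono[OF one_le_ennreal[OF G(3)] add_left_mono[OF mult_right_mono[OF ennreal_leI[OF l(2)[OF that]]]]]) auto
    also have "\<dots> = ennreal (G t \<kappa>) * Y0 \<kappa>"
      using G(1)[of t \<kappa>] e3 unfolding Y0_def by (subst ennreal_mult_mult) auto
    finally have 2: "v0 \<kappa> + conv \<mu> (\<lambda>\<kappa>. ennreal (l t) * W \<kappa>) \<kappa> \<le> ennreal (G t \<kappa>) * Y0 \<kappa>" .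
    have "Bb t \<kappa> = (v0 \<kappa> + conv \<mu> (\<lambda>\<kappa>. ennreal (l t) * W \<kappa>) \<kappa>) + conv \<mu> (\<lambda>\<kappa>. ennreal (\<beta> t \<kappa>) * Y \<kappa>) \<kappa>"
      unfolding Bb_def by (subst conv_add) (auto simp: sets add_ac simp del: distrib_left)
    also have "\<dots> \<le> ennreal (G t \<kappa>) * Y0 \<kappa> + ennreal (G t \<kappa>) * conv \<mu>' Y \<kappa>"
      by (intro add_mono 1 2)
    also have "\<dots> = ennreal (G t \<kappa>) * Y \<kappa>"
      by (simp only: Y(1)[of \<kappa>] distrib_left)
    finally show ?thesis .
  qed
  have B_le3: "Bb t \<kappa> \<le> ennreal e3 * Y \<kappa>" if "t \<ge> 0" for t \<kappa>
    using G(2)[of t \<kappa>] by (intro order_trans[OF B_le[OF that]] mult_right_mono ennreal_leI) auto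
  have B_mono: "Bb t \<kappa> \<le> Bb t' \<kappa>" if "0 \<le> t" "t \<le> t'" for t t' \<kappa>
  proof -
    have "\<beta> t \<kappa> \<le> \<beta> t' \<kappa>" for \<kappa>
      unfolding \<beta>_def using \<kappa>0 G_mono[OF that(2)] by (intro mult_left_mono diff_right_mono) auto
    moreover have "l t \<le> l t'"
      unfolding l_def using n that by (intro mult_left_mono divide_right_mono) auto
    ultimately show ?thesis
      unfolding Bb_def by (intro add_left_mono conv_mono add_mono mult_right_mono ennreal_leI) auto
  qed
  \<comment> \<open>the Taylor remainders of \<open>G\<close>, \<open>decay\<close> and \<open>lag\<close>, and the rate at which \<open>decay\<close> may decrease\<close>
  define c where "c = 4 * \<kappa>0 * e3 + 2 * n\<^sup>2 * exp pi + 2 * n * e3 + n * exp pi"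
  define E where "E \<kappa> = ennreal c * (conv \<mu> Y \<kappa> + (u0 \<kappa> + Y \<kappa>))" for \<kappa>
  have [measurable]: "E \<in> borel_measurable frequencies" unfolding E_def by measurable
  have c: "c \<ge> 0" "4 * \<kappa>0 * e3 \<le> c" "2 * n\<^sup>2 * exp pi \<le> c" "2 * n * e3 \<le> c" "n * exp pi \<le> c"
    using n \<kappa>0 e3 by (auto simp: c_def)
  have B_step: "Bb (t - \<tau>) \<kappa> + ennreal \<tau> * b t \<kappa> \<le> Bb t \<kappa> + ennreal (\<tau>\<^sup>2) * E \<kappa>" if \<tau>: "0 \<le> \<tau>" "\<tau> \<le> t" for t \<tau> \<kappa>
  proof -
    have pt: "(ennreal (\<beta> (t - \<tau>) \<kappa>) * Y \<kappa> + ennreal (l (t - \<tau>)) * W \<kappa>) + ennreal \<tau> * (ennreal (resonance t \<kappa>) * Ob t \<kappa>) \<le>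
        (ennreal (\<beta> t \<kappa>) * Y \<kappa> + ennreal (l t) * W \<kappa>) + ennreal (\<tau>\<^sup>2 * (4 * \<kappa>0 * e3)) * Y \<kappa>" for \<kappa>
    proof (cases "fst \<kappa> = 0")
      case False
      define s where "s = critical_time t \<kappa>"
      have s': "critical_time (t - \<tau>) \<kappa> = s - \<tau>" by (simp add: s_def critical_time_def)
      have res: "resonance t \<kappa> = 1 / (1 + s\<^sup>2)" using False by (simp add: resonance_def s_def)
      have "ennreal (resonance t \<kappa>) * Ob t \<kappa> =
          ennreal (resonance t \<kappa>) * (ennreal (decay n t s) * W \<kappa>) + ennreal (resonance t \<kappa>) * (ennreal (lag n s) * Bb t \<kappa>)"
        using False by (simp add: Ob_def W_def s_def distrib_left)
      also have "\<dots> \<le> ennreal 1 * (ennreal (exp pi * exp (- (n * t))) * W \<kappa>) + ennreal (resonance t \<kappa>) * (ennreal \<kappa>0 * (ennreal (G t \<kappa>) * Y \<kappa>))"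
      proof (rule add_mono[OF mult_mono[OF ennreal_leI[OF resonance_le_1] mult_right_mono[OF ennreal_leI[OF decay_le]]]
            mult_left_mono[OF mult_mono[OF ennreal_leI B_le]]])
        show "lag n s \<le> \<kappa>0" using lag_le[OF n] by (simp add: \<kappa>0_def)
      qed (use \<tau> in auto)
      also have "\<dots> = ennreal (exp pi * exp (- (n * t))) * W \<kappa> + ennreal (resonance t \<kappa> * (\<kappa>0 * G t \<kappa>)) * Y \<kappa>"
        using \<kappa>0 G(1)[of t \<kappa>] by (simp add: ennreal_mult_mult resonance_nonneg)
      finally have "ennreal \<tau> * (ennreal (resonance t \<kappa>) * Ob t \<kappa>) \<le>
          ennreal \<tau> * (ennreal (exp pi * exp (- (n * t))) * W \<kappa> + ennreal (resonance t \<kappa> * (\<kappa>0 * G t \<kappa>)) * Y \<kappa>)"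
        by (intro mult_left_mono) auto
      also have "\<dots> = ennreal (\<tau> * (exp pi * exp (- (n * t)))) * W \<kappa> + ennreal (\<tau> * (resonance t \<kappa> * (\<kappa>0 * G t \<kappa>))) * Y \<kappa>"
        using \<kappa>0 G(1)[of t \<kappa>] \<tau> by (simp add: distrib_left ennreal_mult_mult resonance_nonneg)
      finally have "(ennreal (\<beta> (t - \<tau>) \<kappa>) * Y \<kappa> + ennreal (l (t - \<tau>)) * W \<kappa>) + ennreal \<tau> * (ennreal (resonance t \<kappa>) * Ob t \<kappa>) \<le>
          (ennreal (\<beta> (t - \<tau>) \<kappa>) * Y \<kappa> + ennreal (l (t - \<tau>)) * W \<kappa>) +
          (ennreal (\<tau> * (exp pi * exp (- (n * t)))) * W \<kappa> + ennreal (\<tau> * (resonance t \<kappa> * (\<kappa>0 * G t \<kappa>))) * Y \<kappa>)"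
        by (rule add_left_mono)
      also have "\<dots> = ennreal (\<beta> (t - \<tau>) \<kappa> + \<tau> * (resonance t \<kappa> * (\<kappa>0 * G t \<kappa>))) * Y \<kappa> +
          ennreal (l (t - \<tau>) + \<tau> * (exp pi * exp (- (n * t)))) * W \<kappa>"
        using \<kappa>0 G(1)[of t \<kappa>] \<tau> \<beta>_nonneg[of "t - \<tau>"] l[of "t - \<tau>"]
        by (simp add: distrib_right resonance_nonneg add_ac)
      also have "\<dots> \<le> ennreal (\<beta> t \<kappa> + \<tau>\<^sup>2 * (4 * \<kappa>0 * e3)) * Y \<kappa> + ennreal (l t) * W \<kappa>"
      proof (rule add_mono[OF mult_right_mono[OF ennreal_leI] mult_right_mono[OF ennreal_leI]])
        have "\<kappa>0 / 3 * (exp (3 * arctan (s - \<tau>)) + \<tau> * (3 / (1 + s\<^sup>2) * exp (3 * arctan s))) \<le>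
            \<kappa>0 / 3 * (exp (3 * arctan s) + 12 * exp (3 * pi / 2) * \<tau>\<^sup>2)"
          using \<kappa>0 exp_arctan_step[OF \<tau>(1), of s] by (intro mult_left_mono) auto
        then show "\<beta> (t - \<tau>) \<kappa> + \<tau> * (resonance t \<kappa> * (\<kappa>0 * G t \<kappa>)) \<le> \<beta> t \<kappa> + \<tau>\<^sup>2 * (4 * \<kappa>0 * e3)"
          by (simp add: \<beta>_def G_def s' s_def [symmetric] res e3_def algebra_simps)
        have "exp pi * ((1 - exp (- (n * (t - \<tau>)))) / n + \<tau> * exp (- (n * t))) \<le> exp pi * ((1 - exp (- (n * t))) / n)"
          by (intro mult_left_mono one_minus_exp_step n) auto
        then show "l (t - \<tau>) + \<tau> * (exp pi * exp (- (n * t))) \<le> l t"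
          by (simp add: l_def distrib_left mult.left_commute)
      qed auto
      also have "\<dots> = (ennreal (\<beta> t \<kappa>) * Y \<kappa> + ennreal (l t) * W \<kappa>) + ennreal (\<tau>\<^sup>2 * (4 * \<kappa>0 * e3)) * Y \<kappa>"
        using \<tau> \<beta>_nonneg[of t \<kappa>] \<kappa>0 e3 by (simp add: distrib_right add_ac)
      finally show ?thesis .
    next
      case True
      then have "\<kappa> = (0, snd \<kappa>)" by (cases \<kappa>) auto
      then have "Y \<kappa> = 0" "W \<kappa> = 0" "resonance t \<kappa> = 0" using Y(2) W0 True by (metis, metis, simp add: resonance_def)
      then show ?thesis by simp
    qed
    have "Bb (t - \<tau>) \<kappa> + ennreal \<tau> * b t \<kappa> =
        v0 \<kappa> + (conv \<mu> (\<lambda>\<kappa>. ennreal (\<beta> (t - \<tau>) \<kappa>) * Y \<kappa> + ennreal (l (t - \<tau>)) * W \<kappa>) \<kappa> +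
          conv \<mu> (\<lambda>\<kappa>. ennreal \<tau> * (ennreal (resonance t \<kappa>) * Ob t \<kappa>)) \<kappa>)"
      unfolding Bb_def b_def add.assoc by (subst conv_cmult) (auto simp: sets)
    also have "\<dots> = v0 \<kappa> + conv \<mu> (\<lambda>\<kappa>. (ennreal (\<beta> (t - \<tau>) \<kappa>) * Y \<kappa> + ennreal (l (t - \<tau>)) * W \<kappa>) +
        ennreal \<tau> * (ennreal (resonance t \<kappa>) * Ob t \<kappa>)) \<kappa>"
      by (subst conv_add [symmetric]) (auto simp: sets)
    also have "\<dots> \<le> v0 \<kappa> + conv \<mu> (\<lambda>\<kappa>. (ennreal (\<beta> t \<kappa>) * Y \<kappa> + ennreal (l t) * W \<kappa>) + ennreal (\<tau>\<^sup>2 * (4 * \<kappa>0 * e3)) * Y \<kappa>) \<kappa>"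
      by (intro add_left_mono conv_mono pt)
    also have "\<dots> = v0 \<kappa> + (conv \<mu> (\<lambda>\<kappa>. ennreal (\<beta> t \<kappa>) * Y \<kappa> + ennreal (l t) * W \<kappa>) \<kappa> +
        conv \<mu> (\<lambda>\<kappa>. ennreal (\<tau>\<^sup>2 * (4 * \<kappa>0 * e3)) * Y \<kappa>) \<kappa>)"
      by (subst conv_add [symmetric]) (auto simp: sets)
    also have "\<dots> = Bb t \<kappa> + ennreal (\<tau>\<^sup>2 * (4 * \<kappa>0 * e3)) * conv \<mu> Y \<kappa>"
      unfolding Bb_def add.assoc by (subst conv_cmult) (auto simp: sets)
    also have "\<dots> \<le> Bb t \<kappa> + ennreal (\<tau>\<^sup>2) * E \<kappa>"
    proof (intro add_left_mono)
      have "ennreal (\<tau>\<^sup>2 * (4 * \<kappa>0 * e3)) * conv \<mu> Y \<kappa> \<le> ennreal (\<tau>\<^sup>2 * c) * (conv \<mu> Y \<kappa> + (u0 \<kappa> + Y \<kappa>))"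
        by (rule mult_mono[OF ennreal_leI[OF mult_left_mono[OF c(2)]]]) auto
      then show "ennreal (\<tau>\<^sup>2 * (4 * \<kappa>0 * e3)) * conv \<mu> Y \<kappa> \<le> ennreal (\<tau>\<^sup>2) * E \<kappa>"
        using c by (simp add: E_def ennreal_mult_mult)
    qed
    finally show ?thesis .
  qed
  define d where "d t \<kappa> = n ^ 3 * (snd \<kappa> - of_int (fst \<kappa>) * t)\<^sup>2" for t \<kappa>
  have [measurable]: "d t \<in> borel_measurable frequencies" for t unfolding d_def [abs_def] by measurable
  have d_nonneg: "d t \<kappa> \<ge> 0" for t \<kappa> using n by (simp add: d_def)
  have O_step: "Ob (t - \<tau>) \<kappa> + ennreal \<tau> * Bb t \<kappa> \<le> ennreal (1 + \<tau> * d t \<kappa>) * Ob t \<kappa> + ennreal (\<tau>\<^sup>2) * E \<kappa>"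
    if \<tau>: "0 \<le> \<tau>" "\<tau> \<le> t" for t \<tau> \<kappa>
  proof (cases "fst \<kappa> = 0")
    case True
    then obtain \<xi> where \<kappa>: "\<kappa> = (0, \<xi>)" by (cases \<kappa>) auto
    have "1 * u0 \<kappa> \<le> ennreal (1 + \<tau> * d t \<kappa>) * u0 \<kappa>"
      using \<tau> d_nonneg[of t \<kappa>] by (intro mult_right_mono one_le_ennreal) auto
    also have "\<dots> \<le> ennreal (1 + \<tau> * d t \<kappa>) * u0 \<kappa> + ennreal (\<tau>\<^sup>2) * E \<kappa>" by simp
    finally show ?thesis by (simp add: Ob_def \<kappa> B0)
  next
    case False
    define s D where "s = critical_time t \<kappa>" and "D = 1 + \<tau> * d t \<kappa>"
    have s': "critical_time (t - \<tau>) \<kappa> = s - \<tau>" by (simp add: s_def critical_time_def)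
    have "s\<^sup>2 \<le> (snd \<kappa> - of_int (fst \<kappa>) * t)\<^sup>2"
      using critical_time_square_le[OF False, of t "snd \<kappa>"] by (simp add: s_def)
    then have "n ^ 3 * s\<^sup>2 \<le> d t \<kappa>" unfolding d_def using n by (intro mult_left_mono) auto
    then have D: "1 + \<tau> * (n ^ 3 * s\<^sup>2) \<le> D" "D \<ge> 1"
      unfolding D_def using \<tau> d_nonneg[of t \<kappa>] by (auto intro!: mult_left_mono)
    have nn: "decay n t s \<ge> 0" "decay n (t - \<tau>) (s - \<tau>) \<ge> 0" "lag n s \<ge> 0" "lag n (s - \<tau>) \<ge> 0"
      using lag_nonneg[OF n] by (auto simp: decay_def)
    have 1: "decay n (t - \<tau>) (s - \<tau>) \<le> D * decay n t s + \<tau>\<^sup>2 * (2 * n\<^sup>2 * exp pi)"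
      using decay_step[OF n \<tau>, of s] mult_right_mono[OF D(1) nn(1)] by (simp add: mult_ac)
    have 2: "lag n (s - \<tau>) + \<tau> \<le> D * lag n s + \<tau>\<^sup>2 * (2 * n)"
      using lag_step[OF n \<tau>(1), of s] mult_right_mono[OF D(1) nn(3)] by (simp add: mult_ac)
    have "Ob (t - \<tau>) \<kappa> + ennreal \<tau> * Bb t \<kappa> =
        ennreal (decay n (t - \<tau>) (s - \<tau>)) * u0 \<kappa> + (ennreal (lag n (s - \<tau>)) * Bb (t - \<tau>) \<kappa> + ennreal \<tau> * Bb t \<kappa>)"
      using False by (simp add: Ob_def s' add_ac)
    also have "\<dots> \<le> ennreal (decay n (t - \<tau>) (s - \<tau>)) * u0 \<kappa> + (ennreal (lag n (s - \<tau>)) * Bb t \<kappa> + ennreal \<tau> * Bb t \<kappa>)"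
      using \<tau> by (intro add_mono mult_left_mono B_mono) auto
    also have "\<dots> = ennreal (decay n (t - \<tau>) (s - \<tau>)) * u0 \<kappa> + ennreal (lag n (s - \<tau>) + \<tau>) * Bb t \<kappa>"
      using nn \<tau> by (simp add: distrib_right)
    also have "\<dots> \<le> ennreal (D * decay n t s + \<tau>\<^sup>2 * (2 * n\<^sup>2 * exp pi)) * u0 \<kappa> + ennreal (D * lag n s + \<tau>\<^sup>2 * (2 * n)) * Bb t \<kappa>"
      by (rule add_mono[OF mult_right_mono[OF ennreal_leI[OF 1]] mult_right_mono[OF ennreal_leI[OF 2]]]) auto
    also have "\<dots> = ennreal D * Ob t \<kappa> + (ennreal (\<tau>\<^sup>2 * (2 * n\<^sup>2 * exp pi)) * u0 \<kappa> + ennreal (\<tau>\<^sup>2 * (2 * n)) * Bb t \<kappa>)"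
      using False nn D(2) n by (simp add: Ob_def s_def [symmetric] distrib_right distrib_left ennreal_mult_mult add_ac)
    also have "\<dots> \<le> ennreal D * Ob t \<kappa> + ennreal (\<tau>\<^sup>2) * E \<kappa>"
    proof (intro add_left_mono)
      have "ennreal (\<tau>\<^sup>2 * (2 * n)) * Bb t \<kappa> \<le> ennreal (\<tau>\<^sup>2 * (2 * n)) * (ennreal e3 * Y \<kappa>)"
        using \<tau> by (intro mult_left_mono B_le3) auto
      also have "\<dots> = ennreal (\<tau>\<^sup>2 * (2 * n * e3)) * Y \<kappa>"
        using n e3 by (subst ennreal_mult_mult) (auto simp: mult_ac)
      also have "\<dots> \<le> ennreal (\<tau>\<^sup>2 * c) * Y \<kappa>"
        using c by (intro mult_right_mono ennreal_leI mult_left_mono) auto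
      finally have "ennreal (\<tau>\<^sup>2 * (2 * n)) * Bb t \<kappa> \<le> ennreal (\<tau>\<^sup>2 * c) * Y \<kappa>" .
      moreover have "ennreal (\<tau>\<^sup>2 * (2 * n\<^sup>2 * exp pi)) * u0 \<kappa> \<le> ennreal (\<tau>\<^sup>2 * c) * u0 \<kappa>"
        using c by (intro mult_right_mono ennreal_leI mult_left_mono) auto
      ultimately have "ennreal (\<tau>\<^sup>2 * (2 * n\<^sup>2 * exp pi)) * u0 \<kappa> + ennreal (\<tau>\<^sup>2 * (2 * n)) * Bb t \<kappa> \<le>
          ennreal (\<tau>\<^sup>2 * c) * (u0 \<kappa> + Y \<kappa>)" by (simp add: distrib_left add_mono)
      also have "\<dots> \<le> ennreal (\<tau>\<^sup>2 * c) * (conv \<mu> Y \<kappa> + (u0 \<kappa> + Y \<kappa>))" by (intro mult_left_mono) auto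
      also have "\<dots> = ennreal (\<tau>\<^sup>2) * E \<kappa>" using c by (simp add: E_def ennreal_mult_mult)
      finally show "ennreal (\<tau>\<^sup>2 * (2 * n\<^sup>2 * exp pi)) * u0 \<kappa> + ennreal (\<tau>\<^sup>2 * (2 * n)) * Bb t \<kappa> \<le> ennreal (\<tau>\<^sup>2) * E \<kappa>" .
    qed
    finally show ?thesis unfolding D_def .
  qed
  have O_decrease: "Ob t \<kappa> \<le> Ob t' \<kappa> + ennreal (t' - t) * E \<kappa>" if "0 \<le> t" "t \<le> t'" for t t' \<kappa>
  proof (cases "fst \<kappa> = 0")
    case False
    define s where "s = critical_time t \<kappa>"
    have s': "critical_time t' \<kappa> = s + (t' - t)" by (simp add: s_def critical_time_def)
    have "ennreal (decay n t s) * u0 \<kappa> \<le> ennreal (decay n t' (s + (t' - t)) + n * exp pi * (t' - t)) * u0 \<kappa>"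
      using decay_decrease_le[OF n that(1), of "t' - t" s] that by (intro mult_right_mono ennreal_leI) auto
    also have "\<dots> = ennreal (decay n t' (s + (t' - t))) * u0 \<kappa> + ennreal (n * exp pi * (t' - t)) * u0 \<kappa>"
      using n that by (simp add: distrib_right decay_def)
    also have "ennreal (n * exp pi * (t' - t)) * u0 \<kappa> \<le> ennreal ((t' - t) * c) * (conv \<mu> Y \<kappa> + (u0 \<kappa> + Y \<kappa>))"
    proof (rule mult_mono[OF ennreal_leI])
      show "n * exp pi * (t' - t) \<le> (t' - t) * c"
        using mult_left_mono[OF c(5), of "t' - t"] that by (simp add: mult_ac)
      show "u0 \<kappa> \<le> conv \<mu> Y \<kappa> + (u0 \<kappa> + Y \<kappa>)"
        by (simp add: add_increasing)
    qed auto
    also have "\<dots> = ennreal (t' - t) * E \<kappa>" using c that by (simp add: E_def ennreal_mult_mult)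
    finally have 1: "ennreal (decay n t s) * u0 \<kappa> \<le> ennreal (decay n t' (s + (t' - t))) * u0 \<kappa> + ennreal (t' - t) * E \<kappa>"
      by (simp add: add_left_mono)
    have 2: "ennreal (lag n s) * Bb t \<kappa> \<le> ennreal (lag n (s + (t' - t))) * Bb t' \<kappa>"
      using that n by (intro mult_mono ennreal_leI lag_mono B_mono) auto
    show ?thesis using add_mono[OF 1 2] False by (simp add: Ob_def s' s_def [symmetric] add_ac)
  qed (simp add: Ob_def)
  have sob: "sobolev_sq s F = weighted_sq s (\<lambda>\<kappa>. ennreal (cmod (F \<kappa>)))" for s F
    by (rule sobolev_sq_eq_weighted_sq)
  have sob_mono: "sobolev_sq (real N - 2) F \<le> sobolev_sq (real N) F" for F
    unfolding sob by (rule weighted_sq_order_mono) simp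
  have sob_tendsto: "((\<lambda>r. sobolev_sq (real N - 2) (F r)) \<longlongrightarrow> 0) L"
    if "((\<lambda>r. sobolev_sq (real N) (F r)) \<longlongrightarrow> 0) L" for F and L :: "real filter"
    by (rule tendsto_sandwich[OF always_eventually always_eventually tendsto_const that]) (auto intro: sob_mono)
  have finN: "sobolev_sq (real N) (U t) < \<infinity>" "sobolev_sq (real N) (V t) < \<infinity>" if "t \<ge> 0" for t
    using cont that by (auto simp: sobolev_continuous_def)
  define uu vv where "uu = weighted_sq (real N) u0" and "vv = weighted_sq (real N) v0"
  have uu: "uu = sobolev_sq (real N) (U 0)" and vv: "vv = sobolev_sq (real N) (V 0)"
    by (simp_all add: uu_def vv_def sob u0_def [abs_def] v0_def [abs_def])
  have conv_W: "weighted_sq (real N) (conv \<mu> W) \<le> ennreal (n\<^sup>2) * uu"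
  proof -
    have "weighted_sq (real N) (conv \<mu> W) \<le> ennreal (n\<^sup>2) * weighted_sq (real N) W"
      by (rule conv_bound) auto
    also have "\<dots> \<le> ennreal (n\<^sup>2) * uu"
      unfolding uu_def by (intro mult_left_mono weighted_sq_mono) (auto simp: W_def)
    finally show ?thesis .
  qed
  have Y0_le: "weighted_sq (real N) Y0 \<le> ennreal (2 * exp (5 * pi)) * (uu + vv)"
  proof -
    have "weighted_sq (real N) Y0 = ennreal (e3\<^sup>2) * weighted_sq (real N) (\<lambda>\<kappa>. v0 \<kappa> + ennreal el * conv \<mu> W \<kappa>)"
      unfolding Y0_def using e3 by (subst weighted_sq_cmult) (auto simp: ennreal_power)
    also have "\<dots> \<le> ennreal (e3\<^sup>2) * (2 * vv + 2 * weighted_sq (real N) (\<lambda>\<kappa>. ennreal el * conv \<mu> W \<kappa>))"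
      unfolding vv_def by (intro mult_left_mono weighted_sq_add_le2) auto
    also have "weighted_sq (real N) (\<lambda>\<kappa>. ennreal el * conv \<mu> W \<kappa>) = ennreal (el\<^sup>2) * weighted_sq (real N) (conv \<mu> W)"
      using el by (subst weighted_sq_cmult) (auto simp: ennreal_power)
    also have "ennreal (el\<^sup>2) * weighted_sq (real N) (conv \<mu> W) \<le> ennreal (el\<^sup>2) * (ennreal (n\<^sup>2) * uu)"
      by (intro mult_left_mono conv_W) auto
    also have "\<dots> = ennreal (exp (2 * pi)) * uu"
      using n by (subst ennreal_mult_mult) (auto simp: el_def power_divide exp_double [symmetric])
    finally have "weighted_sq (real N) Y0 \<le> ennreal (e3\<^sup>2) * (2 * vv + 2 * (ennreal (exp (2 * pi)) * uu))"
      by (simp add: add_left_mono mult_left_mono)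
    also have "\<dots> \<le> ennreal (e3\<^sup>2) * (2 * (ennreal (exp (2 * pi)) * vv) + 2 * (ennreal (exp (2 * pi)) * uu))"
      using mult_right_mono[OF one_le_ennreal[of "exp (2 * pi)"], of vv]
      by (intro mult_left_mono add_right_mono) auto
    also have "\<dots> = ennreal (e3\<^sup>2) * (ennreal (2 * exp (2 * pi)) * (uu + vv))"
      by (simp add: ennreal_mult distrib_left mult.assoc add_ac)
    also have "\<dots> = ennreal (2 * exp (5 * pi)) * (uu + vv)"
      by (subst ennreal_mult_mult) (auto simp: e3_def exp_double [symmetric] exp_add [symmetric] mult.left_commute)
    finally show ?thesis .
  qed
  define cY where "cY = 2 * exp (5 * pi) / (1 - \<rho>)\<^sup>2"
  have cY: "cY \<ge> 0" by (simp add: cY_def)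
  have Y_le: "weighted_sq (real N) Y \<le> ennreal cY * (uu + vv)"
  proof -
    have "weighted_sq (real N) Y \<le> ennreal (1 / (1 - \<rho>)\<^sup>2) * (ennreal (2 * exp (5 * pi)) * (uu + vv))"
      by (intro order_trans[OF Y(3)] mult_left_mono Y0_le) auto
    then show ?thesis by (simp add: ennreal_mult_mult cY_def)
  qed
  have fin0: "uu < \<infinity>" "vv < \<infinity>" using finN[of 0] by (auto simp: uu vv)
  have Y_fin: "weighted_sq (real N) Y < \<infinity>"
    using fin0 by (intro order_le_less_trans[OF Y_le]) (auto simp: ennreal_mult_less_top)
  have E_fin: "weighted_sq (real N - 2) E < \<infinity>"
  proof -
    have "weighted_sq (real N - 2) E \<le> weighted_sq (real N) E"
      by (rule weighted_sq_order_mono) simp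
    also have "\<dots> = ennreal (c\<^sup>2) * weighted_sq (real N) (\<lambda>\<kappa>. conv \<mu> Y \<kappa> + (u0 \<kappa> + Y \<kappa>))"
      unfolding E_def using c by (subst weighted_sq_cmult) (auto simp: ennreal_power)
    also have "\<dots> \<le> ennreal (c\<^sup>2) * (2 * weighted_sq (real N) (conv \<mu> Y) + 2 * weighted_sq (real N) (\<lambda>\<kappa>. u0 \<kappa> + Y \<kappa>))"
      by (intro mult_left_mono weighted_sq_add_le2) auto
    also have "\<dots> \<le> ennreal (c\<^sup>2) * (2 * (ennreal (n\<^sup>2) * weighted_sq (real N) Y) + 2 * (2 * uu + 2 * weighted_sq (real N) Y))"
      unfolding uu_def by (intro mult_left_mono add_mono weighted_sq_add_le2 conv_bound) auto
    also have "\<dots> < \<infinity>"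
      using fin0 Y_fin by (auto simp: ennreal_mult_less_top)
    finally show ?thesis .
  qed
  have AE: "AE \<kappa> in frequencies. ennreal (cmod (U t \<kappa>)) \<le> Ob t \<kappa> \<and> ennreal (cmod (V t \<kappa>)) \<le> Bb t \<kappa>"
  proof (rule comparison_principle[where s = "real N - 2" and P = P and d = d and b = b and E = E and c = "n\<^sup>2"])
    show "weighted_sq (real N - 2) (conv \<mu> g) \<le> ennreal (n\<^sup>2) * weighted_sq (real N - 2) g"
      if "g \<in> borel_measurable frequencies" for g
      using that by (rule conv_bound) linarith
    show "sobolev_sq (real N - 2) (U t) < \<infinity>" "sobolev_sq (real N - 2) (V t) < \<infinity>" if "t \<ge> 0" for t
      using finN[OF that] by (auto intro: order_le_less_trans[OF sob_mono])
    show "((\<lambda>r. sobolev_sq (real N - 2) (\<lambda>\<kappa>. U r \<kappa> - U t \<kappa>)) \<longlongrightarrow> 0) (at_right t)"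
      "((\<lambda>r. sobolev_sq (real N - 2) (\<lambda>\<kappa>. V r \<kappa> - V t \<kappa>)) \<longlongrightarrow> 0) (at_right t)" if "t \<ge> 0" for t
    proof -
      have "{t<..} \<subseteq> {0..}" using that by auto
      then have "((\<lambda>r. sobolev_sq (real N) (\<lambda>\<kappa>. U r \<kappa> - U t \<kappa>)) \<longlongrightarrow> 0) (at_right t)"
        "((\<lambda>r. sobolev_sq (real N) (\<lambda>\<kappa>. V r \<kappa> - V t \<kappa>)) \<longlongrightarrow> 0) (at_right t)"
        using cont that by (auto simp: sobolev_continuous_def intro: tendsto_within_subset)
      then show "((\<lambda>r. sobolev_sq (real N - 2) (\<lambda>\<kappa>. U r \<kappa> - U t \<kappa>)) \<longlongrightarrow> 0) (at_right t)"
        "((\<lambda>r. sobolev_sq (real N - 2) (\<lambda>\<kappa>. V r \<kappa> - V t \<kappa>)) \<longlongrightarrow> 0) (at_right t)"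
        by (auto intro: sob_tendsto)
    qed
    show "has_sobolev_derivative (real N - 2) U (\<lambda>\<kappa>. - complex_of_real (d t \<kappa>) * U t \<kappa> + V t \<kappa>) t" if "t > 0" for t
      using deriv(1)[OF that] by (simp add: d_def)
    show "has_sobolev_derivative (real N - 2) V (P t) t" if "t > 0" for t
      using deriv(2)[OF that] unfolding has_sobolev_derivative_def
      by (rule sob_tendsto)
    show "AE \<kappa> in frequencies. ennreal (cmod (P t \<kappa>)) \<le> conv \<mu> (\<lambda>\<kappa>. ennreal (cmod (U t \<kappa>)) - Ob t \<kappa>) \<kappa> + b t \<kappa>" if "t > 0" for t
      using P[OF that]
    proof eventually_elim
      case (elim \<kappa>)
      have [measurable]: "U t \<in> borel_measurable frequencies" using meas(1)[of t] that by simp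
      note elim
      also have "conv \<mu> (\<lambda>\<kappa>. ennreal (resonance t \<kappa> * cmod (U t \<kappa>))) \<kappa> \<le>
          conv \<mu> (\<lambda>\<kappa>. (ennreal (cmod (U t \<kappa>)) - Ob t \<kappa>) + ennreal (resonance t \<kappa>) * Ob t \<kappa>) \<kappa>"
      proof (rule conv_mono)
        fix \<kappa>
        let ?x = "ennreal (cmod (U t \<kappa>)) - Ob t \<kappa>"
        have "ennreal (resonance t \<kappa> * cmod (U t \<kappa>)) = ennreal (resonance t \<kappa>) * ennreal (cmod (U t \<kappa>))"
          using resonance_nonneg by (simp add: ennreal_mult)
        also have "\<dots> \<le> ennreal (resonance t \<kappa>) * (Ob t \<kappa> + ?x)"
          by (intro mult_left_mono) (simp_all add: ennreal_minus_le_iff [THEN iffD1])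
        also have "\<dots> = ennreal (resonance t \<kappa>) * ?x + ennreal (resonance t \<kappa>) * Ob t \<kappa>"
          by (simp add: distrib_left add_ac)
        also have "\<dots> \<le> ennreal 1 * ?x + ennreal (resonance t \<kappa>) * Ob t \<kappa>"
          by (intro add_right_mono mult_right_mono ennreal_leI resonance_le_1) auto
        finally show "ennreal (resonance t \<kappa> * cmod (U t \<kappa>)) \<le> ?x + ennreal (resonance t \<kappa>) * Ob t \<kappa>" by simp
      qed
      also have "\<dots> = conv \<mu> (\<lambda>\<kappa>. ennreal (cmod (U t \<kappa>)) - Ob t \<kappa>) \<kappa> + b t \<kappa>"
        unfolding b_def by (rule conv_add) (auto simp: sets)
      finally show ?case .
    qed
    show "ennreal (cmod (U 0 \<kappa>)) \<le> Ob 0 \<kappa>" "ennreal (cmod (V 0 \<kappa>)) \<le> Bb 0 \<kappa>" for \<kappa>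
      by (auto simp: Ob_def Bb_def u0_def v0_def)
  qed (use sig sets meas d_nonneg E_fin B_step O_step B_mono O_decrease t in auto)
  have V_le: "sobolev_sq (real N) (V t) \<le> ennreal (exp (3 * pi)) * weighted_sq (real N) Y"
  proof -
    have "sobolev_sq (real N) (V t) \<le> weighted_sq (real N) (\<lambda>\<kappa>. ennreal e3 * Y \<kappa>)"
      unfolding sob by (intro weighted_sq_mono_AE eventually_mono[OF AE]) (blast intro: order_trans B_le3[OF t])
    also have "\<dots> = ennreal (exp (3 * pi)) * weighted_sq (real N) Y"
      using e3 by (subst weighted_sq_cmult) (auto simp: ennreal_power e3_def exp_double [symmetric])
    finally show ?thesis .
  qed
  have U_le: "sobolev_sq (real N) (U t) \<le> ennreal (2 * exp (2 * pi)) * uu + ennreal (18 * exp (3 * pi) / n\<^sup>2) * weighted_sq (real N) Y"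
  proof -
    have O_le: "Ob t \<kappa> \<le> ennreal (exp pi) * u0 \<kappa> + ennreal (3 / n * e3) * Y \<kappa>" for \<kappa>
    proof (cases "fst \<kappa> = 0")
      case True
      have "1 * u0 \<kappa> \<le> ennreal (exp pi) * u0 \<kappa>"
        by (intro mult_right_mono one_le_ennreal) auto
      then show ?thesis using True by (auto simp: Ob_def intro: order_trans)
    next
      case False
      have "decay n t s \<le> exp pi" for s
      proof -
        have "exp pi * exp (- (n * t)) \<le> exp pi * 1" using n t by (intro mult_left_mono) auto
        then show ?thesis using decay_le[of n t s] by linarith
      qed
      moreover have "lag n s \<le> 3 / n" for s
        using lag_le[OF n, of s] \<kappa>0 by (simp add: \<kappa>0_def)
      ultimately have "Ob t \<kappa> \<le> ennreal (exp pi) * u0 \<kappa> + ennreal (3 / n) * (ennreal e3 * Y \<kappa>)"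
        using False n unfolding Ob_def by (auto intro!: add_mono mult_mono mult_right_mono ennreal_leI B_le3 t)
      then show ?thesis using n e3 by (simp add: ennreal_mult_mult)
    qed
    have "sobolev_sq (real N) (U t) \<le> weighted_sq (real N) (\<lambda>\<kappa>. ennreal (exp pi) * u0 \<kappa> + ennreal (3 / n * e3) * Y \<kappa>)"
      unfolding sob by (intro weighted_sq_mono_AE eventually_mono[OF AE]) (blast intro: order_trans O_le)
    also have "\<dots> \<le> 2 * weighted_sq (real N) (\<lambda>\<kappa>. ennreal (exp pi) * u0 \<kappa>) + 2 * weighted_sq (real N) (\<lambda>\<kappa>. ennreal (3 / n * e3) * Y \<kappa>)"
      by (rule weighted_sq_add_le2) measurable
    also have "weighted_sq (real N) (\<lambda>\<kappa>. ennreal (exp pi) * u0 \<kappa>) = ennreal (exp (2 * pi)) * uu"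
      by (subst weighted_sq_cmult) (auto simp: ennreal_power uu_def exp_double [symmetric])
    also have "weighted_sq (real N) (\<lambda>\<kappa>. ennreal (3 / n * e3) * Y \<kappa>) = ennreal (9 * exp (3 * pi) / n\<^sup>2) * weighted_sq (real N) Y"
      using n e3 by (subst weighted_sq_cmult) (auto simp: ennreal_power e3_def power_mult_distrib power_divide exp_double [symmetric])
    also have "2 * (ennreal (exp (2 * pi)) * uu) = ennreal (2 * exp (2 * pi)) * uu"
      by (simp add: ennreal_mult mult.assoc)
    also have "2 * (ennreal (9 * exp (3 * pi) / n\<^sup>2) * weighted_sq (real N) Y) = ennreal (18 * exp (3 * pi) / n\<^sup>2) * weighted_sq (real N) Y"
      using ennreal_mult_mult[of 2 "9 * exp (3 * pi) / n\<^sup>2"] by simp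
    finally show ?thesis .
  qed
  have "sobolev_sq (real N) (U t) + sobolev_sq (real N) (V t) \<le>
      ennreal (2 * exp (2 * pi)) * uu + ennreal (18 * exp (3 * pi) / n\<^sup>2 + exp (3 * pi)) * weighted_sq (real N) Y"
    using add_mono[OF U_le V_le] by (simp add: distrib_right add_ac)
  also have "\<dots> \<le> ennreal (2 * exp (2 * pi)) * (uu + vv) + ennreal (18 * exp (3 * pi) / n\<^sup>2 + exp (3 * pi)) * (ennreal cY * (uu + vv))"
    by (intro add_mono mult_left_mono Y_le) auto
  also have "\<dots> = ennreal (2 * exp (2 * pi) + (18 * exp (3 * pi) / n\<^sup>2 + exp (3 * pi)) * cY) * (uu + vv)"
    using cY by (subst ennreal_mult_mult) (auto simp: distrib_right [symmetric] ennreal_plus [symmetric] simp del: ennreal_plus)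
  also have "\<dots> \<le> ennreal ((2 * exp (2 * pi) + 36 * exp (8 * pi) / (1 - 25 / 81 * pi)\<^sup>2) * (1 + 1 / n\<^sup>2)) * (uu + vv)"
  proof (intro mult_right_mono ennreal_leI)
    have "(18 * exp (3 * pi) / n\<^sup>2 + exp (3 * pi)) * cY \<le> (18 * exp (3 * pi) * (1 + 1 / n\<^sup>2)) * cY"
      using cY by (intro mult_right_mono) (simp_all add: distrib_left)
    also have "\<dots> = 36 * exp (8 * pi) / (1 - 25 / 81 * pi)\<^sup>2 * (1 + 1 / n\<^sup>2)"
      by (simp add: cY_def \<rho>_def exp_add [symmetric] mult.assoc)
    finally show "2 * exp (2 * pi) + (18 * exp (3 * pi) / n\<^sup>2 + exp (3 * pi)) * cY \<le>
        (2 * exp (2 * pi) + 36 * exp (8 * pi) / (1 - 25 / 81 * pi)\<^sup>2) * (1 + 1 / n\<^sup>2)"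
      unfolding distrib_right by (intro add_mono) (simp_all add: distrib_left)
  qed auto
  finally show ?thesis unfolding uu vv .
qed

section \<open>Boundedness of solutions\<close>
lemma has_fourier_fourier: "f \<in> sobolev s \<Longrightarrow> has_fourier f (fourier f)"
  unfolding sobolev_def fourier_def by (auto intro: someI [where P = "has_fourier f"])

lemma borel_measurable_dx:
  assumes [measurable]: "F \<in> borel_measurable frequencies"
  shows "dx F \<in> borel_measurable frequencies"
  unfolding dx_def case_prod_beta' by measurable

lemma sobolev_sq_dx_le: "sobolev_sq s (dx F) \<le> sobolev_sq (s + 1) F"
  unfolding sobolev_sq_eq_weighted_sq weighted_sq_def
proof (rule nn_integral_mono)
  fix \<kappa> :: "int \<times> real"
  have "freq_weight \<kappa> powr s * (cmod (dx F \<kappa>))\<^sup>2 = freq_weight \<kappa> powr s * (of_int (fst \<kappa>))\<^sup>2 * (cmod (F \<kappa>))\<^sup>2"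
    by (cases \<kappa>) (simp add: dx_def norm_mult power_mult_distrib)
  also have "\<dots> \<le> freq_weight \<kappa> powr s * freq_weight \<kappa> * (cmod (F \<kappa>))\<^sup>2"
    by (intro mult_right_mono mult_left_mono) (auto simp: freq_weight_def)
  also have "freq_weight \<kappa> powr s * freq_weight \<kappa> = freq_weight \<kappa> powr (s + 1)"
    using freq_weight_pos[of \<kappa>] by (simp add: powr_add)
  finally show "ennreal (freq_weight \<kappa> powr s) * (ennreal (cmod (dx F \<kappa>)))\<^sup>2 \<le>
      ennreal (freq_weight \<kappa> powr (s + 1)) * (ennreal (cmod (F \<kappa>)))\<^sup>2"
    by (simp add: ennreal_power ennreal_leI flip: ennreal_mult)
qed

theorem theorem3p2:
  fixes N :: nat
  shows "\<exists>C>0. \<forall>(\<nu>::real) (T :: real \<Rightarrow> real) (M :: real measure) (h :: real \<Rightarrow> complex).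
    \<nu> > 0 \<longrightarrow>
    (\<forall>y. T differentiable (at y)) \<longrightarrow>
    has_fourier_measure (deriv T) M h \<longrightarrow>
    (\<integral>\<^sup>+\<xi>. ennreal ((1 + \<bar>\<xi>\<bar>) ^ (N + 5) * cmod (h \<xi>)) \<partial>M) \<le> ennreal (\<nu> powr (1/3) / 4 ^ N) \<longrightarrow>
    (\<forall>\<omega>\<^sub>0 \<theta>\<^sub>0 \<omega> \<theta>.
      \<omega>\<^sub>0 \<in> sobolev (real N) \<longrightarrow> \<theta>\<^sub>0 \<in> sobolev (real (N + 1)) \<longrightarrow>
      boussinesq_solution \<nu> T N \<omega>\<^sub>0 \<theta>\<^sub>0 \<omega> \<theta> \<longrightarrow>
      (\<forall>t>0.
        sobolev_sq (real N) (fourier (\<omega> t)) + sobolev_sq (real N) (dx (fourier (\<theta> t)))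
        \<le> ennreal (C * (1 + \<nu> powr (-2/3))\<^sup>2) *
          (sobolev_sq (real N) (fourier \<omega>\<^sub>0) + sobolev_sq (real (N + 1)) (fourier \<theta>\<^sub>0))))"
proof -
  define C where "C = 2 * exp (2 * pi) + 36 * exp (8 * pi) / (1 - 25 / 81 * pi)\<^sup>2"
  have C: "C > 0" by (auto simp: C_def intro!: add_pos_nonneg)
  show ?thesis
  proof (intro exI[of _ C] conjI C allI impI)
    fix \<nu> :: real and T :: "real \<Rightarrow> real" and M :: "real measure" and h :: "real \<Rightarrow> complex"
      and \<omega>\<^sub>0 \<theta>\<^sub>0 :: "real \<times> real \<Rightarrow> real" and \<omega> \<theta> :: "real \<Rightarrow> real \<times> real \<Rightarrow> real" and t :: real
    assume \<nu>: "\<nu> > 0" and fm: "has_fourier_measure (deriv T) M h"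
      and small: "(\<integral>\<^sup>+\<xi>. ennreal ((1 + \<bar>\<xi>\<bar>) ^ (N + 5) * cmod (h \<xi>)) \<partial>M) \<le> ennreal (\<nu> powr (1/3) / 4 ^ N)"
      and sol: "boussinesq_solution \<nu> T N \<omega>\<^sub>0 \<theta>\<^sub>0 \<omega> \<theta>" and t: "t > 0"
    define n where "n = \<nu> powr (1 / 3)"
    have n: "n > 0" using \<nu> by (simp add: n_def)
    have n3: "n ^ 3 = \<nu>" using \<nu> by (simp add: n_def powr_power)
    define \<mu> where "\<mu> = fourier_density_measure M h"
    have sets_M [measurable_cong]: "sets M = sets borel" and h [measurable]: "h \<in> borel_measurable borel"
      using fm by (auto simp: has_fourier_measure_def)
    have sets [measurable_cong]: "sets \<mu> = sets borel" by (simp add: \<mu>_def sets_M)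
    have moment: "(\<integral>\<^sup>+\<eta>. ennreal ((1 + \<bar>\<eta>\<bar>) ^ (N + 5)) \<partial>\<mu>) \<le> ennreal n"
    proof -
      have "(\<integral>\<^sup>+\<eta>. ennreal ((1 + \<bar>\<eta>\<bar>) ^ (N + 5)) \<partial>\<mu>) =
          (\<integral>\<^sup>+\<eta>. ennreal (cmod (h \<eta>)) * ennreal ((1 + \<bar>\<eta>\<bar>) ^ (N + 5)) \<partial>M)"
        unfolding \<mu>_def fourier_density_measure_def by (rule nn_integral_density) measurable
      also have "\<dots> = (\<integral>\<^sup>+\<xi>. ennreal ((1 + \<bar>\<xi>\<bar>) ^ (N + 5) * cmod (h \<xi>)) \<partial>M)"
        by (intro nn_integral_cong) (simp add: ennreal_mult mult.commute)
      also have "\<dots> \<le> ennreal (n / 4 ^ N)" using small by (simp add: n_def)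
      also have "\<dots> \<le> ennreal n" using n by (intro ennreal_leI) (simp add: divide_le_eq mult_left_le)
      finally show ?thesis .
    qed
    have mu: "finite_measure \<mu>"
    proof
      have "emeasure \<mu> (space \<mu>) = (\<integral>\<^sup>+\<eta>. 1 \<partial>\<mu>)" by simp
      also have "\<dots> \<le> (\<integral>\<^sup>+\<eta>. ennreal ((1 + \<bar>\<eta>\<bar>) ^ (N + 5)) \<partial>\<mu>)"
        by (intro nn_integral_mono one_le_ennreal one_le_power) auto
      also have "\<dots> \<le> ennreal n" by (rule moment)
      finally show "emeasure \<mu> (space \<mu>) \<noteq> \<infinity>" by (auto simp: top_unique)
    qed
    define U V where "U r = fourier (\<omega> r)" and "V r = dx (fourier (\<theta> r))" for r
    have U_fourier: "has_fourier (\<omega> r) (U r)" and \<theta>_fourier: "has_fourier (\<theta> r) (fourier (\<theta> r))" if "r \<ge> 0" for r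
      using sol that unfolding boussinesq_solution_def U_def by (auto intro: has_fourier_fourier)
    have U_meas: "U r \<in> borel_measurable frequencies" and V_meas: "V r \<in> borel_measurable frequencies" if "r \<ge> 0" for r
      using U_fourier[OF that] \<theta>_fourier[OF that] unfolding V_def by (auto simp: has_fourier_def intro: borel_measurable_dx)
    define D where "D r P \<longleftrightarrow> P \<in> borel_measurable frequencies \<and> has_sobolev_derivative (real N) V P r \<and>
        (AE \<kappa> in frequencies. ennreal (cmod (P \<kappa>)) \<le> conv \<mu> (\<lambda>\<kappa>. ennreal (resonance r \<kappa> * cmod (U r \<kappa>))) \<kappa>)" for r P
    have "\<forall>r. \<exists>P. r > 0 \<longrightarrow> D r P"
    proof (intro allI)
      fix r :: real
      show "\<exists>P. r > 0 \<longrightarrow> D r P"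
      proof (cases "r > 0")
        case True
        then obtain g P where gP: "has_fourier g (dxx_inv_laplace r (U r))"
          "has_fourier (\<lambda>(x, y). - deriv T y * g (x, y)) P" "has_sobolev_derivative (real N) V P r"
          using sol unfolding boussinesq_solution_def U_def V_def by blast
        have "AE \<kappa> in frequencies. ennreal (cmod (P \<kappa>)) \<le> conv \<mu> (\<lambda>\<kappa>. ennreal (cmod (dxx_inv_laplace r (U r) \<kappa>))) \<kappa>"
        proof (rule has_fourier_mult_le[OF gP(1,2) mu sets])
          show "(\<lambda>\<eta>. sgn (h \<eta>)) \<in> borel_measurable borel" unfolding sgn_div_norm by measurable
          show "AE y in lborel. complex_of_real (deriv T y) = (LINT \<eta>|\<mu>. sgn (h \<eta>) * cis (y * \<eta>))"
            unfolding \<mu>_def by (rule has_fourier_measure_inversion[OF fm mu[unfolded \<mu>_def]])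
        qed (simp add: norm_sgn)
        then show ?thesis using gP by (auto simp: D_def cmod_dxx_inv_laplace has_fourier_def)
      qed simp
    qed
    then obtain P where "\<forall>r. r > 0 \<longrightarrow> D r (P r)"
      by (rule choice [THEN exE])
    then have P: "\<And>r. r > 0 \<Longrightarrow> P r \<in> borel_measurable frequencies"
      "\<And>r. r > 0 \<Longrightarrow> has_sobolev_derivative (real N) V (P r) r"
      "\<And>r. r > 0 \<Longrightarrow> AE \<kappa> in frequencies. ennreal (cmod (P r \<kappa>)) \<le> conv \<mu> (\<lambda>\<kappa>. ennreal (resonance r \<kappa> * cmod (U r \<kappa>))) \<kappa>"
      by (auto simp: D_def)
    have "sobolev_sq (real N) (U t) + sobolev_sq (real N) (V t) \<le>
        ennreal (C * (1 + 1 / n\<^sup>2)) * (sobolev_sq (real N) (U 0) + sobolev_sq (real N) (V 0))"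
      unfolding C_def
    proof (rule linear_boussinesq_bound[OF n mu sets moment U_meas V_meas])
      show "sobolev_continuous (real N) U" "sobolev_continuous (real N) V"
        using sol by (simp_all add: boussinesq_solution_def U_def [abs_def] V_def [abs_def])
      show "has_sobolev_derivative (real N - 2) U
          (\<lambda>\<kappa>. - complex_of_real (n ^ 3 * (snd \<kappa> - of_int (fst \<kappa>) * r)\<^sup>2) * U r \<kappa> + V r \<kappa>) r" if "r > 0" for r
      proof -
        have "(\<lambda>\<kappa>. - complex_of_real (n ^ 3 * (snd \<kappa> - of_int (fst \<kappa>) * r)\<^sup>2) * U r \<kappa> + V r \<kappa>) =
            (\<lambda>\<kappa>. complex_of_real \<nu> * dy_shear r (dy_shear r (U r)) \<kappa> + V r \<kappa>)"
        proof
          fix \<kappa> :: "int \<times> real"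
          show "- complex_of_real (n ^ 3 * (snd \<kappa> - of_int (fst \<kappa>) * r)\<^sup>2) * U r \<kappa> + V r \<kappa> =
              complex_of_real \<nu> * dy_shear r (dy_shear r (U r)) \<kappa> + V r \<kappa>"
            unfolding n3 by (cases \<kappa>) (simp add: dy_shear_def power2_eq_square algebra_simps)
        qed
        then show ?thesis using sol that by (simp add: boussinesq_solution_def U_def [abs_def] V_def [abs_def])
      qed
      show "V 0 (0, \<xi>) = 0" for \<xi> by (simp add: V_def dx_def)
    qed (use P t in auto)
    also have "\<dots> \<le> ennreal (C * (1 + \<nu> powr (-2/3))\<^sup>2) *
        (sobolev_sq (real N) (fourier \<omega>\<^sub>0) + sobolev_sq (real (N + 1)) (fourier \<theta>\<^sub>0))"
    proof (rule mult_mono)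
      have "n\<^sup>2 = \<nu> powr (2 / 3)" using \<nu> by (simp add: n_def powr_power)
      then have "1 / n\<^sup>2 = \<nu> powr (- 2 / 3)" by (simp add: powr_minus_divide)
      moreover have "1 + x \<le> (1 + x)\<^sup>2" if "x \<ge> 0" for x :: real
        using that by (simp add: power2_eq_square algebra_simps)
      ultimately show "ennreal (C * (1 + 1 / n\<^sup>2)) \<le> ennreal (C * (1 + \<nu> powr (-2/3))\<^sup>2)"
        using C by (intro ennreal_leI mult_left_mono) auto
      have "sobolev_sq (real N) (V 0) \<le> sobolev_sq (real N + 1) (fourier (\<theta> 0))"
        unfolding V_def by (rule sobolev_sq_dx_le)
      then show "sobolev_sq (real N) (U 0) + sobolev_sq (real N) (V 0) \<le>
          sobolev_sq (real N) (fourier \<omega>\<^sub>0) + sobolev_sq (real (N + 1)) (fourier \<theta>\<^sub>0)"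
        using sol by (intro add_mono) (auto simp: boussinesq_solution_def U_def add.commute)
    qed auto
    finally show "sobolev_sq (real N) (fourier (\<omega> t)) + sobolev_sq (real N) (dx (fourier (\<theta> t)))
        \<le> ennreal (C * (1 + \<nu> powr (-2/3))\<^sup>2) *
          (sobolev_sq (real N) (fourier \<omega>\<^sub>0) + sobolev_sq (real (N + 1)) (fourier \<theta>\<^sub>0))"
      by (simp add: U_def V_def)
  qed
qed

end
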